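(* For every link diagram $D$ and all $i,j$, the short exact sequence $$0\to H_{i+2,j+4}(D)\xrightarrow{\ \alpha_h\ }H_{i,j}(D\#D_h)\xrightarrow{\ \beta_h\ }H_{i-2,j-4}(D)\to 0$$ (with $\alpha_h,\beta_h$ the maps described in the context, $D_h$ the Hopf link diagram) splits, so that $$H_{i,j}(D\#D_h)=H_{i+2,j+4}(D)\oplus H_{i-2,j-4}(D).$$
   Context: Diagrams: $D$ is a diagram in the plane (disc) of an unoriented framed link, with ordered crossings. At each crossing there are two smoothings: the positive-marker smoothing ($A$-smoothing) joins the two local regions swept out when the overcrossing arc is rotated counterclockwise until it meets the undercrossing arc; the negative-marker smoothing joins the other two regions. A Kauffman state $s$ assigns $+1$ or $-1$ (a positive or negative marker) to each crossing; $D_s$ is the system of circles obtained by smoothing all crossings according to $s$, and $\sigma(s)$ is the number of positive minus the number of negative markers. Khovanov homology: an enhanced state $S$ is a Kauffman state $s$ with a sign $+$ or $-$ on each circle of $D_s$; put $\sigma(S)=\sigma(s)$ and $\tau(S)=\#\{\text{positive circles}\}-\#\{\text{negative circles}\}$. $\mathcal{C}_{i,j}(D)$ is the free abelian group on enhanced states with $\sigma(S)=i$ and $\sigma(S)+2\tau(S)=j$. The differential $d_{i,j}:\mathcal{C}_{i,j}(D)\to\mathcal{C}_{i-2,j}(D)$ is $d(S)=\sum_{S'}(-1)^{t(S:S')}[S:S']S'$, the sum over enhanced states $S'$ generating $\mathcal C_{i-2,j}(D)$, where $[S:S']=1$ if the markers of $S$ and $S'$ differ at exactly one crossing $v$ and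 all circles not touching $v$ have the same sign in $S$ and $S'$, and $[S:S']=0$ otherwise; $t(S:S')$ is the number of negative markers of $S$ at crossings bigger than $v$ in the ordering. $H_{i,j}(D)=\ker(d_{i,j})/\mathrm{im}(d_{i+2,j})$. Hopf link addition: $D_h$ is the standard two-crossing diagram of the Hopf link. $D\#D_h$ is obtained from $D$ by adding a small circle meeting one arc of $D$ in exactly two crossings, the arc passing over the circle at one crossing and under it at the other. The two new crossings are placed first in the ordering of crossings of $D\#D_h$, followed by the crossings of $D$. When both new crossings have the same marker, smoothing them yields the arc of $D$ together with one additional small trivial circle. $\alpha_h$ is induced by sending an enhanced state $S$ of $D$ to the enhanced state of $D\#D_h$ with negative markers at both new crossings, negative sign on the small circle, and agreeing with $S$ elsewhere. $\beta_h$ is induced by the projection sending an enhanced state with positive markers at both new crossings and positive sign on the small circle to the corresponding enhanced state of $D$, and all other enhanced states to $0$. *)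

theory Defs
  imports "HOL-Algebra.Algebra" "HOL-Algebra.Free_Abelian_Groups"
begin

section \<open>Link diagrams\<close>

text \<open>
  A diagram of an unoriented framed link is given by its planar diagram code: the arcs between
  consecutive crossings carry labels, and a crossing is the list of the labels of its four ends in
  counterclockwise order, starting at one of the two ends of the undercrossing arc.  So entries 0
  and 2 belong to the undercrossing arc and entries 1 and 3 to the overcrossing arc.  The order of
  the crossings is the order of the list.  Components without crossings are not seen by the
  crossings; each of them is recorded by a label of its own in \<open>loops\<close>.
\<close>

record 'a diagram =
  crossings :: "'a list list"
  loops :: "'a set"

definition crossing_ends :: "'a diagram \<Rightarrow> (nat \<times> nat) set" where
  "crossing_ends D = {..<length (crossings D)} \<times> {..<4}"

definition label :: "'a diagram \<Rightarrow> nat \<times> nat \<Rightarrow> 'a" where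
  "label D x = crossings D ! fst x ! snd x"

definition edges :: "'a diagram \<Rightarrow> 'a set" where
  "edges D = label D ` crossing_ends D"

definition arcs :: "'a diagram \<Rightarrow> 'a set" where
  "arcs D = edges D \<union> loops D"

definition linked_classes :: "'b set \<Rightarrow> ('b \<times> 'b) set \<Rightarrow> 'b set set" where
  "linked_classes A r = A // (r \<union> r\<inverse>)\<^sup>*"

text \<open>
  The 4-valent graph with its cyclic orders at the vertices is drawn in the plane iff Euler's
  formula \<open>V - E + F = 2 C\<close> holds, where \<open>C\<close> is the number of connected components of the graph and
  the \<open>F\<close> faces are the orbits of the permutation of the crossing ends that crosses to the
  other end of the same edge and then turns to the next end around that crossing.
\<close>

definition other_end :: "'a diagram \<Rightarrow> nat \<times> nat \<Rightarrow> nat \<times> nat" where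
  "other_end D x = (THE y. y \<in> crossing_ends D \<and> y \<noteq> x \<and> label D y = label D x)"

definition next_end :: "nat \<times> nat \<Rightarrow> nat \<times> nat" where
  "next_end x = (fst x, (snd x + 1) mod 4)"

definition faces :: "'a diagram \<Rightarrow> (nat \<times> nat) set set" where
  "faces D = linked_classes (crossing_ends D)
     {(x, next_end (other_end D x)) | x. x \<in> crossing_ends D}"

definition graph_components :: "'a diagram \<Rightarrow> nat set set" where
  "graph_components D = linked_classes {..<length (crossings D)}
     {(fst x, fst y) | x y. x \<in> crossing_ends D \<and> y \<in> crossing_ends D \<and> label D x = label D y}"

definition planar :: "'a diagram \<Rightarrow> bool" where
  "planar D \<longleftrightarrow>
     int (length (crossings D)) - int (card (edges D)) + int (card (faces D))
       = 2 * int (card (graph_components D))"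

definition link_diagram :: "'a diagram \<Rightarrow> bool" where
  "link_diagram D \<longleftrightarrow>
     (\<forall>c \<in> set (crossings D). length c = 4) \<and>
     (\<forall>a \<in> edges D. card {x \<in> crossing_ends D. label D x = a} = 2) \<and>
     finite (loops D) \<and> edges D \<inter> loops D = {} \<and> planar D"


section \<open>Kauffman states and enhanced states\<close>

text \<open>
  Rotating the overcrossing arc counterclockwise sweeps out the regions between entries 1 and 2 and
  between entries 3 and 0.  The positive smoothing joins these two regions, so it connects entry 0
  with entry 1 and entry 2 with entry 3.
\<close>

definition smoothing :: "bool \<Rightarrow> 'a list \<Rightarrow> ('a \<times> 'a) set" where
  "smoothing m c =
     (if m then {(c ! 0, c ! 1), (c ! 2, c ! 3)} else {(c ! 0, c ! 3), (c ! 1, c ! 2)})"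

text \<open>
  A Kauffman state is a list of markers (\<open>True\<close> is positive), one for each crossing.  A circle is
  represented by the set of the labels of the arcs it consists of.
\<close>

definition kauffman_states :: "'a diagram \<Rightarrow> bool list set" where
  "kauffman_states D = {s. length s = length (crossings D)}"

definition circles :: "'a diagram \<Rightarrow> bool list \<Rightarrow> 'a set set" where
  "circles D s = linked_classes (arcs D)
     (\<Union>v<length (crossings D). smoothing (s ! v) (crossings D ! v))"

definition state_sigma :: "bool list \<Rightarrow> int" where
  "state_sigma s = (\<Sum>m\<leftarrow>s. if m then 1 else - 1)"

text \<open>An enhanced state is a Kauffman state together with the set of its positive circles.\<close>

type_synonym 'a estate = "bool list \<times> 'a set set"

definition enhanced_states :: "'a diagram \<Rightarrow> 'a estate set" where
  "enhanced_states D = (SIGMA s : kauffman_states D. Pow (circles D s))"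

definition sigma :: "'a estate \<Rightarrow> int" where
  "sigma S = state_sigma (fst S)"

definition tau :: "'a diagram \<Rightarrow> 'a estate \<Rightarrow> int" where
  "tau D S = int (card (snd S)) - int (card (circles D (fst S) - snd S))"

definition generators :: "'a diagram \<Rightarrow> int \<Rightarrow> int \<Rightarrow> 'a estate set" where
  "generators D i j = {S \<in> enhanced_states D. sigma S = i \<and> sigma S + 2 * tau D S = j}"


section \<open>Khovanov homology\<close>

definition touches :: "'a diagram \<Rightarrow> 'a set \<Rightarrow> nat \<Rightarrow> bool" where
  "touches D K v \<longleftrightarrow> K \<inter> set (crossings D ! v) \<noteq> {}"

definition differing :: "'a estate \<Rightarrow> 'a estate \<Rightarrow> nat set" where
  "differing S S' = {v. v < length (fst S) \<and> fst S ! v \<noteq> fst S' ! v}"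

text \<open>A circle that does not touch the crossing \<open>v\<close> is a circle of both states.\<close>

definition incidence :: "'a diagram \<Rightarrow> 'a estate \<Rightarrow> 'a estate \<Rightarrow> int" where
  "incidence D S S' =
     (if \<exists>v. differing S S' = {v} \<and>
             (\<forall>K \<in> circles D (fst S) \<union> circles D (fst S').
                \<not> touches D K v \<longrightarrow> (K \<in> snd S \<longleftrightarrow> K \<in> snd S'))
      then 1 else 0)"

definition negatives_after :: "'a estate \<Rightarrow> 'a estate \<Rightarrow> nat" where
  "negatives_after S S' =
     card {w. the_elem (differing S S') < w \<and> w < length (fst S) \<and> \<not> fst S ! w}"

definition chain_group :: "'a diagram \<Rightarrow> int \<Rightarrow> int \<Rightarrow> ('a estate \<Rightarrow>\<^sub>0 int) monoid" where
  "chain_group D i j = free_Abelian_group (generators D i j)"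

definition differential ::
    "'a diagram \<Rightarrow> int \<Rightarrow> int \<Rightarrow> ('a estate \<Rightarrow>\<^sub>0 int) \<Rightarrow> ('a estate \<Rightarrow>\<^sub>0 int)" where
  "differential D i j = frag_extend (\<lambda>S. \<Sum>S' \<in> generators D (i - 2) j.
     frag_cmul ((- 1) ^ negatives_after S S' * incidence D S S') (frag_of S'))"

definition cycles :: "'a diagram \<Rightarrow> int \<Rightarrow> int \<Rightarrow> ('a estate \<Rightarrow>\<^sub>0 int) set" where
  "cycles D i j = kernel (chain_group D i j) (chain_group D (i - 2) j) (differential D i j)"

definition boundaries :: "'a diagram \<Rightarrow> int \<Rightarrow> int \<Rightarrow> ('a estate \<Rightarrow>\<^sub>0 int) set" where
  "boundaries D i j = differential D (i + 2) j ` carrier (chain_group D (i + 2) j)"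

definition homology :: "'a diagram \<Rightarrow> int \<Rightarrow> int \<Rightarrow> ('a estate \<Rightarrow>\<^sub>0 int) set monoid" where
  "homology D i j = (chain_group D i j)\<lparr>carrier := cycles D i j\<rparr> Mod boundaries D i j"

text \<open>
  For a chain map \<open>f\<close> into the chain complex of \<open>D\<close>, this sends the class of a cycle \<open>z\<close> to the
  class of \<open>f z\<close>.
\<close>

definition induced ::
    "'a diagram \<Rightarrow> int \<Rightarrow> int \<Rightarrow> (('b estate \<Rightarrow>\<^sub>0 int) \<Rightarrow> ('a estate \<Rightarrow>\<^sub>0 int)) \<Rightarrow>
     ('b estate \<Rightarrow>\<^sub>0 int) set \<Rightarrow> ('a estate \<Rightarrow>\<^sub>0 int) set" where
  "induced D i j f Z = boundaries D i j <#>\<^bsub>chain_group D i j\<^esub> f ` Z"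

lemma induced_class:
  assumes add: "\<And>x y. f (x + y) = f x + f y"
    and bnd: "f ` boundaries E k l \<subseteq> boundaries D i j"
  shows "induced D i j f (boundaries E k l #>\<^bsub>chain_group E k l\<^esub> z)
           = boundaries D i j #>\<^bsub>chain_group D i j\<^esub> f z"
proof -
  have "f 0 = f 0 + f 0"
    using add [of 0 0] by simp
  hence f0: "f 0 = 0"
    by simp
  have d0: "0 \<in> boundaries E k l"
  proof -
    have "differential E (k + 2) l 0 = 0"
      by (simp add: differential_def)
    thus ?thesis
      unfolding boundaries_def chain_group_def by (auto simp: image_iff intro!: bexI [of _ 0])
  qed
  have bb: "b + b' \<in> boundaries D i j" if h: "b \<in> boundaries D i j" "b' \<in> boundaries D i j" for b b'
  proof -
    obtain x where x: "x \<in> carrier (chain_group D (i + 2) j)" "b = differential D (i + 2) j x"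
      using h(1) unfolding boundaries_def by blast
    obtain y where y: "y \<in> carrier (chain_group D (i + 2) j)" "b' = differential D (i + 2) j y"
      using h(2) unfolding boundaries_def by blast
    have "x + y \<in> carrier (chain_group D (i + 2) j)"
      using x y Poly_Mapping.keys_add [of x y] unfolding chain_group_def by auto
    moreover have "b + b' = differential D (i + 2) j (x + y)"
      by (simp add: x y differential_def frag_extend_add)
    ultimately show ?thesis
      unfolding boundaries_def by blast
  qed
  show ?thesis
  proof (intro equalityI subsetI)
    fix c assume "c \<in> induced D i j f (boundaries E k l #>\<^bsub>chain_group E k l\<^esub> z)"
    then obtain b e where "b \<in> boundaries D i j" "e \<in> boundaries E k l" "c = b + f (e + z)"
      by (auto simp: induced_def set_mult_def r_coset_def chain_group_def)
    moreover have "b + f e \<in> boundaries D i j"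
      using bb bnd calculation by blast
    ultimately show "c \<in> boundaries D i j #>\<^bsub>chain_group D i j\<^esub> f z"
      by (auto simp: r_coset_def chain_group_def add add.assoc intro!: bexI [of _ "b + f e"])
  next
    fix c assume "c \<in> boundaries D i j #>\<^bsub>chain_group D i j\<^esub> f z"
    then obtain b where "b \<in> boundaries D i j" "c = b + f (0 + z)"
      by (auto simp: r_coset_def chain_group_def)
    thus "c \<in> induced D i j f (boundaries E k l #>\<^bsub>chain_group E k l\<^esub> z)"
      using d0 unfolding induced_def set_mult_def r_coset_def chain_group_def
      by (force simp del: add_0)
  qed
qed


section \<open>Hopf link addition\<close>

text \<open>
  Draw the chosen arc of the diagram horizontally from left to right, so that it first passes over
  and then under the small circle.  The two crossings cut it into a left part, the part \<open>Between\<close>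
  the crossings and a right part.  The left part keeps the old label; the right part is called
  \<open>Beyond\<close>, unless the arc was a component without crossings, in which case left and right part are
  the same arc.  The small circle is cut into \<open>Upper_half\<close> and \<open>Lower_half\<close>.
\<close>

datatype 'a hopf_label = Old 'a | Between | Beyond | Upper_half | Lower_half

text \<open>
  The place of the addition is an arc with a direction.  For an arc that ends at crossings it is
  given by the crossing end at which the directed arc arrives; the two ends of an arc give the two
  ways to choose at which of the two new crossings the arc passes over.  A component without
  crossings is given by its label; both directions lead to the same code up to exchanging the names of
  the two halves of the small circle.
\<close>

datatype 'a place = Edge_end "nat \<times> nat" | Free_loop 'a

definition is_place :: "'a diagram \<Rightarrow> 'a place \<Rightarrow> bool" where
  "is_place D p = (case p of Edge_end x \<Rightarrow> x \<in> crossing_ends D | Free_loop a \<Rightarrow> a \<in> loops D)"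

text \<open>
  The ends are listed counterclockwise from the bottom at the first of these crossings and from the
  left at the second one.  The flag \<open>ov\<close> tells whether the crossing at which the arc of the diagram
  is over precedes the other one in the ordering of crossings.
\<close>

definition hopf_crossings ::
    "bool \<Rightarrow> 'a hopf_label \<Rightarrow> 'a hopf_label \<Rightarrow> 'a hopf_label list list" where
  "hopf_crossings ov left_part right_part =
     (let arc_over = [Lower_half, Between, Upper_half, left_part];
          arc_under = [Between, Lower_half, right_part, Upper_half]
      in if ov then [arc_over, arc_under] else [arc_under, arc_over])"

definition hopf_addition :: "'a diagram \<Rightarrow> 'a place \<Rightarrow> bool \<Rightarrow> 'a hopf_label diagram" where
  "hopf_addition D p ov =
     (case p of
        Edge_end x \<Rightarrow>
          \<lparr>crossings = hopf_crossings ov (Old (label D x)) Beyond @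
             (map (map Old) (crossings D))
               [fst x := (map Old (crossings D ! fst x))[snd x := Beyond]],
           loops = Old ` loops D\<rparr>
      | Free_loop a \<Rightarrow>
          \<lparr>crossings = hopf_crossings ov (Old a) (Old a) @ map (map Old) (crossings D),
           loops = Old ` (loops D - {a})\<rparr>)"

text \<open>
  If both new crossings carry the same marker, the circles of \<open>D # D\<^sub>h\<close> are the small circle, which
  consists of \<open>Between\<close> and one half of the added circle, and one circle for each circle \<open>K\<close> of
  \<open>D\<close>, whose set of old labels is \<open>K\<close>.  In \<open>alpha_state\<close> the small circle has no old label, so
  it is not among the positive circles.
\<close>

definition alpha_state :: "'a diagram \<Rightarrow> 'a place \<Rightarrow> bool \<Rightarrow> 'a estate \<Rightarrow> 'a hopf_label estate" where
  "alpha_state D p ov S =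
     (let s' = False # False # fst S
      in (s', {K \<in> circles (hopf_addition D p ov) s'. Old -` K \<in> snd S}))"

definition alpha_chain ::
    "'a diagram \<Rightarrow> 'a place \<Rightarrow> bool \<Rightarrow> ('a estate \<Rightarrow>\<^sub>0 int) \<Rightarrow> ('a hopf_label estate \<Rightarrow>\<^sub>0 int)" where
  "alpha_chain D p ov = frag_extend (\<lambda>S. frag_of (alpha_state D p ov S))"

definition beta_state :: "'a diagram \<Rightarrow> 'a hopf_label estate \<Rightarrow> 'a estate" where
  "beta_state D S =
     (let s = drop 2 (fst S) in (s, {K \<in> circles D s. \<exists>K' \<in> snd S. Old -` K' = K}))"

definition beta_chain ::
    "'a diagram \<Rightarrow> ('a hopf_label estate \<Rightarrow>\<^sub>0 int) \<Rightarrow> ('a estate \<Rightarrow>\<^sub>0 int)" where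
  "beta_chain D = frag_extend (\<lambda>S.
     if fst S ! 0 \<and> fst S ! 1 \<and> {Between, Lower_half} \<in> snd S then frag_of (beta_state D S) else 0)"

definition alpha_h ::
    "'a diagram \<Rightarrow> 'a place \<Rightarrow> bool \<Rightarrow> int \<Rightarrow> int \<Rightarrow>
     ('a estate \<Rightarrow>\<^sub>0 int) set \<Rightarrow> ('a hopf_label estate \<Rightarrow>\<^sub>0 int) set" where
  "alpha_h D p ov i j = induced (hopf_addition D p ov) i j (alpha_chain D p ov)"

definition beta_h ::
    "'a diagram \<Rightarrow> int \<Rightarrow> int \<Rightarrow>
     ('a hopf_label estate \<Rightarrow>\<^sub>0 int) set \<Rightarrow> ('a estate \<Rightarrow>\<^sub>0 int) set" where
  "beta_h D i j = induced D (i - 2) (j - 4) (beta_chain D)"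

end

theory Submission
  imports Defs
begin

text \<open>
  Sorting the enhanced states of \<open>D # D\<^sub>h\<close> by the markers at the two new crossings and, if these
  agree, by the sign of the small circle splits the chain group of \<open>D # D\<^sub>h\<close> into six copies of
  that of \<open>D\<close>.  From \<open>++\<close> to the two copies with mixed markers the differential merges the small
  circle into the circle through the chosen arc, which is onto, and from there to \<open>--\<close> it splits the
  small circle off, which is injective.  Up to homotopy there remain the kernel of the merging and the
  cokernel of the splitting.  With \<open>M\<close> the multiplication by a positive sign on the circle through
  the arc, the kernel consists of the chains \<open>(+) x - (-) (M x)\<close> at \<open>++\<close>, where the signs in
  parentheses are those of the small circle, and mapping \<open>x\<close> to this chain is a splitting of
  \<open>\<beta>\<^sub>h\<close>; mapping \<open>(-) x + (+) y\<close> at \<open>--\<close> to \<open>x - M y\<close> is a left inverse of \<open>\<alpha>\<^sub>h\<close>.  That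
  these are chain maps needs only that \<open>M\<close> commutes with the differential of \<open>D\<close>.
\<close>

section \<open>Circles of a Kauffman state\<close>

text \<open>The signs behave like Z[X]/(X^2) with negative as 1 and positive as X: a marker turning
  negative lowers \<open>sigma\<close> by 2, so \<open>tau\<close> must grow by 1. Merging with a
  negative circle therefore keeps the other sign, and merging with a positive one is M. Hence the
  differential contains, up to sign, identities from ++ with negative small circle to each mixed
  copy and from each mixed copy to -- with positive small circle. Inverting one of each kind, with
  either mixed copy used once, removes four of the six copies; the other components of the
  differential at these four force the corrections by M. The obstacle is signs. As the new crossings
  come first, the sign of a change at an old crossing ignores the new markers, but a change at a new
  crossing has a sign depending on all old markers; it is recorded by the operator \<open>N\<close>,
  which anticommutes with the differential of \<open>D\<close>. That M commutes with the
  differential is shown one crossing at a time by counting degrees, without deciding which circles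
  merge or split. All maps are defined on chains of all bidegrees together, so that each identity is
  checked once and the grading is added afterwards.\<close>

definition linked :: "('b \<times> 'b) set \<Rightarrow> ('b \<times> 'b) set" where
  "linked r = (r \<union> r\<inverse>)\<^sup>*"

lemma linked_classes_eq: "linked_classes A r = (\<lambda>x. linked r `` {x}) ` A"
  by (auto simp: linked_classes_def linked_def quotient_def)

lemma linked_refl [simp]: "(x, x) \<in> linked r"
  by (simp add: linked_def)

lemma linked_incl: "(x, y) \<in> r \<Longrightarrow> (x, y) \<in> linked r"
  by (auto simp: linked_def)

lemma linked_sym: "(x, y) \<in> linked r \<Longrightarrow> (y, x) \<in> linked r"
proof -
  have "sym (linked r)"
    unfolding linked_def by (intro sym_rtrancl) (auto simp: sym_def)
  then show "(x, y) \<in> linked r \<Longrightarrow> (y, x) \<in> linked r"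
    by (auto simp: sym_def)
qed

lemma linked_trans: "(x, y) \<in> linked r \<Longrightarrow> (y, z) \<in> linked r \<Longrightarrow> (x, z) \<in> linked r"
  unfolding linked_def by (rule rtrancl_trans)

text \<open>The tool for showing that two labels are not linked: it suffices to find a function that
  separates them and respects every generating pair.\<close>

lemma linked_invariant:
  assumes "(x, y) \<in> linked r" and "\<And>x y. (x, y) \<in> r \<Longrightarrow> f x = f y"
  shows "f x = f y"
  using assms(1) unfolding linked_def by (induction rule: rtrancl_induct) (auto dest: assms(2))

lemma linked_in:
  assumes "(x, y) \<in> linked r" "r \<subseteq> A \<times> A" "x \<in> A"
  shows "y \<in> A"
  using linked_invariant [OF assms(1), of "\<lambda>x. x \<in> A"] assms(2,3) by auto

lemma linked_class_eq_iff: "linked r `` {x} = linked r `` {y} \<longleftrightarrow> (x, y) \<in> linked r"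
  by (auto dest: equalityD2 intro: linked_refl) (meson linked_trans linked_sym)+

text \<open>A path that starts in a class never leaves it, so pairs that miss the class cannot
  influence it. This is what keeps a circle unchanged when a marker is changed at a crossing that it
  does not meet.\<close>

lemma linked_class_local:
  assumes local: "\<And>y z. y \<in> linked r `` {x} \<or> z \<in> linked r `` {x} \<Longrightarrow> (y, z) \<in> r \<longleftrightarrow> (y, z) \<in> r'"
  shows "linked r' `` {x} = linked r `` {x}"
proof (intro equalityI subsetI)
  fix y assume "y \<in> linked r' `` {x}"
  then have "(x, y) \<in> (r' \<union> r'\<inverse>)\<^sup>*"
    by (simp add: linked_def)
  then show "y \<in> linked r `` {x}"
  proof (induction rule: rtrancl_induct)
    case base
    then show ?case by simp
  next
    case (step y z)
    then have "(y, z) \<in> r \<or> (z, y) \<in> r"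
      using local by blast
    then have "(y, z) \<in> linked r"
      using linked_incl [of y z r] linked_sym [OF linked_incl [of z y r]] by blast
    with step.IH have "(x, z) \<in> linked r"
      using linked_trans [of x y r z] by simp
    then show ?case by simp
  qed
next
  fix y assume "y \<in> linked r `` {x}"
  then have "(x, y) \<in> (r \<union> r\<inverse>)\<^sup>*"
    by (simp add: linked_def)
  \<comment> \<open>Membership in both classes is carried along, because \<open>local\<close> speaks
    only about points of the class of \<open>r\<close>.\<close>
  then have "(x, y) \<in> linked r \<and> (x, y) \<in> linked r'"
  proof (induction rule: rtrancl_induct)
    case base
    then show ?case by simp
  next
    case (step y z)
    then have "(y, z) \<in> r' \<or> (z, y) \<in> r'" "(y, z) \<in> linked r"
      using local [of y z] local [of z y] linked_incl [of y z r] linked_sym [OF linked_incl [of z y r]] by blast+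
    then have "(y, z) \<in> linked r'"
      using linked_incl [of y z r'] linked_sym [OF linked_incl [of z y r']] by blast
    with step.IH \<open>(y, z) \<in> linked r\<close> show ?case
      using linked_trans [of x y r z] linked_trans [of x y r' z] by blast
  qed
  then show "y \<in> linked r' `` {x}"
    by simp
qed

lemma less_4_cases: "k < 4 \<longleftrightarrow> k = 0 \<or> k = 1 \<or> k = 2 \<or> k = (3 :: nat)"
  by auto

definition state_rel :: "'a diagram \<Rightarrow> bool list \<Rightarrow> ('a \<times> 'a) set" where
  "state_rel D s = (\<Union>v<length (crossings D). smoothing (s ! v) (crossings D ! v))"

lemma circles_eq: "circles D s = linked_classes (arcs D) (state_rel D s)"
  by (simp add: circles_def state_rel_def)

text \<open>A finite partition of its own union. It isolates what the counting arguments use of the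
  circles of a state; a choice of signs is then a subset of \<open>P\<close>, the positive
  blocks.\<close>

definition blocks :: "'b set set \<Rightarrow> bool" where
  "blocks P \<longleftrightarrow> finite P \<and> {} \<notin> P \<and> (\<forall>K\<in>P. \<forall>L\<in>P. K \<noteq> L \<longrightarrow> K \<inter> L = {})"

lemma blocks_finite: "blocks P \<Longrightarrow> finite P"
  by (simp add: blocks_def)

lemma blocks_eq: "blocks P \<Longrightarrow> K \<in> P \<Longrightarrow> L \<in> P \<Longrightarrow> x \<in> K \<Longrightarrow> x \<in> L \<Longrightarrow> K = L"
  unfolding blocks_def by blast

lemma blocks_nonempty: "blocks P \<Longrightarrow> K \<in> P \<Longrightarrow> K \<noteq> {}"
  unfolding blocks_def by blast

lemma circles_blocks:
  assumes "finite (arcs D)"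
  shows "blocks (circles D s)"
  unfolding blocks_def
proof (intro conjI ballI impI)
  show "finite (circles D s)"
    using assms by (simp add: circles_eq linked_classes_eq)
  show "{} \<notin> circles D s"
    by (auto simp: circles_eq linked_classes_eq) (metis Image_singleton_iff empty_iff linked_refl)
  fix K L assume "K \<in> circles D s" "L \<in> circles D s" and ne: "K \<noteq> L"
  then obtain x y where K: "K = linked (state_rel D s) `` {x}" and L: "L = linked (state_rel D s) `` {y}"
    by (auto simp: circles_eq linked_classes_eq)
  show "K \<inter> L = {}"
  proof (rule ccontr)
    assume "K \<inter> L \<noteq> {}"
    then obtain z where "(x, z) \<in> linked (state_rel D s)" "(y, z) \<in> linked (state_rel D s)"
      by (auto simp: K L)
    then have "(x, y) \<in> linked (state_rel D s)"
      by (rule linked_trans [OF _ linked_sym])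
    with ne show False
      by (simp add: K L linked_class_eq_iff)
  qed
qed

text \<open>The lemmas on chain complexes are stated under this condition so that they apply to
  \<open>D\<close> and to \<open>D # D\<^sub>h\<close> alike; \<open>well_formed_E\<close> provides
  it for the latter.\<close>

definition well_formed :: "'a diagram \<Rightarrow> bool" where
  "well_formed D \<longleftrightarrow> finite (loops D) \<and> (\<forall>c\<in>set (crossings D). length c = 4)"

lemma link_diagram_well_formed: "link_diagram D \<Longrightarrow> well_formed D"
  by (simp add: link_diagram_def well_formed_def)

lemma well_formed_finite_arcs: "well_formed D \<Longrightarrow> finite (arcs D)"
  by (simp add: arcs_def edges_def well_formed_def crossing_ends_def)

lemma crossing_set:
  assumes "well_formed D" "v < length (crossings D)"
  shows "set (crossings D ! v) = {crossings D ! v ! 0, crossings D ! v ! 1, crossings D ! v ! 2, crossings D ! v ! 3}"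
proof -
  have "length (crossings D ! v) = 4"
    using assms by (simp add: well_formed_def)
  then have "set (crossings D ! v) = (!) (crossings D ! v) ` {..<4}"
    by (metis atLeast0LessThan list.set_map map_nth set_upt)
  also have "{..<4} = {0, 1, 2, 3 :: nat}"
    by auto
  finally show ?thesis by simp
qed

lemma crossing_subset_arcs:
  assumes "well_formed D" "v < length (crossings D)"
  shows "set (crossings D ! v) \<subseteq> arcs D"
proof -
  have "crossings D ! v ! k \<in> arcs D" if "k < 4" for k
    using assms(2) that unfolding arcs_def edges_def label_def
    by (intro UnI1 image_eqI [of _ _ "(v, k)"]) (simp_all add: crossing_ends_def)
  then show ?thesis
    unfolding crossing_set [OF assms] by simp
qed

lemma state_rel_subset:
  assumes "well_formed D"
  shows "state_rel D s \<subseteq> arcs D \<times> arcs D"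
proof -
  have "smoothing m (crossings D ! v) \<subseteq> arcs D \<times> arcs D" if "v < length (crossings D)" for m v
    using crossing_subset_arcs [OF assms that] unfolding crossing_set [OF assms that] smoothing_def by auto
  then show ?thesis
    unfolding state_rel_def by blast
qed

definition circ :: "'a diagram \<Rightarrow> bool list \<Rightarrow> 'a \<Rightarrow> 'a set" where
  "circ D s a = linked (state_rel D s) `` {a}"

lemma circ_in: "a \<in> arcs D \<Longrightarrow> circ D s a \<in> circles D s"
  by (auto simp: circ_def circles_eq linked_classes_eq)

lemma circ_self [simp]: "a \<in> circ D s a"
  by (simp add: circ_def)

lemma circlesE:
  assumes "K \<in> circles D s"
  obtains a where "a \<in> arcs D" "K = circ D s a"
  using assms by (auto simp: circ_def circles_eq linked_classes_eq)

lemma well_formed_blocks: "well_formed D \<Longrightarrow> blocks (circles D s)"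
  by (rule circles_blocks [OF well_formed_finite_arcs])

lemma well_formed_finite_circles: "well_formed D \<Longrightarrow> finite (circles D s)"
  by (rule blocks_finite [OF well_formed_blocks])

section \<open>Local coefficients of a change of marker\<close>

text \<open>For \<open>T\<close> a subset of \<open>P\<close> this is the number of positive minus
  the number of negative circles, hence \<open>tau\<close>. Avoiding the set difference leaves
  linear arithmetic in two cardinals.\<close>

definition bdeg :: "'b set set \<Rightarrow> 'b set set \<Rightarrow> int" where
  "bdeg P T = 2 * int (card T) - int (card P)"

lemma card_remove_if: "finite A \<Longrightarrow> card A = card (A - {x}) + (if x \<in> A then 1 else 0)"
  using card_Suc_Diff1 [of A x] by auto

lemma remove_eq: "A - {x} = B - {x} \<Longrightarrow> finite A \<Longrightarrow> finite B \<Longrightarrow> card A = card B \<Longrightarrow> A = B"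
proof -
  assume eq: "A - {x} = B - {x}" and fin: "finite A" "finite B" and card: "card A = card B"
  have "card (A - {x}) + (if x \<in> A then 1 else 0) = card (B - {x}) + (if x \<in> B then 1 else 0)"
    by (rule trans [OF sym [OF card_remove_if [OF fin(1)]] trans [OF card card_remove_if [OF fin(2)]]])
  then have "x \<in> A \<longleftrightarrow> x \<in> B"
    unfolding eq by (simp split: if_splits)
  with eq show "A = B" by blast
qed

text \<open>Matrix entry of multiplication by X in Z[X]/(X^2) at the circle \<open>Q\<close>, where
  negative stands for 1 and positive for X: a positive \<open>Q\<close> gives 0.\<close>

definition mult_coeff :: "'b set \<Rightarrow> 'b set set \<Rightarrow> 'b set set \<Rightarrow> int" where
  "mult_coeff Q T T' = (if Q \<notin> T \<and> T' = insert Q T then 1 else 0)"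

text \<open>The unsigned matrix entry for turning a positive marker at \<open>v\<close> negative.
  The summand 1 in the degree condition comes from the grading: \<open>sigma\<close> drops by 2 and
  \<open>sigma + 2 * tau\<close> stays.\<close>

definition vcoeff :: "'a diagram \<Rightarrow> bool list \<Rightarrow> nat \<Rightarrow> 'a set set \<Rightarrow> 'a set set \<Rightarrow> int" where
  "vcoeff D s v T T' =
     (if (\<forall>Q\<in>circles D s \<union> circles D (s[v := False]). Q \<inter> set (crossings D ! v) = {} \<longrightarrow> (Q \<in> T \<longleftrightarrow> Q \<in> T')) \<and>
         bdeg (circles D (s[v := False])) T' = bdeg (circles D s) T + 1 then 1 else 0)"

definition touched :: "'a diagram \<Rightarrow> bool list \<Rightarrow> nat \<Rightarrow> 'a set set" where
  "touched D s v = {Q \<in> circles D s. Q \<inter> set (crossings D ! v) \<noteq> {}}"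

definition untouched :: "'a diagram \<Rightarrow> bool list \<Rightarrow> nat \<Rightarrow> 'a set set" where
  "untouched D s v = {Q \<in> circles D s. Q \<inter> set (crossings D ! v) = {}}"

lemma circles_touched: "circles D s = untouched D s v \<union> touched D s v" "untouched D s v \<inter> touched D s v = {}"
  by (auto simp: touched_def untouched_def)

lemma circ_eqI: "(a, b) \<in> linked (state_rel D s) \<Longrightarrow> circ D s a = circ D s b"
  by (simp add: circ_def linked_class_eq_iff)

lemma circ_eq: "K \<in> circles D s \<Longrightarrow> a \<in> K \<Longrightarrow> K = circ D s a"
  by (erule circlesE) (simp add: circ_def linked_class_eq_iff)

text \<open>A smoothing joins the four ends at the crossing in two pairs, so they lie on at most two
  circles.\<close>

lemma card_touched:
  assumes wf: "well_formed D" and v: "v < length (crossings D)"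
  shows "card (touched D s v) \<in> {1, 2}"
proof -
  let ?c = "crossings D ! v"
  have in_rel: "circ D s x = circ D s y" if "(x, y) \<in> smoothing (s ! v) ?c" for x y
    using that v by (intro circ_eqI linked_incl) (auto simp: state_rel_def)
  have "\<exists>x y. circ D s ` set ?c = {circ D s x, circ D s y}"
  proof (cases "s ! v")
    case True
    then have "circ D s (?c ! 0) = circ D s (?c ! 1)" "circ D s (?c ! 2) = circ D s (?c ! 3)"
      by (auto intro!: in_rel simp: smoothing_def)
    then show ?thesis
      unfolding crossing_set [OF wf v] by (intro exI [of _ "?c ! 0"] exI [of _ "?c ! 2"]) auto
  next
    case False
    then have "circ D s (?c ! 0) = circ D s (?c ! 3)" "circ D s (?c ! 1) = circ D s (?c ! 2)"
      by (auto intro!: in_rel simp: smoothing_def)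
    then show ?thesis
      unfolding crossing_set [OF wf v] by (intro exI [of _ "?c ! 0"] exI [of _ "?c ! 1"]) auto
  qed
  moreover have "touched D s v = circ D s ` set ?c"
  proof (intro equalityI subsetI)
    fix Q assume "Q \<in> touched D s v"
    then obtain x where "x \<in> set ?c" "x \<in> Q" "Q \<in> circles D s"
      by (auto simp: touched_def)
    then show "Q \<in> circ D s ` set ?c"
      using circ_eq [of Q D s x] by blast
  next
    fix Q assume "Q \<in> circ D s ` set ?c"
    then obtain x where x: "x \<in> set ?c" "Q = circ D s x"
      by blast
    then have "Q \<in> circles D s" "x \<in> Q \<inter> set ?c"
      using crossing_subset_arcs [OF wf v] by (auto intro: circ_in)
    then show "Q \<in> touched D s v"
      by (auto simp: touched_def)
  qed
  ultimately obtain x y where "touched D s v = {circ D s x, circ D s y}"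
    by auto
  then show ?thesis
    by (simp add: card_insert_if)
qed

text \<open>A circle that avoids \<open>v\<close> is built from smoothings at other crossings only,
  and there the two states agree; by \<open>linked_class_local\<close> it is literally the same set
  of labels in both.\<close>

lemma untouched_subset:
  assumes wf: "well_formed D" and eq: "\<And>w. w \<noteq> v \<Longrightarrow> s ! w = t ! w" and v: "v < length (crossings D)"
  shows "untouched D s v \<subseteq> untouched D t v"
proof
  fix Q assume Q: "Q \<in> untouched D s v"
  then have "Q \<in> circles D s" and un: "Q \<inter> set (crossings D ! v) = {}"
    by (simp_all add: untouched_def)
  then obtain x where x: "x \<in> arcs D" and Qx: "Q = circ D s x"
    by (blast elim: circlesE)
  have at_v: "smoothing m (crossings D ! v) \<subseteq> set (crossings D ! v) \<times> set (crossings D ! v)" for m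
    unfolding crossing_set [OF wf v] smoothing_def by auto
  have "(y, z) \<in> state_rel D s \<longleftrightarrow> (y, z) \<in> state_rel D t" if yz: "y \<in> Q \<or> z \<in> Q" for y z
  proof -
    have "(y, z) \<notin> smoothing m (crossings D ! v)" for m
      using at_v [of m] un yz by blast
    then have "(y, z) \<in> smoothing (s ! w) (crossings D ! w) \<longleftrightarrow> (y, z) \<in> smoothing (t ! w) (crossings D ! w)" for w
      using eq [of w] by (cases "w = v") simp_all
    then show ?thesis
      unfolding state_rel_def by simp
  qed
  then have "circ D t x = circ D s x"
    unfolding circ_def Qx by (rule linked_class_local)
  then show "Q \<in> untouched D t v"
    using circ_in [OF x, of t] Qx un by (simp add: untouched_def)
qed

lemma untouched_update: "well_formed D \<Longrightarrow> v < length (crossings D) \<Longrightarrow> untouched D (s[v := m]) v = untouched D s v"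
  by (intro equalityI untouched_subset) simp_all

text \<open>Once the signs agree on the untouched circles, these contribute equally to both degrees
  and cancel, so the condition concerns only the one or two circles at \<open>v\<close> before and
  after.\<close>

lemma vcoeff_eq:
  assumes wf: "well_formed D" and v: "v < length (crossings D)"
    and T: "T \<subseteq> circles D s" "T' \<subseteq> circles D (s[v := False])"
  shows "vcoeff D s v T T' =
    (if (\<forall>Q\<in>untouched D s v. Q \<in> T \<longleftrightarrow> Q \<in> T') \<and>
        2 * int (card (T' \<inter> touched D (s[v := False]) v)) - int (card (touched D (s[v := False]) v)) =
        2 * int (card (T \<inter> touched D s v)) - int (card (touched D s v)) + 1 then 1 else 0)"
proof -
  let ?t = "s[v := False]"
  have U: "untouched D ?t v = untouched D s v"
    by (rule untouched_update [OF wf v])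
  have agree: "(\<forall>Q\<in>circles D s \<union> circles D ?t. Q \<inter> set (crossings D ! v) = {} \<longrightarrow> (Q \<in> T \<longleftrightarrow> Q \<in> T')) \<longleftrightarrow>
      (\<forall>Q\<in>untouched D s v. Q \<in> T \<longleftrightarrow> Q \<in> T')"
  proof -
    have "untouched D s v = {Q \<in> circles D s \<union> circles D ?t. Q \<inter> set (crossings D ! v) = {}}"
      using U unfolding untouched_def by blast
    then show ?thesis
      by auto
  qed
  have deg: "bdeg (circles D u) R = 2 * int (card (R \<inter> untouched D u v)) - int (card (untouched D u v)) +
      (2 * int (card (R \<inter> touched D u v)) - int (card (touched D u v)))" if R: "R \<subseteq> circles D u" for R u
  proof -
    have fin: "finite (untouched D u v)" "finite (touched D u v)"
      using well_formed_finite_circles [OF wf, of u] by (simp_all add: untouched_def touched_def)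
    have "card (circles D u) = card (untouched D u v) + card (touched D u v)"
      unfolding circles_touched(1) [of D u v] by (rule card_Un_disjoint [OF fin circles_touched(2)])
    moreover have "R = (R \<inter> untouched D u v) \<union> (R \<inter> touched D u v)"
      using R circles_touched(1) [of D u v] by blast
    then have "card R = card (R \<inter> untouched D u v) + card (R \<inter> touched D u v)"
      using card_Un_disjoint [of "R \<inter> untouched D u v" "R \<inter> touched D u v"] fin circles_touched(2) [of D u v] by auto
    ultimately show ?thesis
      unfolding bdeg_def by linarith
  qed
  show ?thesis
  proof (cases "\<forall>Q\<in>untouched D s v. Q \<in> T \<longleftrightarrow> Q \<in> T'")
    case True
    then have "T \<inter> untouched D s v = T' \<inter> untouched D s v"
      by blast
    then have "bdeg (circles D ?t) T' = bdeg (circles D s) T + 1 \<longleftrightarrow>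
        2 * int (card (T' \<inter> touched D ?t v)) - int (card (touched D ?t v)) =
        2 * int (card (T \<inter> touched D s v)) - int (card (touched D s v)) + 1"
      unfolding deg [OF T(1)] deg [OF T(2)] U by auto
    with True show ?thesis
      unfolding vcoeff_def agree by simp
  next
    case False
    then show ?thesis
      unfolding vcoeff_def agree by simp
  qed
qed

text \<open>Collapses a matrix product in which one factor is \<open>mult_coeff\<close>: for given
  outer indices only the middle index \<open>R\<close> survives.\<close>

lemma sum_Pow_unique:
  assumes "finite P" "\<And>T. T \<subseteq> P \<Longrightarrow> f T = (if T = R \<and> b then c else (0 :: int))" "b \<Longrightarrow> R \<subseteq> P"
  shows "(\<Sum>T\<in>Pow P. f T) = (if b then c else 0)"
proof (cases b)
  case True
  have "(\<Sum>T\<in>Pow P. f T) = (\<Sum>T\<in>Pow P. if T = R then c else 0)"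
    using assms(2) True by (intro sum.cong) auto
  then show ?thesis
    using True assms(1,3) by (simp add: sum.delta)
next
  case False
  then show ?thesis
    using assms(2) by (simp add: sum.neutral)
qed

text \<open>
  Multiplication by the positive sign at a point commutes with changing one marker.  If the point
  lies on a circle touching the crossing, then since at most two circles touch it before and after
  the change, the degrees force all these circles to be negative before and positive after.
\<close>

lemma vcoeff_mult_commute:
  assumes wf: "well_formed D" and v: "v < length (crossings D)" and a: "a \<in> arcs D"
    and T: "T \<subseteq> circles D s" "T'' \<subseteq> circles D (s[v := False])"
  shows "(\<Sum>T'\<in>Pow (circles D s). mult_coeff (circ D s a) T T' * vcoeff D s v T' T'') =
    (\<Sum>T'\<in>Pow (circles D (s[v := False])). vcoeff D s v T T' * mult_coeff (circ D (s[v := False]) a) T' T'')"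
proof -
  let ?t = "s[v := False]"
  let ?Q = "circ D s a" and ?R = "circ D ?t a"
  let ?A = "touched D s v" and ?B = "touched D ?t v" and ?U = "untouched D s v"
  have fin: "finite (circles D u)" for u
    by (rule well_formed_finite_circles [OF wf])
  have finA: "finite ?A" "finite ?B"
    using fin by (simp_all add: touched_def)
  have U: "untouched D ?t v = ?U"
    by (rule untouched_update [OF wf v])
  have Q: "?Q \<in> circles D s" "?R \<in> circles D ?t"
    by (rule circ_in [OF a])+
  have left: "(\<Sum>T'\<in>Pow (circles D s). mult_coeff ?Q T T' * vcoeff D s v T' T'') =
      (if ?Q \<notin> T then vcoeff D s v (insert ?Q T) T'' else 0)"
    by (rule sum_Pow_unique [where R = "insert ?Q T"]) (use fin T Q in \<open>auto simp: mult_coeff_def\<close>)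
  have right: "(\<Sum>T'\<in>Pow (circles D ?t). vcoeff D s v T T' * mult_coeff ?R T' T'') =
      (if ?R \<in> T'' then vcoeff D s v T (T'' - {?R}) else 0)"
    by (rule sum_Pow_unique [where R = "T'' - {?R}"]) (use fin T Q in \<open>auto simp: mult_coeff_def\<close>)
  have sub: "insert ?Q T \<subseteq> circles D s" "T'' - {?R} \<subseteq> circles D ?t"
    using T Q by auto
  show ?thesis
  \<comment> \<open>If the circle through \<open>a\<close> avoids the crossing, it is a circle of
    both states and multiplication changes one sign that the local condition at \<open>v\<close>
    does not see.\<close>
  proof (cases "?Q \<in> ?U")
    case True
    then have "?Q \<in> circles D ?t"
      using U by (auto simp: untouched_def)
    then have R: "?R = ?Q"
      using circ_eq [of ?Q D ?t a] by simp
    have "?Q \<notin> ?A" "?Q \<notin> ?B"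
      using True by (auto simp: untouched_def touched_def)
    then have same: "insert ?Q T \<inter> ?A = T \<inter> ?A" "(T'' - {?Q}) \<inter> ?B = T'' \<inter> ?B"
      by auto
    have agree: "?Q \<notin> T \<and> (\<forall>P\<in>?U. P \<in> insert ?Q T \<longleftrightarrow> P \<in> T'') \<longleftrightarrow>
        ?Q \<in> T'' \<and> (\<forall>P\<in>?U. P \<in> T \<longleftrightarrow> P \<in> T'' - {?Q})"
      using True by blast
    have nested: "(if p then if q \<and> d then 1 else 0 else 0) = (if (p \<and> q) \<and> d then 1 else (0 :: int))" for p q d
      by simp
    show ?thesis
      unfolding left right
      unfolding R vcoeff_eq [OF wf v sub(1) T(2)] vcoeff_eq [OF wf v T(1) sub(2)[unfolded R]] nested same agree ..
  next
    case False
    then have QA: "?Q \<in> ?A"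
      using Q(1) circles_touched(1) [of D s v] by blast
    have RU: "?R \<notin> ?U"
    proof
      assume "?R \<in> ?U"
      then have "?R = ?Q"
        using circ_eq [of ?R D s a] by (simp add: untouched_def)
      with \<open>?R \<in> ?U\<close> False show False by simp
    qed
    then have RB: "?R \<in> ?B"
      using Q(2) circles_touched(1) [of D ?t v] U by blast
    have agree: "(\<forall>P\<in>?U. P \<in> insert ?Q T \<longleftrightarrow> P \<in> T'') \<longleftrightarrow> (\<forall>P\<in>?U. P \<in> T \<longleftrightarrow> P \<in> T'')"
      "(\<forall>P\<in>?U. P \<in> T \<longleftrightarrow> P \<in> T'' - {?R}) \<longleftrightarrow> (\<forall>P\<in>?U. P \<in> T \<longleftrightarrow> P \<in> T'')"
      using False RU by auto
    have cA: "card (insert ?Q T \<inter> ?A) = Suc (card (T \<inter> ?A))" if "?Q \<notin> T"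
      using that QA finA by simp
    have cB: "Suc (card ((T'' - {?R}) \<inter> ?B)) = card (T'' \<inter> ?B)" if "?R \<in> T''"
    proof -
      have "(T'' - {?R}) \<inter> ?B = T'' \<inter> ?B - {?R}"
        by blast
      then show ?thesis
        using card_Suc_Diff1 [of "T'' \<inter> ?B" ?R] that RB finA by simp
    qed
    \<comment> \<open>The 3 is the total rise of \<open>tau\<close> along either composite: 2 for a
      circle turning positive and 1 for the changed marker.\<close>
    define deg where "deg \<longleftrightarrow> 2 * int (card (T'' \<inter> ?B)) - int (card ?B) = 2 * int (card (T \<inter> ?A)) - int (card ?A) + 3"
    have extreme: "?Q \<notin> T \<and> ?R \<in> T''" if deg
    proof -
      have le: "card (T'' \<inter> ?B) \<le> card ?B"
        using finA by (intro card_mono) auto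
      moreover have "card ?A \<in> {1, 2}" "card ?B \<in> {1, 2}"
        using card_touched [OF wf v] by auto
      ultimately have "card (T \<inter> ?A) = 0" "card (T'' \<inter> ?B) = card ?B"
        using that unfolding deg_def by auto
      then have "T \<inter> ?A = {}" "T'' \<inter> ?B = ?B"
        using finA card_subset_eq [of ?B "T'' \<inter> ?B"] by auto
      then show ?thesis
        using QA RB by blast
    qed
    have 1: "(if ?Q \<notin> T then vcoeff D s v (insert ?Q T) T'' else 0) =
        (if (\<forall>P\<in>?U. P \<in> T \<longleftrightarrow> P \<in> T'') \<and> deg then 1 else 0)"
    proof (cases "?Q \<in> T")
      case True
      with extreme show ?thesis by auto
    next
      case False
      then show ?thesis
        unfolding vcoeff_eq [OF wf v sub(1) T(2)] agree cA [OF False] deg_def by simp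
    qed
    have 2: "(if ?R \<in> T'' then vcoeff D s v T (T'' - {?R}) else 0) =
        (if (\<forall>P\<in>?U. P \<in> T \<longleftrightarrow> P \<in> T'') \<and> deg then 1 else 0)"
    proof (cases "?R \<in> T''")
      case False
      with extreme show ?thesis by auto
    next
      case True
      have "2 * int (card ((T'' - {?R}) \<inter> ?B)) - int (card ?B) = 2 * int (card (T \<inter> ?A)) - int (card ?A) + 1 \<longleftrightarrow> deg"
        using cB [OF True] unfolding deg_def by linarith
      then show ?thesis
        unfolding vcoeff_eq [OF wf v T(1) sub(2)] agree using True by simp
    qed
    show ?thesis
      unfolding left right 1 2 ..
  qed
qed

section \<open>The ungraded differential\<close>

definition jdeg :: "'a diagram \<Rightarrow> 'a estate \<Rightarrow> int" where
  "jdeg D S = sigma S + 2 * tau D S"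

text \<open>The bidegree conditions, which \<open>differential\<close> puts into its range of
  summation, are moved into the coefficient, so that a single map serves all \<open>i\<close> and
  \<open>j\<close>.\<close>

definition coef :: "'a diagram \<Rightarrow> 'a estate \<Rightarrow> 'a estate \<Rightarrow> int" where
  "coef D S S' = (if sigma S' = sigma S - 2 \<and> jdeg D S' = jdeg D S
     then (- 1) ^ negatives_after S S' * incidence D S S' else 0)"

definition dgen :: "'a diagram \<Rightarrow> 'a estate \<Rightarrow> ('a estate \<Rightarrow>\<^sub>0 int)" where
  "dgen D S = (\<Sum>S'\<in>enhanced_states D. frag_cmul (coef D S S') (frag_of S'))"

definition dtot :: "'a diagram \<Rightarrow> ('a estate \<Rightarrow>\<^sub>0 int) \<Rightarrow> ('a estate \<Rightarrow>\<^sub>0 int)" where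
  "dtot D = frag_extend (dgen D)"

lemma generators_iff: "S \<in> generators D i j \<longleftrightarrow> S \<in> enhanced_states D \<and> sigma S = i \<and> jdeg D S = j"
  by (auto simp: generators_def jdeg_def)

lemma enhanced_states_iff:
  "(s, T) \<in> enhanced_states D \<longleftrightarrow> length s = length (crossings D) \<and> T \<subseteq> circles D s"
  by (simp add: enhanced_states_def kauffman_states_def)

lemma finite_enhanced_states:
  assumes "well_formed D"
  shows "finite (enhanced_states D)"
  unfolding enhanced_states_def
proof (rule finite_SigmaI)
  have "finite {s :: bool list. set s \<subseteq> UNIV \<and> length s = length (crossings D)}"
    by (rule finite_lists_length_eq) simp
  then show "finite (kauffman_states D)"
    by (simp add: kauffman_states_def)
qed (simp add: well_formed_finite_circles [OF assms])

text \<open>For a state of bidegree \<open>(i, j)\<close> the states outside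
  \<open>generators D (i - 2) j\<close> have coefficient 0, so summing over all enhanced states
  changes nothing.\<close>

lemma differential_eq_dtot:
  assumes wf: "well_formed D" and x: "x \<in> carrier (chain_group D i j)"
  shows "differential D i j x = dtot D x"
  unfolding differential_def dtot_def
proof (rule frag_extend_eq)
  fix S assume "S \<in> Poly_Mapping.keys x"
  then have S: "S \<in> generators D i j"
    using x by (auto simp: chain_group_def)
  show "(\<Sum>S'\<in>generators D (i - 2) j. frag_cmul ((- 1) ^ negatives_after S S' * incidence D S S') (frag_of S')) = dgen D S"
    unfolding dgen_def
  proof (rule sum.mono_neutral_cong_left)
    show "finite (enhanced_states D)"
      by (rule finite_enhanced_states [OF wf])
    show "generators D (i - 2) j \<subseteq> enhanced_states D"
      by (auto simp: generators_iff)
    show "\<forall>S'\<in>enhanced_states D - generators D (i - 2) j. frag_cmul (coef D S S') (frag_of S') = 0"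
      using S by (auto simp: generators_iff coef_def)
    show "frag_cmul ((- 1) ^ negatives_after S S' * incidence D S S') (frag_of S') = frag_cmul (coef D S S') (frag_of S')"
      if "S' \<in> generators D (i - 2) j" for S'
      using S that by (simp add: generators_iff coef_def)
  qed
qed

lemma tau_bdeg:
  assumes "well_formed D" "T \<subseteq> circles D s"
  shows "tau D (s, T) = bdeg (circles D s) T"
proof -
  have fin: "finite (circles D s)"
    by (rule well_formed_finite_circles [OF assms(1)])
  then have "card (circles D s - T) = card (circles D s) - card T" "card T \<le> card (circles D s)"
    using assms(2) by (auto simp: card_Diff_subset finite_subset card_mono)
  then show ?thesis
    by (simp add: tau_def bdeg_def)
qed

lemma state_sigma_update: "v < length s \<Longrightarrow> s ! v \<Longrightarrow> state_sigma (s[v := False]) = state_sigma s - 2"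
proof (induction s arbitrary: v)
  case (Cons m s)
  then show ?case
    by (cases v) (simp_all add: state_sigma_def)
qed simp

definition sg :: "bool list \<Rightarrow> nat \<Rightarrow> int" where
  "sg s v = (- 1) ^ card {w. v < w \<and> w < length s \<and> \<not> s ! w}"

lemma coef_update:
  assumes wf: "well_formed D" and s: "length s = length (crossings D)" and v: "v < length (crossings D)" "s ! v"
    and T: "T \<subseteq> circles D s" "T' \<subseteq> circles D (s[v := False])"
  shows "coef D (s, T) (s[v := False], T') = sg s v * vcoeff D s v T T'"
proof -
  have diff: "differing (s, T) (s[v := False], T') = {v}"
    using v s by (auto simp: differing_def nth_list_update)
  have neg: "negatives_after (s, T) (s[v := False], T') = card {w. v < w \<and> w < length s \<and> \<not> s ! w}"
    by (simp add: negatives_after_def diff)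
  have inc: "incidence D (s, T) (s[v := False], T') =
    (if \<forall>Q\<in>circles D s \<union> circles D (s[v := False]). Q \<inter> set (crossings D ! v) = {} \<longrightarrow> (Q \<in> T \<longleftrightarrow> Q \<in> T') then 1 else 0)"
    unfolding incidence_def diff by (simp add: touches_def)
  have sig: "sigma (s[v := False], T') = sigma (s, T) - 2"
    using v s by (simp add: sigma_def state_sigma_update)
  have "jdeg D (s[v := False], T') = jdeg D (s, T) \<longleftrightarrow> bdeg (circles D (s[v := False])) T' = bdeg (circles D s) T + 1"
    using sig unfolding jdeg_def tau_bdeg [OF wf T(1)] tau_bdeg [OF wf T(2)] by linarith
  then show ?thesis
    unfolding coef_def vcoeff_def neg inc sg_def using sig by simp
qed

text \<open>\<open>incidence\<close> only asks that the markers differ at one crossing. The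
  direction of the change comes from \<open>sigma\<close>, which would grow if the marker turned
  from negative to positive.\<close>

lemma coef_nonzero:
  assumes "S \<in> enhanced_states D" "S' \<in> enhanced_states D" "coef D S S' \<noteq> 0"
  obtains v where "v < length (crossings D)" "fst S ! v" "fst S' = (fst S)[v := False]"
proof -
  have len: "length (fst S) = length (crossings D)" "length (fst S') = length (crossings D)"
    using assms(1,2) by (cases S; cases S'; simp add: enhanced_states_iff)+
  have "incidence D S S' \<noteq> 0" and sig: "sigma S' = sigma S - 2"
    using assms(3) by (auto simp: coef_def split: if_splits)
  then obtain v where diff: "differing S S' = {v}"
    by (auto simp: incidence_def split: if_splits)
  then have v: "v < length (crossings D)" "fst S ! v \<noteq> fst S' ! v"
    using len by (auto simp: differing_def)
  have same: "fst S ! w = fst S' ! w" if "w < length (crossings D)" "w \<noteq> v" for w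
  proof (rule ccontr)
    assume "fst S ! w \<noteq> fst S' ! w"
    then have "w \<in> differing S S'"
      using that(1) len by (simp add: differing_def)
    with diff that(2) show False by simp
  qed
  have upd: "fst S' = (fst S)[v := fst S' ! v]"
    by (rule nth_equalityI) (use len v same in \<open>simp_all add: nth_list_update\<close>)
  have "fst S ! v"
  proof (rule ccontr)
    assume F: "\<not> fst S ! v"
    then have "fst S' ! v"
      using v(2) by simp
    moreover have "fst S = (fst S')[v := False]"
      by (rule nth_equalityI) (use len v F same in \<open>auto simp: nth_list_update\<close>)
    ultimately have "sigma S = sigma S' - 2"
      using state_sigma_update [of v "fst S'"] v(1) len by (simp add: sigma_def)
    with sig show False by simp
  qed
  moreover have "fst S' = (fst S)[v := False]"
    using upd v(2) calculation by simp
  ultimately show thesis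
    using that v(1) by blast
qed

text \<open>The changed crossing and the new signs determine the target state, so the sum over
  states can be reindexed by them. In this form the sign \<open>sg\<close> and the local coefficient
  \<open>vcoeff\<close> are separate factors.\<close>

lemma dgen_eq:
  assumes wf: "well_formed D" and S: "(s, T) \<in> enhanced_states D"
  shows "dgen D (s, T) = (\<Sum>v\<in>{v. v < length (crossings D) \<and> s ! v}. \<Sum>T'\<in>Pow (circles D (s[v := False])).
    frag_cmul (sg s v * vcoeff D s v T T') (frag_of (s[v := False], T')))"
proof -
  let ?A = "{v. v < length (crossings D) \<and> s ! v}"
  let ?I = "SIGMA v : ?A. Pow (circles D (s[v := False]))"
  let ?f = "\<lambda>(v, T'). (s[v := False], T')"
  have s: "length s = length (crossings D)" and T: "T \<subseteq> circles D s"
    using S by (simp_all add: enhanced_states_iff)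
  have fin: "finite (circles D t)" for t
    by (rule well_formed_finite_circles [OF wf])
  have inj: "inj_on ?f ?I"
  proof (rule inj_onI)
    fix x y assume x: "x \<in> ?I" and y: "y \<in> ?I" and eq: "?f x = ?f y"
    obtain v T1 where xv: "x = (v, T1)" by (cases x)
    obtain w T2 where yw: "y = (w, T2)" by (cases y)
    have upd: "s[v := False] = s[w := False]" and "T1 = T2"
      using eq by (simp_all add: xv yw)
    have "v = w"
    proof (rule ccontr)
      assume "v \<noteq> w"
      then have "s[w := False] ! v"
        using x by (simp add: xv)
      moreover have "\<not> s[v := False] ! v"
        using x s by (simp add: xv)
      ultimately show False using upd by simp
    qed
    with \<open>T1 = T2\<close> show "x = y" by (simp add: xv yw)
  qed
  have "dgen D (s, T) = (\<Sum>S'\<in>?f ` ?I. frag_cmul (coef D (s, T) S') (frag_of S'))"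
    unfolding dgen_def
  proof (rule sum.mono_neutral_right)
    show "finite (enhanced_states D)"
      by (rule finite_enhanced_states [OF wf])
    show "?f ` ?I \<subseteq> enhanced_states D"
      using s by (auto simp: enhanced_states_iff)
    show "\<forall>S'\<in>enhanced_states D - ?f ` ?I. frag_cmul (coef D (s, T) S') (frag_of S') = 0"
    proof
      fix S' assume S': "S' \<in> enhanced_states D - ?f ` ?I"
      have "coef D (s, T) S' = 0"
      proof (rule ccontr)
        assume "coef D (s, T) S' \<noteq> 0"
        then obtain v where v: "v < length (crossings D)" "s ! v" "fst S' = s[v := False]"
          using coef_nonzero [OF S, of S'] S' by auto
        then have "S' = ?f (v, snd S')" "(v, snd S') \<in> ?I"
          using S' by (cases S'; simp add: enhanced_states_iff)+
        then have "S' \<in> ?f ` ?I"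
          by (rule image_eqI)
        with S' show False by simp
      qed
      then show "frag_cmul (coef D (s, T) S') (frag_of S') = 0"
        by simp
    qed
  qed
  also have "\<dots> = (\<Sum>x\<in>?I. frag_cmul (coef D (s, T) (?f x)) (frag_of (?f x)))"
    by (subst sum.reindex [OF inj]) simp
  also have "\<dots> = (\<Sum>(v, T')\<in>?I. frag_cmul (sg s v * vcoeff D s v T T') (frag_of (s[v := False], T')))"
    by (rule sum.cong [OF refl]) (clarsimp simp: coef_update [OF wf s _ _ T])
  also have "\<dots> = (\<Sum>v\<in>?A. \<Sum>T'\<in>Pow (circles D (s[v := False])).
      frag_cmul (sg s v * vcoeff D s v T T') (frag_of (s[v := False], T')))"
    by (rule sum.Sigma [symmetric]) (use fin in simp_all)
  finally show ?thesis .
qed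

lemma frag_extend_lin:
  assumes "finite I"
  shows "frag_extend f (\<Sum>i\<in>I. frag_cmul (c i) (frag_of (g i))) = (\<Sum>i\<in>I. frag_cmul (c i) (f (g i)))"
  using assms by (simp add: frag_extend_sum frag_extend_cmul comp_def)

lemma frag_cmul_sum_left: "finite I \<Longrightarrow> (\<Sum>i\<in>I. frag_cmul (c i) x) = frag_cmul (\<Sum>i\<in>I. c i) x"
  by (induction I rule: finite_induct) (simp_all add: frag_cmul_distrib)

section \<open>Multiplication by a positive sign at an arc\<close>

definition xgen :: "'a diagram \<Rightarrow> 'a \<Rightarrow> 'a estate \<Rightarrow> ('a estate \<Rightarrow>\<^sub>0 int)" where
  "xgen D a S = (if circ D (fst S) a \<in> snd S then 0 else frag_of (fst S, insert (circ D (fst S) a) (snd S)))"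

definition xtot :: "'a diagram \<Rightarrow> 'a \<Rightarrow> ('a estate \<Rightarrow>\<^sub>0 int) \<Rightarrow> ('a estate \<Rightarrow>\<^sub>0 int)" where
  "xtot D a = frag_extend (xgen D a)"

lemma xgen_eq:
  assumes wf: "well_formed D" and a: "a \<in> arcs D" and T: "T \<subseteq> circles D s"
  shows "xgen D a (s, T) = (\<Sum>T'\<in>Pow (circles D s). frag_cmul (mult_coeff (circ D s a) T T') (frag_of (s, T')))"
proof -
  have "(\<Sum>T'\<in>Pow (circles D s). frag_cmul (mult_coeff (circ D s a) T T') (frag_of (s, T'))) =
    (\<Sum>T'\<in>Pow (circles D s). if T' = insert (circ D s a) T then frag_cmul (if circ D s a \<notin> T then 1 else 0) (frag_of (s, T')) else 0)"
    by (rule sum.cong) (simp_all add: mult_coeff_def)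
  also have "\<dots> = frag_cmul (if circ D s a \<notin> T then 1 else 0) (frag_of (s, insert (circ D s a) T))"
    using circ_in [OF a, of s] T well_formed_finite_circles [OF wf, of s] by (subst sum.delta) auto
  finally show ?thesis
    by (simp add: xgen_def)
qed

text \<open>Multiplication leaves the markers alone and \<open>sg s v\<close> depends on nothing
  else, so the claim reduces, crossing by crossing, to \<open>vcoeff_mult_commute\<close> and the
  rest is rearranging finite sums.\<close>

lemma dtot_xgen:
  assumes wf: "well_formed D" and a: "a \<in> arcs D" and S: "(s, T) \<in> enhanced_states D"
  shows "dtot D (xgen D a (s, T)) = xtot D a (dgen D (s, T))"
proof -
  have fin: "finite (circles D t)" for t
    by (rule well_formed_finite_circles [OF wf])
  have s: "length s = length (crossings D)" and T: "T \<subseteq> circles D s"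
    using S by (simp_all add: enhanced_states_iff)
  let ?A = "{v. v < length (crossings D) \<and> s ! v}"
  let ?P = "\<lambda>v. Pow (circles D (s[v := False]))"
  let ?t = "\<lambda>v T''. frag_of (s[v := False], T'')"
  have "dtot D (xgen D a (s, T)) = (\<Sum>T'\<in>Pow (circles D s). frag_cmul (mult_coeff (circ D s a) T T') (dgen D (s, T')))"
    unfolding dtot_def xgen_eq [OF wf a T] by (rule frag_extend_lin) (simp add: fin)
  also have "\<dots> = (\<Sum>T'\<in>Pow (circles D s). \<Sum>v\<in>?A. \<Sum>T''\<in>?P v.
      frag_cmul (sg s v) (frag_cmul (mult_coeff (circ D s a) T T' * vcoeff D s v T' T'') (?t v T'')))"
  proof (rule sum.cong [OF refl])
    fix T' assume "T' \<in> Pow (circles D s)"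
    then have "(s, T') \<in> enhanced_states D"
      using s by (simp add: enhanced_states_iff)
    from dgen_eq [OF wf this] show "frag_cmul (mult_coeff (circ D s a) T T') (dgen D (s, T')) = (\<Sum>v\<in>?A. \<Sum>T''\<in>?P v.
      frag_cmul (sg s v) (frag_cmul (mult_coeff (circ D s a) T T' * vcoeff D s v T' T'') (?t v T'')))"
      by (simp add: frag_cmul_sum algebra_simps)
  qed
  also have "\<dots> = (\<Sum>v\<in>?A. \<Sum>T'\<in>Pow (circles D s). \<Sum>T''\<in>?P v.
      frag_cmul (sg s v) (frag_cmul (mult_coeff (circ D s a) T T' * vcoeff D s v T' T'') (?t v T'')))"
    by (rule sum.swap)
  also have "\<dots> = (\<Sum>v\<in>?A. \<Sum>T''\<in>?P v. \<Sum>T'\<in>Pow (circles D s).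
      frag_cmul (sg s v) (frag_cmul (mult_coeff (circ D s a) T T' * vcoeff D s v T' T'') (?t v T'')))"
    by (intro sum.cong refl sum.swap)
  also have "\<dots> = (\<Sum>v\<in>?A. \<Sum>T''\<in>?P v. frag_cmul (sg s v) (frag_cmul
      (\<Sum>T'\<in>Pow (circles D s). mult_coeff (circ D s a) T T' * vcoeff D s v T' T'') (?t v T'')))"
    using fin by (simp add: frag_cmul_sum_left flip: frag_cmul_sum del: frag_cmul_cmul)
  also have "\<dots> = (\<Sum>v\<in>?A. \<Sum>T''\<in>?P v. frag_cmul (sg s v) (frag_cmul
      (\<Sum>T'\<in>?P v. vcoeff D s v T T' * mult_coeff (circ D (s[v := False]) a) T' T'') (?t v T'')))"
    using vcoeff_mult_commute [OF wf _ a T] by (intro sum.cong refl) simp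
  also have "\<dots> = (\<Sum>v\<in>?A. \<Sum>T''\<in>?P v. \<Sum>T'\<in>?P v.
      frag_cmul (sg s v) (frag_cmul (vcoeff D s v T T' * mult_coeff (circ D (s[v := False]) a) T' T'') (?t v T'')))"
    using fin by (simp add: frag_cmul_sum_left flip: frag_cmul_sum del: frag_cmul_cmul)
  also have "\<dots> = (\<Sum>v\<in>?A. \<Sum>T'\<in>?P v. \<Sum>T''\<in>?P v.
      frag_cmul (sg s v) (frag_cmul (vcoeff D s v T T' * mult_coeff (circ D (s[v := False]) a) T' T'') (?t v T'')))"
    by (intro sum.cong refl sum.swap)
  also have "\<dots> = (\<Sum>v\<in>?A. \<Sum>T'\<in>?P v. frag_cmul (sg s v * vcoeff D s v T T') (xgen D a (s[v := False], T')))"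
    by (intro sum.cong refl) (simp add: xgen_eq [OF wf a] frag_cmul_sum algebra_simps)
  also have "\<dots> = xtot D a (dgen D (s, T))"
    unfolding xtot_def dgen_eq [OF wf S] using fin by (simp add: frag_extend_sum comp_def frag_extend_cmul)
  finally show ?thesis .
qed

section \<open>Circles of the Hopf link addition\<close>

lemma well_formed_edges:
  assumes "well_formed D"
  shows "edges D = (\<Union>c\<in>set (crossings D). set c)"
proof -
  have "edges D = (\<Union>v<length (crossings D). set (crossings D ! v))"
  proof (intro equalityI subsetI)
    fix b assume "b \<in> edges D"
    then obtain v k where "v < length (crossings D)" "k < 4" "b = crossings D ! v ! k"
      by (auto simp: edges_def label_def crossing_ends_def)
    moreover from this have "length (crossings D ! v) = 4"
      using assms by (simp add: well_formed_def)
    ultimately show "b \<in> (\<Union>v<length (crossings D). set (crossings D ! v))"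
      by (intro UN_I [of v]) simp_all
  next
    fix b assume "b \<in> (\<Union>v<length (crossings D). set (crossings D ! v))"
    then obtain v where v: "v < length (crossings D)" "b \<in> set (crossings D ! v)"
      by blast
    moreover from v have "length (crossings D ! v) = 4"
      using assms by (simp add: well_formed_def)
    ultimately obtain k where "k < 4" "b = crossings D ! v ! k"
      by (auto simp: in_set_conv_nth)
    with v show "b \<in> edges D"
      unfolding edges_def label_def by (intro image_eqI [of _ _ "(v, k)"]) (simp_all add: crossing_ends_def)
  qed
  also have "\<dots> = (\<Union>c\<in>set (crossings D). set c)"
    by (simp add: set_conv_nth [of "crossings D"]) blast
  finally show ?thesis .
qed

text \<open>Smoothings in terms of positions around a crossing instead of labels. The positions are
  the same in \<open>D\<close> and \<open>D # D\<^sub>h\<close>, whereas one label has been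
  renamed.\<close>

definition joined :: "bool \<Rightarrow> (nat \<times> nat) set" where
  "joined m = (if m then {(0, 1), (2, 3)} else {(0, 3), (1, 2)})"

lemma smoothing_joined: "(x, y) \<in> smoothing m c \<longleftrightarrow> (\<exists>(k, k')\<in>joined m. x = c ! k \<and> y = c ! k')"
  by (auto simp: smoothing_def joined_def)

lemma joined_less: "(k, k') \<in> joined m \<Longrightarrow> k < 4 \<and> k' < 4"
  by (auto simp: joined_def split: if_splits)

lemma smoothing_map_nth:
  "(x, y) \<in> state_rel D s \<longleftrightarrow> (\<exists>v k k'. v < length (crossings D) \<and> (k, k') \<in> joined (s ! v) \<and>
     x = crossings D ! v ! k \<and> y = crossings D ! v ! k')"
  by (auto simp: state_rel_def smoothing_joined)

section \<open>Crossings and labels of the Hopf link addition\<close>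

locale hopf =
  fixes D :: "'a diagram" and p :: "'a place" and ov :: bool
  assumes D: "link_diagram D" and place: "is_place D p"
begin

definition arc :: 'a where
  "arc = (case p of Edge_end x \<Rightarrow> label D x | Free_loop b \<Rightarrow> b)"

definition right_part :: "'a hopf_label" where
  "right_part = (case p of Edge_end x \<Rightarrow> Beyond | Free_loop b \<Rightarrow> Old b)"

abbreviation E :: "'a hopf_label diagram" where
  "E \<equiv> hopf_addition D p ov"

abbreviation n :: nat where
  "n \<equiv> length (crossings D)"

text \<open>The label in \<open>E\<close> of end \<open>k\<close> at the old crossing
  \<open>v\<close>. The renaming goes by position, since only one of the two ends of the chosen arc
  becomes \<open>Beyond\<close>.\<close>

definition relabel :: "nat \<Rightarrow> nat \<Rightarrow> 'a hopf_label" where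
  "relabel v k = (if p = Edge_end (v, k) then Beyond else Old (crossings D ! v ! k))"

lemma wf: "well_formed D"
  using D by (rule link_diagram_well_formed)

lemma arc_in_arcs: "arc \<in> arcs D"
  using place by (auto simp: arc_def is_place_def arcs_def edges_def split: place.splits)

lemma right_part_cases: "right_part = Beyond \<or> right_part = Old arc"
  by (auto simp: right_part_def arc_def split: place.splits)

definition over_crossing :: "'a hopf_label list" where
  "over_crossing = [Lower_half, Between, Upper_half, Old arc]"

definition under_crossing :: "'a hopf_label list" where
  "under_crossing = [Between, Lower_half, right_part, Upper_half]"

lemma crossings_E:
  "crossings E = (if ov then [over_crossing, under_crossing] else [under_crossing, over_crossing]) @ drop 2 (crossings E)"
  unfolding hopf_addition_def hopf_crossings_def over_crossing_def under_crossing_def arc_def right_part_def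
  by (cases p) (simp_all add: Let_def)

lemma length_crossings_E: "length (crossings E) = n + 2"
  by (cases p) (simp_all add: hopf_addition_def hopf_crossings_def Let_def)

lemma crossing_E_0: "crossings E ! 0 = (if ov then over_crossing else under_crossing)"
  by (subst crossings_E) simp

lemma crossing_E_1: "crossings E ! Suc 0 = (if ov then under_crossing else over_crossing)"
  by (subst crossings_E) simp

lemma length_crossing_D: "v < n \<Longrightarrow> length (crossings D ! v) = 4"
  using wf by (simp add: well_formed_def)

lemma crossing_E_old:
  assumes "v < n"
  shows "crossings E ! Suc (Suc v) = map (relabel v) [0, 1, 2, 3]"
proof -
  have l: "length (crossings D ! v) = 4"
    using assms by (rule length_crossing_D)
  then have upt: "map Old (crossings D ! v) = map (\<lambda>k. Old (crossings D ! v ! k)) [0, 1, 2, 3]"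
    by (intro nth_equalityI) (auto simp: less_4_cases)
  show ?thesis
  proof (cases p)
    case (Edge_end x)
    show ?thesis
    proof (cases "fst x = v")
      case True
      then obtain k where x: "x = (v, k)" by (cases x) auto
      have "k < 4"
        using place x Edge_end by (simp add: is_place_def crossing_ends_def)
      have "crossings E ! Suc (Suc v) = (map Old (crossings D ! v))[k := Beyond]"
        using assms by (simp add: hopf_addition_def hopf_crossings_def Let_def Edge_end x)
      also have "\<dots> = map (relabel v) [0, 1, 2, 3]"
      proof -
        have "relabel v l = (if l = k then Beyond else Old (crossings D ! v ! l))" for l
          unfolding relabel_def unfolding Edge_end x by auto
        then show ?thesis
          unfolding upt using \<open>k < 4\<close>[unfolded less_4_cases]
          by (elim disjE) (simp_all add: numeral_2_eq_2 numeral_3_eq_3)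
      qed
      finally show ?thesis .
    next
      case False
      then have "crossings E ! Suc (Suc v) = map Old (crossings D ! v)"
        using assms by (simp add: hopf_addition_def hopf_crossings_def Let_def Edge_end)
      moreover have "relabel v l = Old (crossings D ! v ! l)" for l
        unfolding relabel_def unfolding Edge_end using False by auto
      ultimately show ?thesis
        by (simp add: upt)
    qed
  next
    case (Free_loop b)
    then have "crossings E ! Suc (Suc v) = map Old (crossings D ! v)"
      using assms by (simp add: hopf_addition_def hopf_crossings_def Let_def)
    moreover have "relabel v l = Old (crossings D ! v ! l)" for l
      unfolding relabel_def unfolding Free_loop by simp
    ultimately show ?thesis
      by (simp add: upt)
  qed
qed

lemma crossing_E_old_nth: "v < n \<Longrightarrow> k < 4 \<Longrightarrow> crossings E ! Suc (Suc v) ! k = relabel v k"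
  by (auto simp: crossing_E_old less_4_cases)

lemma well_formed_E: "well_formed E"
proof -
  have "length (crossings E ! v) = 4" if v: "v < n + 2" for v
  proof -
    consider "v = 0" | "v = Suc 0" | u where "v = Suc (Suc u)" "u < n"
      using v by (metis Suc_less_eq add_2_eq_Suc' not0_implies_Suc)
    then show ?thesis
      by cases (simp_all add: crossing_E_0 crossing_E_1 crossing_E_old over_crossing_def under_crossing_def)
  qed
  then have "\<forall>c\<in>set (crossings E). length c = 4"
    by (auto simp: in_set_conv_nth length_crossings_E)
  moreover have "finite (loops D)"
    using wf by (simp add: well_formed_def)
  then have "finite (loops E)"
    by (cases p) (simp_all add: hopf_addition_def)
  ultimately show ?thesis
    by (simp add: well_formed_def)
qed

lemma relabel_cases:
  assumes "v < n" "k < 4"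
  shows "relabel v k = Old (crossings D ! v ! k) \<or> relabel v k = Beyond \<and> right_part = Beyond \<and> crossings D ! v ! k = arc"
  by (auto simp: relabel_def right_part_def arc_def label_def)

text \<open>No old label is lost: a free loop that is taken out of \<open>loops\<close> reappears as
  the label \<open>Old arc\<close> of the over crossing.\<close>

lemma arcs_E: "arcs E = Old ` arcs D \<union> {Between, Upper_half, Lower_half, right_part}"
proof -
  have split: "set (crossings E) = {over_crossing, under_crossing} \<union> (\<lambda>v. crossings E ! Suc (Suc v)) ` {..<n}"
  proof -
    have "set (crossings E) = (\<lambda>v. crossings E ! v) ` {..<n + 2}"
      by (auto simp: set_conv_nth length_crossings_E)
    also have "{..<n + 2} = {0, Suc 0} \<union> (\<lambda>v. Suc (Suc v)) ` {..<n}"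
      by (simp add: numeral_2_eq_2 lessThan_Suc_eq_insert_0 image_image)
    finally show ?thesis
      by (auto simp: image_Un image_image crossing_E_0 crossing_E_1)
  qed
  have old: "set (crossings E ! Suc (Suc v)) = relabel v ` {..<4}" if "v < n" for v
    unfolding crossing_E_old [OF that] by (auto simp: less_4_cases)
  have edges: "edges E = {Lower_half, Between, Upper_half, Old arc, right_part} \<union> (\<Union>v<n. relabel v ` {..<4})"
    unfolding well_formed_edges [OF well_formed_E] split using old
    by (auto simp: over_crossing_def under_crossing_def)
  have loops: "loops E = Old ` (loops D - (case p of Edge_end x \<Rightarrow> {} | Free_loop b \<Rightarrow> {b}))"
    by (cases p) (simp_all add: hopf_addition_def)
  show ?thesis
  proof (intro equalityI subsetI)
    fix u assume "u \<in> arcs E"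
    then consider "u \<in> {Lower_half, Between, Upper_half, Old arc, right_part}" | v k where "v < n" "k < 4" "u = relabel v k"
      | b where "b \<in> loops D" "u = Old b"
      unfolding arcs_def edges loops by blast
    then show "u \<in> Old ` arcs D \<union> {Between, Upper_half, Lower_half, right_part}"
    proof cases
      case 1
      then show ?thesis using arc_in_arcs by auto
    next
      case 2
      have "label D (v, k) \<in> arcs D"
        unfolding arcs_def edges_def using 2 by (auto simp: crossing_ends_def)
      then show ?thesis
        using relabel_cases [OF 2(1,2)] 2(3) by (auto simp: label_def)
    next
      case 3
      then show ?thesis by (auto simp: arcs_def)
    qed
  next
    fix u assume "u \<in> Old ` arcs D \<union> {Between, Upper_half, Lower_half, right_part}"
    then consider "u \<in> {Lower_half, Between, Upper_half, Old arc, right_part}"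
      | b where "b \<in> edges D" "u = Old b" "b \<noteq> arc" | b where "b \<in> loops D" "u = Old b" "b \<noteq> arc"
      unfolding arcs_def by blast
    then show "u \<in> arcs E"
    proof cases
      case 1
      then show ?thesis unfolding arcs_def edges by blast
    next
      case 2
      then obtain v k where vk: "v < n" "k < 4" "b = crossings D ! v ! k"
        by (auto simp: edges_def label_def crossing_ends_def)
      then have "u = relabel v k"
        using relabel_cases [OF vk(1,2)] 2 by auto
      then show ?thesis
        unfolding arcs_def edges using vk by blast
    next
      case 3
      then have "b \<in> loops D - (case p of Edge_end x \<Rightarrow> {} | Free_loop b \<Rightarrow> {b})"
        using 3 unfolding arc_def by (cases p) simp_all
      then show ?thesis
        unfolding arcs_def loops using 3 by blast
    qed
  qed
qed

text \<open>
  \<open>attached m1 m2\<close> are the new labels on the circle through the chosen arc, and \<open>small m\<close> is the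
  small circle if both new markers are \<open>m\<close>.
\<close>

definition attached :: "bool \<Rightarrow> bool \<Rightarrow> 'a hopf_label set" where
  "attached m1 m2 = (if m1 = m2 then {right_part, if m1 then Upper_half else Lower_half}
     else {right_part, Between, Upper_half, Lower_half})"

definition small :: "bool \<Rightarrow> 'a hopf_label set" where
  "small m = {Between, if m then Lower_half else Upper_half}"

text \<open>The circle of \<open>E\<close> that corresponds to the circle \<open>K\<close> of
  \<open>D\<close>. Its old labels are exactly \<open>K\<close>, even if \<open>right_part\<close>
  is \<open>Old arc\<close>, because then that label is added only when \<open>arc\<close> is
  already in \<open>K\<close>.\<close>

definition lift :: "bool \<Rightarrow> bool \<Rightarrow> 'a set \<Rightarrow> 'a hopf_label set" where
  "lift m1 m2 K = Old ` K \<union> (if arc \<in> K then attached m1 m2 else {})"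

lemma Old_in_attached: "Old b \<in> attached m1 m2 \<Longrightarrow> b = arc"
  using right_part_cases by (auto simp: attached_def split: if_splits)

lemma vimage_lift: "Old -` lift m1 m2 K = K"
  using Old_in_attached by (auto simp: lift_def split: if_splits)

lemma vimage_small: "Old -` small m = {}"
  by (auto simp: small_def)

lemma lift_inject: "lift m1 m2 K = lift m1 m2 L \<longleftrightarrow> K = L"
  by (metis vimage_lift)

text \<open>The new crossings are addressed by their roles, over and under; \<open>ov\<close> merely
  decides which of the two markers belongs to which role. From here on the order of the new
  crossings no longer matters for the circles.\<close>

lemma state_rel_E:
  "(x, y) \<in> state_rel E (m1 # m2 # s) \<longleftrightarrow>
     (x, y) \<in> smoothing (if ov then m1 else m2) over_crossing \<or> (x, y) \<in> smoothing (if ov then m2 else m1) under_crossing \<or>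
     (\<exists>v k k'. v < n \<and> (k, k') \<in> joined (s ! v) \<and> x = relabel v k \<and> y = relabel v k')"
  (is "?l \<longleftrightarrow> ?r")
proof -
  have "?l \<longleftrightarrow> (\<exists>v<n + 2. (x, y) \<in> smoothing ((m1 # m2 # s) ! v) (crossings E ! v))"
    by (auto simp: state_rel_def length_crossings_E)
  also have "\<dots> \<longleftrightarrow> (x, y) \<in> smoothing m1 (crossings E ! 0) \<or> (x, y) \<in> smoothing m2 (crossings E ! Suc 0) \<or>
      (\<exists>v<n. (x, y) \<in> smoothing (s ! v) (crossings E ! Suc (Suc v)))"
    (is "(\<exists>v<n + 2. ?Q v) \<longleftrightarrow> ?rr")
  proof
    assume "\<exists>v<n + 2. ?Q v"
    then obtain v where "v < n + 2" "?Q v" by blast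
    then consider "v = 0" | "v = Suc 0" | u where "v = Suc (Suc u)" "u < n"
      by (metis Suc_less_eq add_2_eq_Suc' not0_implies_Suc)
    then show ?rr
      using \<open>?Q v\<close> by cases auto
  next
    assume ?rr
    then show "\<exists>v<n + 2. ?Q v"
    proof (elim disjE)
      assume "\<exists>v<n. (x, y) \<in> smoothing (s ! v) (crossings E ! Suc (Suc v))"
      then obtain v where "v < n" "(x, y) \<in> smoothing (s ! v) (crossings E ! Suc (Suc v))" by blast
      then show ?thesis by (intro exI [of _ "Suc (Suc v)"]) simp
    next
      assume "(x, y) \<in> smoothing m1 (crossings E ! 0)"
      then show ?thesis by (intro exI [of _ 0]) simp
    next
      assume "(x, y) \<in> smoothing m2 (crossings E ! Suc 0)"
      then show ?thesis by (intro exI [of _ "Suc 0"]) simp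
    qed
  qed
  also have "(\<exists>v<n. (x, y) \<in> smoothing (s ! v) (crossings E ! Suc (Suc v))) \<longleftrightarrow>
      (\<exists>v k k'. v < n \<and> (k, k') \<in> joined (s ! v) \<and> x = relabel v k \<and> y = relabel v k')"
  proof -
    have "(x, y) \<in> smoothing (s ! v) (crossings E ! Suc (Suc v)) \<longleftrightarrow>
        (\<exists>(k, k')\<in>joined (s ! v). x = relabel v k \<and> y = relabel v k')" if "v < n" for v
      unfolding smoothing_joined
      by (intro bex_cong refl) (clarsimp simp: crossing_E_old_nth [OF that] dest!: joined_less)
    then show ?thesis by blast
  qed
  finally show ?thesis
    unfolding crossing_E_0 crossing_E_1 by (cases ov) auto
qed

section \<open>Linked labels in the Hopf link addition\<close>

lemma linked_attached:
  assumes "u \<in> attached m1 m2"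
  shows "(u, Old arc) \<in> linked (state_rel E (m1 # m2 # s))"
proof -
  let ?L = "linked (state_rel E (m1 # m2 # s))"
  have 1: "(x, y) \<in> ?L" if "(x, y) \<in> smoothing (if ov then m1 else m2) over_crossing" for x y
    using that by (intro linked_incl) (simp add: state_rel_E)
  have 2: "(x, y) \<in> ?L" if "(x, y) \<in> smoothing (if ov then m2 else m1) under_crossing" for x y
    using that by (intro linked_incl) (simp add: state_rel_E)
  have o: "(if ov then m1 else m2) \<Longrightarrow> (Lower_half, Between) \<in> ?L" "(if ov then m1 else m2) \<Longrightarrow> (Upper_half, Old arc) \<in> ?L"
    "\<not> (if ov then m1 else m2) \<Longrightarrow> (Lower_half, Old arc) \<in> ?L" "\<not> (if ov then m1 else m2) \<Longrightarrow> (Between, Upper_half) \<in> ?L"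
    by (rule 1; simp add: smoothing_def over_crossing_def)+
  have u: "(if ov then m2 else m1) \<Longrightarrow> (Between, Lower_half) \<in> ?L" "(if ov then m2 else m1) \<Longrightarrow> (right_part, Upper_half) \<in> ?L"
    "\<not> (if ov then m2 else m1) \<Longrightarrow> (Between, Upper_half) \<in> ?L" "\<not> (if ov then m2 else m1) \<Longrightarrow> (Lower_half, right_part) \<in> ?L"
    by (rule 2; simp add: smoothing_def under_crossing_def)+
  note tr = linked_trans [of _ _ "state_rel E (m1 # m2 # s)"]
  note sy = linked_sym [of _ _ "state_rel E (m1 # m2 # s)"]
  \<comment> \<open>The marker pairs ++, --, +-, -+ with the over crossing named first. In the mixed
    pairs \<open>Between\<close> and both halves of the added circle are all joined to the arc, and
    the links are chained one label at a time.\<close>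
  consider "if ov then m1 else m2" "if ov then m2 else m1" | "\<not> (if ov then m1 else m2)" "\<not> (if ov then m2 else m1)"
    | "if ov then m1 else m2" "\<not> (if ov then m2 else m1)" | "\<not> (if ov then m1 else m2)" "if ov then m2 else m1"
    by blast
  then show ?thesis
  proof cases
    case 1
    then have "u = right_part \<or> u = Upper_half"
      using assms by (auto simp: attached_def split: if_splits)
    then show ?thesis
      using o(2) [OF 1(1)] tr [OF u(2) [OF 1(2)] o(2) [OF 1(1)]] by blast
  next
    case 2
    then have "u = right_part \<or> u = Lower_half"
      using assms by (auto simp: attached_def split: if_splits)
    then show ?thesis
      using o(3) [OF 2(1)] tr [OF sy [OF u(4) [OF 2(2)]] o(3) [OF 2(1)]] by blast
  next
    case 3
    have U: "(Upper_half, Old arc) \<in> ?L" using o(2) [OF 3(1)] .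
    have B: "(Between, Old arc) \<in> ?L" using tr [OF u(3) [OF 3(2)] U] .
    have L: "(Lower_half, Old arc) \<in> ?L" using tr [OF o(1) [OF 3(1)] B] .
    have R: "(right_part, Old arc) \<in> ?L" using tr [OF sy [OF u(4) [OF 3(2)]] L] .
    from U B L R show ?thesis
      using assms unfolding attached_def by (auto split: if_splits)
  next
    case 4
    have L: "(Lower_half, Old arc) \<in> ?L" using o(3) [OF 4(1)] .
    have B: "(Between, Old arc) \<in> ?L" using tr [OF u(1) [OF 4(2)] L] .
    have U: "(Upper_half, Old arc) \<in> ?L" using tr [OF sy [OF o(4) [OF 4(1)]] B] .
    have R: "(right_part, Old arc) \<in> ?L" using tr [OF u(2) [OF 4(2)] U] .
    from U B L R show ?thesis
      using assms unfolding attached_def by (auto split: if_splits)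
  qed
qed

lemma linked_small: "(Between, if m then Lower_half else Upper_half) \<in> linked (state_rel E (m # m # s))"
  by (intro linked_incl) (simp add: state_rel_E smoothing_def under_crossing_def)

lemma right_part_attached: "right_part \<in> attached m1 m2"
  by (simp add: attached_def)

lemma linked_relabel:
  assumes "v < n" "k < 4"
  shows "(relabel v k, Old (crossings D ! v ! k)) \<in> linked (state_rel E (m1 # m2 # s))"
  using relabel_cases [OF assms]
proof
  assume h: "relabel v k = Beyond \<and> right_part = Beyond \<and> crossings D ! v ! k = arc"
  then show ?thesis
    using linked_attached [OF right_part_attached, of m1 m2 s] by simp
qed simp

lemma linked_Old:
  assumes "(b, c) \<in> linked (state_rel D s)"
  shows "(Old b, Old c) \<in> linked (state_rel E (m1 # m2 # s))"
  using assms unfolding linked_def [of "state_rel D s"]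
proof (induction rule: rtrancl_induct)
  case base
  show ?case by simp
next
  case (step c c')
  let ?L = "linked (state_rel E (m1 # m2 # s))"
  have *: "(Old c, Old c') \<in> ?L" if cc: "(c, c') \<in> state_rel D s" for c c'
  proof -
    obtain v k k' where v: "v < n" "(k, k') \<in> joined (s ! v)" "c = crossings D ! v ! k" "c' = crossings D ! v ! k'"
      using cc unfolding smoothing_map_nth by blast
    have k: "k < 4" "k' < 4"
      using joined_less [OF v(2)] by auto
    have "(relabel v k, relabel v k') \<in> ?L"
      using v by (intro linked_incl) (auto simp: state_rel_E)
    then have "(Old c, relabel v k') \<in> ?L"
      unfolding v by (rule linked_trans [OF linked_sym [OF linked_relabel [OF v(1) k(1)]]])
    then show ?thesis
      unfolding v by (rule linked_trans [OF _ linked_relabel [OF v(1) k(2)]])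
  qed
  have "(Old c, Old c') \<in> ?L"
    using step(2) * [of c c'] linked_sym [OF * [of c' c]] by blast
  with step(3) show ?case
    by (rule linked_trans)
qed

text \<open>A collapse of the labels of \<open>E\<close> onto those of \<open>D\<close>: labels
  attached to the chosen arc go to it, those of the small circle go to \<open>None\<close>. Followed
  by \<open>circ D s\<close> it is constant along all smoothings, which gives the invariant that
  keeps different circles apart.\<close>

definition old_arc :: "bool \<Rightarrow> bool \<Rightarrow> 'a hopf_label \<Rightarrow> 'a option" where
  "old_arc m1 m2 u = (if u \<in> attached m1 m2 then Some arc else case u of Old b \<Rightarrow> Some b | _ \<Rightarrow> None)"

lemma old_arc_Old [simp]: "old_arc m1 m2 (Old b) = Some b"
  using Old_in_attached [of b m1 m2] by (auto simp: old_arc_def)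

lemma old_arc_attached: "u \<in> attached m1 m2 \<Longrightarrow> old_arc m1 m2 u = Some arc"
  by (simp add: old_arc_def)

lemma old_arc_relabel: "v < n \<Longrightarrow> k < 4 \<Longrightarrow> old_arc m1 m2 (relabel v k) = Some (crossings D ! v ! k)"
  using relabel_cases [of v k] right_part_attached [of m1 m2] by (auto simp: old_arc_attached)

lemma old_arc_small: "u \<in> small m \<Longrightarrow> old_arc m m u = None"
  using right_part_cases by (auto simp: small_def old_arc_def attached_def)

lemma linked_E_invariant:
  assumes "(u, w) \<in> linked (state_rel E (m1 # m2 # s))"
  shows "map_option (circ D s) (old_arc m1 m2 u) = map_option (circ D s) (old_arc m1 m2 w)"
  using assms
proof (rule linked_invariant)
  fix x y assume "(x, y) \<in> state_rel E (m1 # m2 # s)"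
  then consider "(x, y) \<in> smoothing (if ov then m1 else m2) over_crossing"
    | "(x, y) \<in> smoothing (if ov then m2 else m1) under_crossing"
    | v k k' where "v < n" "(k, k') \<in> joined (s ! v)" "x = relabel v k" "y = relabel v k'"
    unfolding state_rel_E by blast
  then show "map_option (circ D s) (old_arc m1 m2 x) = map_option (circ D s) (old_arc m1 m2 y)"
  proof cases
    case 1
    then show ?thesis
      using right_part_cases by (cases ov; cases m1; cases m2)
        (auto simp: smoothing_def over_crossing_def old_arc_def attached_def)
  next
    case 2
    then show ?thesis
      using right_part_cases by (cases ov; cases m1; cases m2)
        (auto simp: smoothing_def under_crossing_def old_arc_def attached_def)
  next
    case 3
    have k: "k < 4" "k' < 4"
      using joined_less [OF 3(2)] by auto
    have "(crossings D ! v ! k, crossings D ! v ! k') \<in> state_rel D s"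
      using 3 unfolding smoothing_map_nth by blast
    then have "circ D s (crossings D ! v ! k) = circ D s (crossings D ! v ! k')"
      unfolding circ_def linked_class_eq_iff by (rule linked_incl)
    then show ?thesis
      using 3 k by (simp add: old_arc_relabel)
  qed
qed

text \<open>\<open>linked_E_invariant\<close> bounds the circle from above;
  \<open>linked_Old\<close> and \<open>linked_attached\<close> provide the links that fill
  it.\<close>

lemma circ_E_Old: "circ E (m1 # m2 # s) (Old b) = lift m1 m2 (circ D s b)"
proof (intro equalityI subsetI)
  fix w assume "w \<in> circ E (m1 # m2 # s) (Old b)"
  then have "(Old b, w) \<in> linked (state_rel E (m1 # m2 # s))"
    by (simp add: circ_def)
  from linked_E_invariant [OF this] obtain c where c: "old_arc m1 m2 w = Some c" "circ D s c = circ D s b"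
    by (cases "old_arc m1 m2 w") auto
  then have cb: "c \<in> circ D s b"
    using circ_self [of c D s] by simp
  from c(1) have "w = Old c \<or> w \<in> attached m1 m2 \<and> c = arc"
    by (auto simp: old_arc_def split: if_splits hopf_label.splits)
  with cb show "w \<in> lift m1 m2 (circ D s b)"
    by (auto simp: lift_def)
next
  fix w assume w: "w \<in> lift m1 m2 (circ D s b)"
  have old: "(Old b, Old c) \<in> linked (state_rel E (m1 # m2 # s))" if "c \<in> circ D s b" for c
    using that by (intro linked_Old) (simp add: circ_def)
  from w consider c where "c \<in> circ D s b" "w = Old c" | "arc \<in> circ D s b" "w \<in> attached m1 m2"
    by (auto simp: lift_def split: if_splits)
  then show "w \<in> circ E (m1 # m2 # s) (Old b)"
  proof cases
    case 1
    then show ?thesis using old by (simp add: circ_def)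
  next
    case 2
    then show ?thesis
      using linked_trans [OF old [OF 2(1)] linked_sym [OF linked_attached [OF 2(2)]]] by (simp add: circ_def)
  qed
qed

lemma circ_E_attached: "u \<in> attached m1 m2 \<Longrightarrow> circ E (m1 # m2 # s) u = lift m1 m2 (circ D s arc)"
  using circ_eqI [OF linked_attached, of u m1 m2 s] by (simp add: circ_E_Old)

text \<open>The invariant is \<open>None\<close> on the small circle, and every other arc of
  \<open>E\<close> is old or attached and so has a different value.\<close>

lemma circ_E_small: "u \<in> small m \<Longrightarrow> circ E (m # m # s) u = small m"
proof -
  have B: "circ E (m # m # s) Between = small m"
  proof (intro equalityI subsetI)
    fix w assume "w \<in> circ E (m # m # s) Between"
    then have "(Between, w) \<in> linked (state_rel E (m # m # s))"
      by (simp add: circ_def)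
    then have "map_option (circ D s) (old_arc m m w) = None" and "w \<in> arcs E"
      using linked_E_invariant [of Between w m m s] old_arc_small [of Between m]
        linked_in [OF _ state_rel_subset [OF well_formed_E]] by (simp_all add: small_def arcs_E)
    then have "w \<notin> attached m m" "w \<notin> range Old" "w \<in> arcs E"
      by (auto simp: old_arc_attached)
    then show "w \<in> small m"
      unfolding arcs_E by (auto simp: small_def attached_def split: if_splits)
  next
    fix w assume "w \<in> small m"
    then show "w \<in> circ E (m # m # s) Between"
      using linked_small [of m s] by (auto simp: small_def circ_def)
  qed
  assume "u \<in> small m"
  then have "u = Between \<or> u = (if m then Lower_half else Upper_half)"
    by (auto simp: small_def)
  then show ?thesis
    using B circ_eqI [OF linked_small, of m s] by metis
qed

definition small_set :: "bool \<Rightarrow> bool \<Rightarrow> 'a hopf_label set set" where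
  "small_set m1 m2 = (if m1 = m2 then {small m1} else {})"

lemma circles_E: "circles E (m1 # m2 # s) = lift m1 m2 ` circles D s \<union> small_set m1 m2"
proof (intro equalityI subsetI)
  fix Q assume "Q \<in> circles E (m1 # m2 # s)"
  then obtain u where u: "u \<in> arcs E" "Q = circ E (m1 # m2 # s) u"
    by (rule circlesE)
  have "u \<in> Old ` arcs D \<or> u \<in> attached m1 m2 \<or> m1 = m2 \<and> u \<in> small m1"
    using u(1) unfolding arcs_E by (auto simp: attached_def small_def)
  then consider b where "b \<in> arcs D" "u = Old b" | "u \<in> attached m1 m2" | "m1 = m2" "u \<in> small m1"
    by blast
  then show "Q \<in> lift m1 m2 ` circles D s \<union> small_set m1 m2"
  proof cases
    case 1
    then show ?thesis using circ_in [OF 1(1), of s] by (simp add: u(2) circ_E_Old)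
  next
    case 2
    then show ?thesis using circ_in [OF arc_in_arcs, of s] by (simp add: u(2) circ_E_attached)
  next
    case 3
    then show ?thesis using circ_E_small by (simp add: u(2) small_set_def)
  qed
next
  fix Q assume "Q \<in> lift m1 m2 ` circles D s \<union> small_set m1 m2"
  then consider K where "K \<in> circles D s" "Q = lift m1 m2 K" | "m1 = m2" "Q = small m1"
    by (auto simp: small_set_def split: if_splits)
  then show "Q \<in> circles E (m1 # m2 # s)"
  proof cases
    case 1
    then obtain b where "b \<in> arcs D" "K = circ D s b"
      by (blast elim: circlesE)
    then have "Q = circ E (m1 # m2 # s) (Old b)" "Old b \<in> arcs E"
      using 1 by (simp_all add: circ_E_Old arcs_E)
    then show ?thesis by (simp add: circ_in)
  next
    case 2
    have "Between \<in> small m1" "Between \<in> arcs E"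
      by (simp_all add: small_def arcs_E)
    with 2 show ?thesis
      using circ_in [of Between E "m1 # m2 # s"] circ_E_small [of Between m1 s] by simp
  qed
qed

lemma lift_not_small: "K \<in> circles D s \<Longrightarrow> lift m1 m2 K \<noteq> small m"
proof
  assume K: "K \<in> circles D s" and "lift m1 m2 K = small m"
  then have "K = {}"
    by (metis vimage_lift vimage_small)
  with K show False
    using blocks_nonempty [OF well_formed_blocks [OF wf]] by blast
qed

text \<open>An end lies on \<open>lift m1 m2 K\<close> exactly if its old label lies in
  \<open>K\<close>. This includes the end renamed \<open>Beyond\<close>, which is attached to the
  chosen arc.\<close>

lemma lift_touches_old:
  assumes "v < n"
  shows "lift m1 m2 K \<inter> set (crossings E ! Suc (Suc v)) = {} \<longleftrightarrow> K \<inter> set (crossings D ! v) = {}"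
proof -
  have mem: "relabel v k \<in> lift m1 m2 K \<longleftrightarrow> crossings D ! v ! k \<in> K" if "k < 4" for k
  proof -
    have "Old b \<in> lift m1 m2 K \<longleftrightarrow> b \<in> K" for b
      using vimage_lift [of m1 m2 K] by blast
    moreover have "Beyond \<in> lift m1 m2 K \<longleftrightarrow> arc \<in> K" if "right_part = Beyond"
      using that right_part_attached [of m1 m2] by (auto simp: lift_def)
    ultimately show ?thesis
      using relabel_cases [OF assms that] by (elim disjE conjE) simp_all
  qed
  have "set (crossings E ! Suc (Suc v)) = {relabel v 0, relabel v 1, relabel v 2, relabel v 3}"
    unfolding crossing_E_old [OF assms] by simp
  then show ?thesis
    unfolding crossing_set [OF wf assms] using mem [of 0] mem [of 1] mem [of 2] mem [of 3] by simp
qed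

lemma small_touches_old: "v < n \<Longrightarrow> small m \<inter> set (crossings E ! Suc (Suc v)) = {}"
proof -
  have "relabel v k \<notin> small m" for k
    by (simp add: relabel_def small_def)
  then show "v < n \<Longrightarrow> small m \<inter> set (crossings E ! Suc (Suc v)) = {}"
    by (simp add: crossing_E_old)
qed

text \<open>Both halves of the added circle occur at both new crossings, and a lifted circle through
  the arc always contains at least one half. Any other lifted circle has only old labels different
  from \<open>arc\<close>.\<close>

lemma lift_touches_new:
  assumes "v < 2"
  shows "lift m1 m2 K \<inter> set (crossings E ! v) = {} \<longleftrightarrow> arc \<notin> K"
proof -
  have c: "crossings E ! v = over_crossing \<or> crossings E ! v = under_crossing"
    using assms crossing_E_0 crossing_E_1 by (cases v) auto
  have ul: "{Upper_half, Lower_half} \<subseteq> set (crossings E ! v)" "set (crossings E ! v) \<subseteq> {Upper_half, Lower_half, Between, Old arc, right_part}"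
    using c by (auto simp: over_crossing_def under_crossing_def)
  show ?thesis
  proof (cases "arc \<in> K")
    case True
    have "attached m1 m2 \<inter> {Upper_half, Lower_half} \<noteq> {}"
      by (simp add: attached_def)
    then have "lift m1 m2 K \<inter> set (crossings E ! v) \<noteq> {}"
      using True ul(1) unfolding lift_def by auto
    with True show ?thesis by simp
  next
    case False
    have "Old ` K \<inter> {Upper_half, Lower_half, Between, Old arc, right_part} = {}"
      using False right_part_cases by auto
    then have "lift m1 m2 K \<inter> set (crossings E ! v) = {}"
      using ul(2) unfolding lift_def if_not_P [OF False] by blast
    with False show ?thesis by simp
  qed
qed

lemma small_touches_new: "v < 2 \<Longrightarrow> small m \<inter> set (crossings E ! v) \<noteq> {}"
  using crossing_E_0 crossing_E_1 by (cases v) (auto simp: small_def over_crossing_def under_crossing_def)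

end

section \<open>The differential of the Hopf link addition\<close>

text \<open>The part of the sign at a new crossing that comes from the old markers: the new
  crossings come first, so every old negative marker is counted.\<close>

definition nsg :: "bool list \<Rightarrow> int" where
  "nsg s = (- 1) ^ card {w. w < length s \<and> \<not> s ! w}"

lemma sg_Cons_0: "sg (m # s) 0 = nsg s"
proof -
  have "{w. 0 < w \<and> w < length (m # s) \<and> \<not> (m # s) ! w} = Suc ` {w. w < length s \<and> \<not> s ! w}" (is "?l = ?r")
  proof (rule Set.set_eqI)
    fix w show "w \<in> ?l \<longleftrightarrow> w \<in> ?r"
      by (cases w) auto
  qed
  then show ?thesis
    by (simp add: sg_def nsg_def card_image)
qed

lemma sg_Cons_Suc: "sg (m # s) (Suc v) = sg s v"
proof -
  have "{w. Suc v < w \<and> w < length (m # s) \<and> \<not> (m # s) ! w} = Suc ` {w. v < w \<and> w < length s \<and> \<not> s ! w}" (is "?l = ?r")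
  proof (rule Set.set_eqI)
    fix w show "w \<in> ?l \<longleftrightarrow> w \<in> ?r"
      by (cases w) auto
  qed
  then show ?thesis
    by (simp add: sg_def card_image)
qed

lemma nsg_Cons: "nsg (m # s) = (if m then 1 else - 1) * nsg s"
proof -
  have eq: "{w. w < length (m # s) \<and> \<not> (m # s) ! w} = (if m then {} else {0}) \<union> Suc ` {w. w < length s \<and> \<not> s ! w}"
    (is "?l = ?r")
  proof (rule Set.set_eqI)
    fix w show "w \<in> ?l \<longleftrightarrow> w \<in> ?r"
      by (cases w) auto
  qed
  have "card ?r = (if m then 0 else 1) + card {w. w < length s \<and> \<not> s ! w}"
    by (subst card_Un_disjoint) (auto simp: card_image)
  then show ?thesis
    unfolding nsg_def eq by simp
qed

text \<open>The reason why \<open>N\<close> anticommutes with the differential of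
  \<open>D\<close>.\<close>

lemma nsg_update:
  assumes "v < length s" "s ! v"
  shows "nsg (s[v := False]) = - nsg s"
proof -
  have "{w. w < length (s[v := False]) \<and> \<not> s[v := False] ! w} = insert v {w. w < length s \<and> \<not> s ! w}"
    using assms by (auto simp: nth_list_update)
  then show ?thesis
    unfolding nsg_def using assms by simp
qed

lemma nsg_square [simp]: "nsg s * nsg s = 1"
  by (simp add: nsg_def flip: power_add mult_2)

lemma agree_off_block:
  assumes P: "blocks P" and C: "C \<in> P" "a \<in> C" and T: "T \<subseteq> P" "T' \<subseteq> P"
  shows "(\<forall>K\<in>P. a \<notin> K \<longrightarrow> (K \<in> T \<longleftrightarrow> K \<in> T')) \<longleftrightarrow> T - {C} = T' - {C}"
proof -
  have "a \<notin> K \<longleftrightarrow> K \<noteq> C" if "K \<in> P" for K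
    using blocks_eq [OF P that C(1) _ C(2)] C(2) by blast
  then have "(\<forall>K\<in>P. a \<notin> K \<longrightarrow> (K \<in> T \<longleftrightarrow> K \<in> T')) \<longleftrightarrow> (\<forall>K\<in>P. K \<noteq> C \<longrightarrow> (K \<in> T \<longleftrightarrow> K \<in> T'))"
    by blast
  also have "\<dots> \<longleftrightarrow> T - {C} = T' - {C}"
    using T by blast
  finally show ?thesis .
qed

text \<open>The local situation at a new crossing, seen in \<open>D\<close>: all signs except that
  of one circle \<open>C\<close> are fixed, so a rise of the degree by 2 means that \<open>C\<close>
  turns from negative to positive, and a rise by 0 that nothing changes.\<close>

lemma one_block_coeff:
  assumes P: "blocks P" and C: "C \<in> P" "a \<in> C" and T: "T \<subseteq> P" "T' \<subseteq> P"
  shows "(\<forall>K\<in>P. a \<notin> K \<longrightarrow> (K \<in> T \<longleftrightarrow> K \<in> T')) \<and> bdeg P T' = bdeg P T + (if q then 2 else 0) \<longleftrightarrow>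
    (if q then C \<notin> T \<and> T' = insert C T else T' = T)"
proof -
  have fin: "finite T" "finite T'"
    using T blocks_finite [OF P] finite_subset by auto
  have deg: "bdeg P T' = bdeg P T + (if q then 2 else 0) \<longleftrightarrow> card T' = card T + (if q then 1 else 0)"
    by (auto simp: bdeg_def)
  show ?thesis
    unfolding agree_off_block [OF P C T] deg
  proof (cases q)
    case True
    have "T - {C} = T' - {C} \<and> card T' = card T + 1 \<longleftrightarrow> C \<notin> T \<and> T' = insert C T"
    proof
      assume h: "T - {C} = T' - {C} \<and> card T' = card T + 1"
      then have "card (T - {C}) + (if C \<in> T' then 1 else 0) = card (T - {C}) + (if C \<in> T then 1 else 0) + 1"
        using card_remove_if [OF fin(1), of C] card_remove_if [OF fin(2), of C] by metis
      then have "C \<in> T'" "C \<notin> T"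
        by (simp_all split: if_splits)
      then show "C \<notin> T \<and> T' = insert C T"
        using h by blast
    next
      assume "C \<notin> T \<and> T' = insert C T"
      then show "T - {C} = T' - {C} \<and> card T' = card T + 1"
        using fin by simp
    qed
    with True show "(T - {C} = T' - {C} \<and> card T' = card T + (if q then 1 else 0)) =
      (if q then C \<notin> T \<and> T' = insert C T else T' = T)"
      by simp
  next
    case False
    have "T' = T" if "T - {C} = T' - {C}" "card T' = card T"
      using remove_eq [OF that(1) fin] that(2) by simp
    with False show "(T - {C} = T' - {C} \<and> card T' = card T + (if q then 1 else 0)) =
      (if q then C \<notin> T \<and> T' = insert C T else T' = T)"
      by auto
  qed
qed

section \<open>The six copies of the enhanced states of the diagram\<close>

context hopf
begin

definition eset :: "bool \<Rightarrow> bool \<Rightarrow> bool \<Rightarrow> 'a set set \<Rightarrow> 'a hopf_label set set" where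
  "eset m1 m2 e T = lift m1 m2 ` T \<union> (if e then {small m1} else {})"

definition emb :: "bool \<Rightarrow> bool \<Rightarrow> bool \<Rightarrow> 'a estate \<Rightarrow> 'a hopf_label estate" where
  "emb m1 m2 e S = (m1 # m2 # fst S, eset m1 m2 e (snd S))"

text \<open>With different markers there is no small circle; its sign \<open>e\<close> is then fixed
  to \<open>False\<close>, so that each of the six copies has exactly one name.\<close>

definition valid :: "bool \<Rightarrow> bool \<Rightarrow> bool \<Rightarrow> bool" where
  "valid m1 m2 e \<longleftrightarrow> (e \<longrightarrow> m1 = m2)"

definition signs :: "bool \<Rightarrow> bool \<Rightarrow> bool set" where
  "signs m1 m2 = {e. valid m1 m2 e}"

lemma signs_eq: "signs m1 m2 = (if m1 = m2 then {False, True} else {False})"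
  by (auto simp: signs_def valid_def)

lemma bl: "blocks (circles D s)"
  by (rule well_formed_blocks [OF wf])

lemma fin: "finite (circles D s)"
  by (rule well_formed_finite_circles [OF wf])

lemma lift_in_eset: "K \<in> circles D s \<Longrightarrow> lift m1 m2 K \<in> eset m1 m2 e T \<longleftrightarrow> K \<in> T"
  using lift_not_small by (auto simp: eset_def lift_inject)

lemma small_notin_lift:
  assumes "T \<subseteq> circles D s"
  shows "small m \<notin> lift m1 m2 ` T"
proof
  assume "small m \<in> lift m1 m2 ` T"
  then obtain K where "K \<in> T" "small m = lift m1 m2 K" by (rule imageE)
  with assms lift_not_small [of K s m1 m2 m] show False
    by auto
qed

lemma small_in_eset: "T \<subseteq> circles D s \<Longrightarrow> small m1 \<in> eset m1 m2 e T \<longleftrightarrow> e"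
  using small_notin_lift [of T s m1 m1 m2] by (simp add: eset_def)

lemma eset_subset: "valid m1 m2 e \<Longrightarrow> T \<subseteq> circles D s \<Longrightarrow> eset m1 m2 e T \<subseteq> circles E (m1 # m2 # s)"
  unfolding circles_E eset_def valid_def small_set_def by auto

lemma eset_inject:
  assumes "T \<subseteq> circles D s" "T' \<subseteq> circles D s" "eset m1 m2 e T = eset m1 m2 e' T'"
  shows "e = e'" "T = T'"
proof -
  show "e = e'"
    using small_in_eset [OF assms(1)] small_in_eset [OF assms(2)] assms(3) by metis
  have "K \<in> T \<longleftrightarrow> K \<in> T'" if "K \<in> circles D s" for K
    using lift_in_eset [OF that] assms(3) by metis
  with assms(1,2) show "T = T'"
    by blast
qed

lemma eset_surj:
  assumes "T' \<subseteq> circles E (m1 # m2 # s)"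
  obtains e T where "valid m1 m2 e" "T \<subseteq> circles D s" "T' = eset m1 m2 e T"
proof -
  let ?T = "{K \<in> circles D s. lift m1 m2 K \<in> T'}"
  let ?e = "m1 = m2 \<and> small m1 \<in> T'"
  have "T' = eset m1 m2 ?e ?T"
    using assms unfolding circles_E eset_def small_set_def by (auto split: if_splits)
  then show thesis
    by (intro that [of ?e ?T]) (auto simp: valid_def)
qed

lemma sum_Pow_circles_E:
  "(\<Sum>T'\<in>Pow (circles E (m1 # m2 # s)). F T') = (\<Sum>e\<in>signs m1 m2. \<Sum>T\<in>Pow (circles D s). F (eset m1 m2 e T))"
proof -
  have inj: "inj_on (\<lambda>(e, T). eset m1 m2 e T) (signs m1 m2 \<times> Pow (circles D s))"
  proof (rule inj_onI)
    fix x y assume x: "x \<in> signs m1 m2 \<times> Pow (circles D s)" and y: "y \<in> signs m1 m2 \<times> Pow (circles D s)"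
      and eq: "(case x of (e, T) \<Rightarrow> eset m1 m2 e T) = (case y of (e, T) \<Rightarrow> eset m1 m2 e T)"
    show "x = y"
      using eset_inject [of "snd x" s "snd y" m1 m2 "fst x" "fst y"] x y eq
      by (cases x; cases y) simp
  qed
  have img: "(\<lambda>(e, T). eset m1 m2 e T) ` (signs m1 m2 \<times> Pow (circles D s)) = Pow (circles E (m1 # m2 # s))"
  proof (intro equalityI subsetI)
    fix T' assume "T' \<in> Pow (circles E (m1 # m2 # s))"
    then obtain e T where "valid m1 m2 e" "T \<subseteq> circles D s" "T' = eset m1 m2 e T"
      using eset_surj by (metis PowD)
    then show "T' \<in> (\<lambda>(e, T). eset m1 m2 e T) ` (signs m1 m2 \<times> Pow (circles D s))"
      by (intro image_eqI [of _ _ "(e, T)"]) (simp_all add: signs_def)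
  next
    fix T' assume "T' \<in> (\<lambda>(e, T). eset m1 m2 e T) ` (signs m1 m2 \<times> Pow (circles D s))"
    then obtain e T where "valid m1 m2 e" "T \<subseteq> circles D s" "T' = eset m1 m2 e T"
      by (auto simp: signs_def)
    then show "T' \<in> Pow (circles E (m1 # m2 # s))"
      using eset_subset by simp
  qed
  show ?thesis
    unfolding img [symmetric] sum.reindex [OF inj] sum.cartesian_product by (simp add: case_prod_beta comp_def)
qed

lemma card_circles_E: "card (circles E (m1 # m2 # s)) = card (circles D s) + (if m1 = m2 then 1 else 0)"
proof -
  have "lift m1 m2 ` circles D s \<inter> small_set m1 m2 = {}"
    using small_notin_lift [OF subset_refl] by (simp add: small_set_def)
  then have "card (circles E (m1 # m2 # s)) = card (lift m1 m2 ` circles D s) + card (small_set m1 m2)"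
    unfolding circles_E using fin by (intro card_Un_disjoint) (simp_all add: small_set_def)
  moreover have "card (lift m1 m2 ` circles D s) = card (circles D s)"
    by (rule card_image) (simp add: inj_on_def lift_inject)
  ultimately show ?thesis
    by (simp add: small_set_def)
qed

lemma card_eset:
  assumes "T \<subseteq> circles D s"
  shows "card (eset m1 m2 e T) = card T + (if e then 1 else 0)"
proof -
  have "finite T"
    using assms fin by (rule finite_subset)
  moreover have "small m1 \<notin> lift m1 m2 ` T"
    by (rule small_notin_lift [OF assms])
  moreover have "card (lift m1 m2 ` T) = card T"
    by (rule card_image) (simp add: inj_on_def lift_inject)
  ultimately show ?thesis
    by (simp add: eset_def)
qed

lemma bdeg_eset:
  assumes "T \<subseteq> circles D s" "valid m1 m2 e"
  shows "bdeg (circles E (m1 # m2 # s)) (eset m1 m2 e T) =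
    bdeg (circles D s) T + (if m1 = m2 then if e then 1 else - 1 else 0)"
  using assms(2) unfolding bdeg_def card_circles_E card_eset [OF assms(1)] valid_def by auto

lemma emb_in: "valid m1 m2 e \<Longrightarrow> S \<in> enhanced_states D \<Longrightarrow> emb m1 m2 e S \<in> enhanced_states E"
  using eset_subset by (cases S) (simp add: emb_def enhanced_states_iff length_crossings_E)

lemma emb_inject:
  assumes "S \<in> enhanced_states D" "S' \<in> enhanced_states D" "emb m1 m2 e S = emb m1' m2' e' S'"
  shows "m1 = m1' \<and> m2 = m2' \<and> e = e' \<and> S = S'"
proof -
  obtain s T where S: "S = (s, T)" by (cases S)
  obtain s' T' where S': "S' = (s', T')" by (cases S')
  have m: "m1' = m1" "m2' = m2" "s' = s" and "eset m1 m2 e T = eset m1 m2 e' T'"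
    using assms(3) by (auto simp: emb_def S S')
  then show ?thesis
    using eset_inject [of T s T' m1 m2 e e'] assms(1,2) by (simp add: S S' enhanced_states_iff)
qed

lemma emb_surj:
  assumes "S' \<in> enhanced_states E"
  obtains m1 m2 e S where "valid m1 m2 e" "S \<in> enhanced_states D" "S' = emb m1 m2 e S"
proof -
  obtain s' T' where S': "S' = (s', T')" by (cases S')
  have len: "length s' = n + 2" and T': "T' \<subseteq> circles E s'"
    using assms by (simp_all add: S' enhanced_states_iff length_crossings_E)
  then obtain m1 m2 s where s': "s' = m1 # m2 # s" "length s = n"
    by (auto simp: length_Suc_conv numeral_2_eq_2)
  obtain e T where "valid m1 m2 e" "T \<subseteq> circles D s" "T' = eset m1 m2 e T"
    using eset_surj [of T' m1 m2 s] T' s' by metis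
  then show thesis
    by (intro that [of m1 m2 e "(s, T)"]) (simp_all add: S' s' emb_def enhanced_states_iff)
qed

lemma sigma_emb: "sigma (emb m1 m2 e S) = sigma S + (if m1 then 1 else - 1) + (if m2 then 1 else - 1)"
  by (simp add: sigma_def state_sigma_def emb_def)

lemma jdeg_emb:
  assumes "valid m1 m2 e" "S \<in> enhanced_states D"
  shows "jdeg E (emb m1 m2 e S) = jdeg D S + (if m1 then 1 else - 1) + (if m2 then 1 else - 1) +
    2 * (if m1 = m2 then if e then 1 else - 1 else 0)"
proof -
  obtain s T where S: "S = (s, T)" by (cases S)
  then have T: "T \<subseteq> circles D s"
    using assms by (simp add: enhanced_states_iff)
  have "tau E (emb m1 m2 e S) = tau D S + (if m1 = m2 then if e then 1 else - 1 else 0)"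
    unfolding S emb_def fst_conv snd_conv tau_bdeg [OF wf T]
      tau_bdeg [OF well_formed_E eset_subset [OF assms(1) T]] by (rule bdeg_eset [OF T assms(1)])
  then show ?thesis
    unfolding jdeg_def sigma_emb by simp
qed

text \<open>The small circle meets no old crossing, so it keeps its sign and shifts both degrees
  equally. The remaining circles correspond under \<open>lift\<close>, and so do those that touch
  \<open>v\<close>.\<close>

lemma vcoeff_old:
  assumes v: "v < n" and T: "T \<subseteq> circles D s" "T' \<subseteq> circles D (s[v := False])"
    and e: "valid m1 m2 e" "valid m1 m2 e'"
  shows "vcoeff E (m1 # m2 # s) (Suc (Suc v)) (eset m1 m2 e T) (eset m1 m2 e' T') =
    (if e = e' then vcoeff D s v T T' else 0)"
proof -
  let ?s = "s[v := False]"
  have U: "circles E (m1 # m2 # s) \<union> circles E (m1 # m2 # ?s) =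
      lift m1 m2 ` (circles D s \<union> circles D ?s) \<union> small_set m1 m2"
    unfolding circles_E by blast
  have memT: "lift m1 m2 K \<in> eset m1 m2 e T \<longleftrightarrow> K \<in> T" "lift m1 m2 K \<in> eset m1 m2 e' T' \<longleftrightarrow> K \<in> T'"
    if "K \<in> circles D s \<union> circles D ?s" for K
    using that lift_in_eset by blast+
  have agree: "(\<forall>Q\<in>circles E (m1 # m2 # s) \<union> circles E (m1 # m2 # ?s). Q \<inter> set (crossings E ! Suc (Suc v)) = {} \<longrightarrow>
      (Q \<in> eset m1 m2 e T \<longleftrightarrow> Q \<in> eset m1 m2 e' T')) \<longleftrightarrow>
    (\<forall>K\<in>circles D s \<union> circles D ?s. K \<inter> set (crossings D ! v) = {} \<longrightarrow> (K \<in> T \<longleftrightarrow> K \<in> T')) \<and>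
    (m1 = m2 \<longrightarrow> e = e')"
  proof -
    have img: "(\<forall>Q\<in>f ` Z. F Q) \<longleftrightarrow> (\<forall>K\<in>Z. G K)" if "\<And>K. K \<in> Z \<Longrightarrow> F (f K) = G K"
      for f :: "'a set \<Rightarrow> 'a hopf_label set" and Z F G
      using that by auto
    have 1: "(\<forall>Q\<in>lift m1 m2 ` (circles D s \<union> circles D ?s). Q \<inter> set (crossings E ! Suc (Suc v)) = {} \<longrightarrow>
        (Q \<in> eset m1 m2 e T \<longleftrightarrow> Q \<in> eset m1 m2 e' T')) \<longleftrightarrow>
      (\<forall>K\<in>circles D s \<union> circles D ?s. K \<inter> set (crossings D ! v) = {} \<longrightarrow> (K \<in> T \<longleftrightarrow> K \<in> T'))"
      by (rule img) (simp only: memT lift_touches_old [OF v])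
    have 2: "(\<forall>Q\<in>small_set m1 m2. Q \<inter> set (crossings E ! Suc (Suc v)) = {} \<longrightarrow>
        (Q \<in> eset m1 m2 e T \<longleftrightarrow> Q \<in> eset m1 m2 e' T')) \<longleftrightarrow> (m1 = m2 \<longrightarrow> e = e')"
      by (simp add: small_set_def small_touches_old [OF v] small_in_eset [OF T(1)] small_in_eset [OF T(2)])
    show ?thesis
      unfolding U ball_Un [of "lift m1 m2 ` _"] 1 2 ..
  qed
  have same: "(m1 = m2 \<longrightarrow> e = e') \<longleftrightarrow> e = e'"
    using e by (auto simp: valid_def)
  show ?thesis
  proof (cases "e = e'")
    case True
    then have "bdeg (circles E (m1 # m2 # ?s)) (eset m1 m2 e' T') = bdeg (circles E (m1 # m2 # s)) (eset m1 m2 e T) + 1 \<longleftrightarrow>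
      bdeg (circles D ?s) T' = bdeg (circles D s) T + 1"
      unfolding bdeg_eset [OF T(1) e(1)] bdeg_eset [OF T(2) e(2)] by auto
    with True show ?thesis
      unfolding vcoeff_def list_update_code agree by simp
  next
    case False
    then show ?thesis
      unfolding vcoeff_def list_update_code agree same by simp
  qed
qed

text \<open>The hypothesis on \<open>q\<close> is the degree balance: the left side is the
  contribution of the small circle before the change plus the required rise by 1, and what its
  contribution afterwards leaves over, 0 or 2, has to come from the circle through the arc.\<close>

lemma vcoeff_new:
  assumes v: "v < 2" and upd: "(m1 # m2 # s)[v := False] = m1' # m2' # s"
    and T: "T \<subseteq> circles D s" "T' \<subseteq> circles D s" and e: "valid m1 m2 e" "valid m1' m2' e'"
    and q: "(if m1 = m2 then if e then 1 else - 1 else 0) + 1 =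
      (if m1' = m2' then if e' then 1 else - 1 else 0) + (if q then 2 else 0 :: int)"
  shows "vcoeff E (m1 # m2 # s) v (eset m1 m2 e T) (eset m1' m2' e' T') =
    (if q then mult_coeff (circ D s arc) T T' else if T' = T then 1 else 0)"
proof -
  let ?W = "set (crossings E ! v)"
  have same: "lift m1 m2 K = lift m1' m2' K" if "arc \<notin> K" for K
    using that by (simp add: lift_def)
  have untouched: "{Q \<in> circles E (m1 # m2 # s) \<union> circles E (m1' # m2' # s). Q \<inter> ?W = {}} =
      lift m1 m2 ` {K \<in> circles D s. arc \<notin> K}"
  proof (intro equalityI subsetI)
    fix Q assume Q: "Q \<in> {Q \<in> circles E (m1 # m2 # s) \<union> circles E (m1' # m2' # s). Q \<inter> ?W = {}}"
    then have nsm: "Q \<noteq> small m1" "Q \<noteq> small m1'"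
      using small_touches_new [OF v] by auto
    then obtain K where K: "K \<in> circles D s" "Q = lift m1 m2 K \<or> Q = lift m1' m2' K"
      using Q unfolding circles_E small_set_def by (auto split: if_splits)
    then have "arc \<notin> K"
      using Q lift_touches_new [OF v] by auto
    with K show "Q \<in> lift m1 m2 ` {K \<in> circles D s. arc \<notin> K}"
      using same by auto
  next
    fix Q assume "Q \<in> lift m1 m2 ` {K \<in> circles D s. arc \<notin> K}"
    then show "Q \<in> {Q \<in> circles E (m1 # m2 # s) \<union> circles E (m1' # m2' # s). Q \<inter> ?W = {}}"
      using lift_touches_new [OF v] unfolding circles_E by auto
  qed
  have mem: "lift m1 m2 K \<in> eset m1 m2 e T \<longleftrightarrow> K \<in> T" "lift m1 m2 K \<in> eset m1' m2' e' T' \<longleftrightarrow> K \<in> T'"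
    if K: "K \<in> circles D s" "arc \<notin> K" for K
    using lift_in_eset [OF K(1)] same [OF K(2)] by metis+
  have "(\<forall>Q\<in>circles E (m1 # m2 # s) \<union> circles E (m1' # m2' # s). Q \<inter> ?W = {} \<longrightarrow>
      (Q \<in> eset m1 m2 e T \<longleftrightarrow> Q \<in> eset m1' m2' e' T')) \<longleftrightarrow>
    (\<forall>Q\<in>{Q \<in> circles E (m1 # m2 # s) \<union> circles E (m1' # m2' # s). Q \<inter> ?W = {}}.
      Q \<in> eset m1 m2 e T \<longleftrightarrow> Q \<in> eset m1' m2' e' T')"
    by auto
  also have "\<dots> \<longleftrightarrow> (\<forall>K\<in>circles D s. arc \<notin> K \<longrightarrow> (K \<in> T \<longleftrightarrow> K \<in> T'))"
    unfolding untouched using mem by auto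
  finally have agree: "(\<forall>Q\<in>circles E (m1 # m2 # s) \<union> circles E (m1' # m2' # s). Q \<inter> ?W = {} \<longrightarrow>
      (Q \<in> eset m1 m2 e T \<longleftrightarrow> Q \<in> eset m1' m2' e' T')) \<longleftrightarrow>
    (\<forall>K\<in>circles D s. arc \<notin> K \<longrightarrow> (K \<in> T \<longleftrightarrow> K \<in> T'))" .
  have deg: "bdeg (circles E (m1' # m2' # s)) (eset m1' m2' e' T') = bdeg (circles E (m1 # m2 # s)) (eset m1 m2 e T) + 1 \<longleftrightarrow>
      bdeg (circles D s) T' = bdeg (circles D s) T + (if q then 2 else 0)"
    unfolding bdeg_eset [OF T(1) e(1)] bdeg_eset [OF T(2) e(2)] using q by linarith
  show ?thesis
    unfolding vcoeff_def upd agree deg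
      one_block_coeff [OF bl circ_in [OF arc_in_arcs] circ_self T] mult_coeff_def by simp
qed

section \<open>The differential between the six copies\<close>

definition Emb :: "bool \<Rightarrow> bool \<Rightarrow> bool \<Rightarrow> ('a estate \<Rightarrow>\<^sub>0 int) \<Rightarrow> ('a hopf_label estate \<Rightarrow>\<^sub>0 int)" where
  "Emb m1 m2 e = frag_extend (\<lambda>S. frag_of (emb m1 m2 e S))"

definition term_at :: "bool list \<Rightarrow> 'a hopf_label set set \<Rightarrow> nat \<Rightarrow> ('a hopf_label estate \<Rightarrow>\<^sub>0 int)" where
  "term_at s' T0 v = (\<Sum>T'\<in>Pow (circles E (s'[v := False])).
     frag_cmul (sg s' v * vcoeff E s' v T0 T') (frag_of (s'[v := False], T')))"

lemma sum_delta_frag: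
  assumes "T \<subseteq> circles D s"
  shows "(\<Sum>T'\<in>Pow (circles D s). frag_cmul (c * (if T' = T then 1 else 0)) (f T')) = frag_cmul c (f T)"
proof -
  have "(\<Sum>T'\<in>Pow (circles D s). frag_cmul (c * (if T' = T then 1 else 0)) (f T')) =
      (\<Sum>T'\<in>Pow (circles D s). if T' = T then frag_cmul c (f T') else 0)"
    by (rule sum.cong) auto
  then show ?thesis
    using assms fin by (simp add: sum.delta)
qed

lemma sum_mult_frag:
  assumes "T \<subseteq> circles D s"
  shows "(\<Sum>T'\<in>Pow (circles D s). frag_cmul (c * mult_coeff (circ D s arc) T T') (frag_of (emb m1 m2 e (s, T')))) =
    frag_cmul c (Emb m1 m2 e (xgen D arc (s, T)))"
  unfolding xgen_eq [OF wf arc_in_arcs assms] Emb_def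
  using fin by (simp add: frag_extend_lin frag_cmul_sum)

text \<open>The small circle disappears. Losing a negative one already raises \<open>tau\<close> by
  1, so the other signs stay; losing a positive one lowers it by 1, and the circle through the arc
  has to make up for 2.\<close>

lemma term_at_new_merge:
  assumes v: "v < 2" and upd: "(True # True # s)[v := False] = m1' # m2' # s" and m: "m1' \<noteq> m2'"
    and T: "T \<subseteq> circles D s"
  shows "term_at (True # True # s) (eset True True e T) v = frag_cmul (sg (True # True # s) v)
    (if e then Emb m1' m2' False (xgen D arc (s, T)) else frag_of (emb m1' m2' False (s, T)))"
proof -
  have vc: "vcoeff E (True # True # s) v (eset True True e T) (eset m1' m2' False T') =
      (if e then mult_coeff (circ D s arc) T T' else if T' = T then 1 else 0)"
    if "T' \<subseteq> circles D s" for T'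
    by (rule vcoeff_new [OF v upd T that]) (use m in \<open>auto simp: valid_def\<close>)
  have "signs m1' m2' = {False}"
    using m by (simp add: signs_eq)
  then have "term_at (True # True # s) (eset True True e T) v = (\<Sum>T'\<in>Pow (circles D s).
      frag_cmul (sg (True # True # s) v * (if e then mult_coeff (circ D s arc) T T' else if T' = T then 1 else 0))
        (frag_of (emb m1' m2' False (s, T'))))"
    unfolding term_at_def upd sum_Pow_circles_E by (simp add: emb_def vc)
  then show ?thesis
    using sum_delta_frag [OF T, of "sg (True # True # s) v" "\<lambda>T'. frag_of (emb m1' m2' False (s, T'))"]
      sum_mult_frag [OF T, of "sg (True # True # s) v" m1' m2' False]
    by (cases e) simp_all
qed

text \<open>The small circle appears. A positive one accounts for the whole rise of
  \<open>tau\<close>; a negative one forces the circle through the arc to turn positive.\<close>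

lemma term_at_new_split:
  assumes v: "v < 2" and upd: "(m1 # m2 # s)[v := False] = False # False # s" and m: "m1 \<noteq> m2"
    and T: "T \<subseteq> circles D s"
  shows "term_at (m1 # m2 # s) (eset m1 m2 False T) v = frag_cmul (sg (m1 # m2 # s) v)
    (frag_of (emb False False True (s, T)) + Emb False False False (xgen D arc (s, T)))"
proof -
  have vc: "vcoeff E (m1 # m2 # s) v (eset m1 m2 False T) (eset False False e' T') =
      (if \<not> e' then mult_coeff (circ D s arc) T T' else if T' = T then 1 else 0)"
    if "T' \<subseteq> circles D s" for e' T'
    by (rule vcoeff_new [OF v upd T that]) (use m in \<open>auto simp: valid_def\<close>)
  have "term_at (m1 # m2 # s) (eset m1 m2 False T) v =
      (\<Sum>T'\<in>Pow (circles D s). frag_cmul (sg (m1 # m2 # s) v * mult_coeff (circ D s arc) T T') (frag_of (emb False False False (s, T')))) +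
      (\<Sum>T'\<in>Pow (circles D s). frag_cmul (sg (m1 # m2 # s) v * (if T' = T then 1 else 0)) (frag_of (emb False False True (s, T'))))"
    unfolding term_at_def upd sum_Pow_circles_E signs_eq by (simp add: emb_def vc)
  also have "\<dots> = frag_cmul (sg (m1 # m2 # s) v) (Emb False False False (xgen D arc (s, T))) +
      frag_cmul (sg (m1 # m2 # s) v) (frag_of (emb False False True (s, T)))"
    by (simp only: sum_mult_frag [OF T] sum_delta_frag [OF T])
  finally show ?thesis
    by (simp add: frag_cmul_distrib2 add.commute)
qed

lemma term_at_old:
  assumes v: "v < n" and T: "T \<subseteq> circles D s" and e: "valid m1 m2 e"
  shows "term_at (m1 # m2 # s) (eset m1 m2 e T) (Suc (Suc v)) = (\<Sum>T'\<in>Pow (circles D (s[v := False])).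
    frag_cmul (sg s v * vcoeff D s v T T') (frag_of (emb m1 m2 e (s[v := False], T'))))"
proof -
  have "term_at (m1 # m2 # s) (eset m1 m2 e T) (Suc (Suc v)) = (\<Sum>e'\<in>signs m1 m2. \<Sum>T'\<in>Pow (circles D (s[v := False])).
      if e' = e then frag_cmul (sg s v * vcoeff D s v T T') (frag_of (emb m1 m2 e (s[v := False], T'))) else 0)"
    unfolding term_at_def list_update_code sum_Pow_circles_E
    by (intro sum.cong refl) (auto simp: sg_Cons_Suc vcoeff_old [OF v T _ e] signs_def emb_def)
  also have "\<dots> = (\<Sum>e'\<in>signs m1 m2. if e' = e then (\<Sum>T'\<in>Pow (circles D (s[v := False])).
      frag_cmul (sg s v * vcoeff D s v T T') (frag_of (emb m1 m2 e (s[v := False], T')))) else 0)"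
    by (intro sum.cong refl) simp
  also have "\<dots> = (\<Sum>T'\<in>Pow (circles D (s[v := False])).
      frag_cmul (sg s v * vcoeff D s v T T') (frag_of (emb m1 m2 e (s[v := False], T'))))"
    using e by (subst sum.delta) (simp_all add: signs_def)
  finally show ?thesis .
qed

text \<open>The part from the old crossings is the differential of \<open>D\<close> without an
  additional sign, because \<open>sg\<close> counts only negative markers after the changed crossing
  and the new crossings come before.\<close>

lemma dgen_emb:
  assumes S: "(s, T) \<in> enhanced_states D" and e: "valid m1 m2 e"
  shows "dgen E (emb m1 m2 e (s, T)) =
    (if m1 then term_at (m1 # m2 # s) (eset m1 m2 e T) 0 else 0) +
    (if m2 then term_at (m1 # m2 # s) (eset m1 m2 e T) (Suc 0) else 0) +
    Emb m1 m2 e (dgen D (s, T))"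
proof -
  let ?s = "m1 # m2 # s" and ?T = "eset m1 m2 e T"
  let ?A = "{v. v < n \<and> s ! v}"
  have T: "T \<subseteq> circles D s"
    using S by (simp add: enhanced_states_iff)
  have idx: "{v. v < length (crossings E) \<and> ?s ! v} =
      (if m1 then {0} else {}) \<union> ((if m2 then {Suc 0} else {}) \<union> (\<lambda>v. Suc (Suc v)) ` ?A)" (is "?l = ?r")
  proof (rule Set.set_eqI)
    fix w show "w \<in> ?l \<longleftrightarrow> w \<in> ?r"
      by (cases w; cases "w - 1") (auto simp: length_crossings_E)
  qed
  have "dgen E (?s, ?T) = (\<Sum>v\<in>?r. term_at ?s ?T v)"
    unfolding term_at_def idx [symmetric]
    by (rule dgen_eq [OF well_formed_E]) (use emb_in [OF e S] in \<open>simp add: emb_def\<close>)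
  also have "\<dots> = (\<Sum>v\<in>(if m1 then {0} else {}). term_at ?s ?T v) +
      ((\<Sum>v\<in>(if m2 then {Suc 0} else {}). term_at ?s ?T v) + (\<Sum>v\<in>(\<lambda>v. Suc (Suc v)) ` ?A. term_at ?s ?T v))"
    by (subst sum.union_disjoint; (subst sum.union_disjoint)?) auto
  also have "(\<Sum>v\<in>(\<lambda>v. Suc (Suc v)) ` ?A. term_at ?s ?T v) = (\<Sum>v\<in>?A. term_at ?s ?T (Suc (Suc v)))"
    by (subst sum.reindex) (simp_all add: inj_on_def)
  also have "\<dots> = (\<Sum>v\<in>?A. \<Sum>T'\<in>Pow (circles D (s[v := False])).
    frag_cmul (sg s v * vcoeff D s v T T') (frag_of (emb m1 m2 e (s[v := False], T'))))"
    by (rule sum.cong) (simp_all add: term_at_old [OF _ T e])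
  also have "\<dots> = Emb m1 m2 e (dgen D (s, T))"
    unfolding Emb_def dgen_eq [OF wf S] using fin by (simp add: frag_extend_sum comp_def frag_extend_cmul)
  finally show ?thesis
    by (simp add: emb_def add.assoc)
qed

end

section \<open>The splitting\<close>

definition lin :: "(('b \<Rightarrow>\<^sub>0 int) \<Rightarrow> ('c \<Rightarrow>\<^sub>0 int)) \<Rightarrow> bool" where
  "lin f \<longleftrightarrow> (\<forall>x y. f (x - y) = f x - f y)"

lemma lin_diff: "lin f \<Longrightarrow> f (x - y) = f x - f y"
  by (simp add: lin_def)

lemma lin_0: "lin f \<Longrightarrow> f 0 = 0"
  using lin_diff [of f 0 0] by simp

lemma lin_minus: "lin f \<Longrightarrow> f (- x) = - f x"
  using lin_diff [of f 0 x] lin_0 [of f] by simp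

lemma lin_add: "lin f \<Longrightarrow> f (x + y) = f x + f y"
  using lin_diff [of f x "- y"] lin_minus [of f y] by simp

lemma lin_frag_extend: "lin (frag_extend f)"
  by (simp add: lin_def frag_extend_diff)

lemma lin_compose: "lin f \<Longrightarrow> lin g \<Longrightarrow> lin (\<lambda>x. f (g x))"
  by (simp add: lin_def)

lemma lin_sub: "lin f \<Longrightarrow> lin g \<Longrightarrow> lin (\<lambda>x. f x - g x)"
  by (simp add: lin_def)

lemma lin_sum: "lin f \<Longrightarrow> lin g \<Longrightarrow> lin (\<lambda>x. f x + g x)"
  by (simp add: lin_def)

lemma lin_uminus: "lin f \<Longrightarrow> lin (\<lambda>x. - f x)"
  by (simp add: lin_def)

lemma lin_id: "lin (\<lambda>x. x)"
  by (simp add: lin_def)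

text \<open>\<open>frag_induction\<close> builds chains from generators by differences, which is why
  \<open>lin\<close> is phrased with differences.\<close>

lemma lin_eq_on:
  assumes "lin f" "lin g" "\<And>S. S \<in> A \<Longrightarrow> f (frag_of S) = g (frag_of S)" "Poly_Mapping.keys x \<subseteq> A"
  shows "f x = g x"
  using assms(4) by (induction x rule: frag_induction) (simp_all add: assms(3) lin_0 lin_diff assms(1,2))

lemma keys_diff_subset: "Poly_Mapping.keys x \<subseteq> B \<Longrightarrow> Poly_Mapping.keys y \<subseteq> B \<Longrightarrow> Poly_Mapping.keys (x - y) \<subseteq> B"
  using keys_diff [of x y] by blast

lemma keys_add_subset: "Poly_Mapping.keys x \<subseteq> B \<Longrightarrow> Poly_Mapping.keys y \<subseteq> B \<Longrightarrow> Poly_Mapping.keys (x + y) \<subseteq> B"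
  using Poly_Mapping.keys_add [of x y] by blast

lemma keys_frag_extend_subset:
  assumes "Poly_Mapping.keys x \<subseteq> A" "\<And>S. S \<in> A \<Longrightarrow> Poly_Mapping.keys (f S) \<subseteq> B"
  shows "Poly_Mapping.keys (frag_extend f x) \<subseteq> B"
  using keys_frag_extend [of f x] assms by blast

section \<open>Homology in terms of the ungraded differential\<close>

lemma lin_dtot: "lin (dtot F)"
  unfolding dtot_def by (rule lin_frag_extend)

lemma dtot_graded:
  assumes "Poly_Mapping.keys x \<subseteq> generators F i j"
  shows "Poly_Mapping.keys (dtot F x) \<subseteq> generators F (i - 2) j"
  unfolding dtot_def using assms
proof (rule keys_frag_extend_subset)
  fix S assume S: "S \<in> generators F i j"
  show "Poly_Mapping.keys (dgen F S) \<subseteq> generators F (i - 2) j"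
  proof
    fix S' assume "S' \<in> Poly_Mapping.keys (dgen F S)"
    then obtain S1 where S1: "S1 \<in> enhanced_states F" "S' \<in> Poly_Mapping.keys (frag_cmul (coef F S S1) (frag_of S1))"
      using keys_sum [of "\<lambda>S'. frag_cmul (coef F S S') (frag_of S')" "enhanced_states F"] unfolding dgen_def by blast
    then have "S' = S1" "coef F S S1 \<noteq> 0"
      by (simp_all add: keys_frag_of)
    with S S1 show "S' \<in> generators F (i - 2) j"
      by (auto simp: generators_iff coef_def split: if_splits)
  qed
qed

abbreviation cls :: "'b diagram \<Rightarrow> int \<Rightarrow> int \<Rightarrow> ('b estate \<Rightarrow>\<^sub>0 int) \<Rightarrow> ('b estate \<Rightarrow>\<^sub>0 int) set" where
  "cls F i j z \<equiv> boundaries F i j #>\<^bsub>chain_group F i j\<^esub> z"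

lemma cls_eq: "cls F i j z = (\<lambda>b. b + z) ` boundaries F i j"
  by (auto simp: r_coset_def chain_group_def)

lemma cycles_iff:
  assumes "well_formed F"
  shows "z \<in> cycles F i j \<longleftrightarrow> Poly_Mapping.keys z \<subseteq> generators F i j \<and> dtot F z = 0"
  using differential_eq_dtot [OF assms, of z i j] by (auto simp: cycles_def kernel_def chain_group_def)

lemma boundaries_iff:
  assumes "well_formed F"
  shows "b \<in> boundaries F i j \<longleftrightarrow> (\<exists>x. Poly_Mapping.keys x \<subseteq> generators F (i + 2) j \<and> b = dtot F x)"
proof -
  have "boundaries F i j = dtot F ` carrier (chain_group F (i + 2) j)"
    unfolding boundaries_def by (rule image_cong [OF refl differential_eq_dtot [OF assms]])
  then show ?thesis
    unfolding chain_group_def by (simp add: image_iff Bex_def)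
qed

lemma boundaries_diff:
  assumes "well_formed F" "b \<in> boundaries F i j" "b' \<in> boundaries F i j"
  shows "b - b' \<in> boundaries F i j"
proof -
  obtain x y where "Poly_Mapping.keys x \<subseteq> generators F (i + 2) j" "b = dtot F x"
    "Poly_Mapping.keys y \<subseteq> generators F (i + 2) j" "b' = dtot F y"
    using assms by (auto simp: boundaries_iff)
  then show ?thesis
    unfolding boundaries_iff [OF assms(1)]
    by (intro exI [of _ "x - y"]) (simp add: keys_diff_subset lin_diff [OF lin_dtot])
qed

lemma boundaries_0: "well_formed F \<Longrightarrow> 0 \<in> boundaries F i j"
  unfolding boundaries_iff by (intro exI [of _ 0]) (simp add: lin_0 [OF lin_dtot])

lemma boundaries_add:
  assumes "well_formed F" "b \<in> boundaries F i j" "b' \<in> boundaries F i j"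
  shows "b + b' \<in> boundaries F i j"
  using boundaries_diff [OF assms(1,2) boundaries_diff [OF assms(1) boundaries_0 [OF assms(1)] assms(3)]] by simp

lemma cls_eq_iff:
  assumes "well_formed F"
  shows "cls F i j z = cls F i j w \<longleftrightarrow> z - w \<in> boundaries F i j"
proof
  assume eq: "cls F i j z = cls F i j w"
  have "z = 0 + z"
    by simp
  then have "z \<in> cls F i j z"
    unfolding cls_eq by (rule image_eqI) (rule boundaries_0 [OF assms])
  then obtain b where "b \<in> boundaries F i j" "z = b + w"
    unfolding eq unfolding cls_eq by blast
  then show "z - w \<in> boundaries F i j"
    by simp
next
  assume zw: "z - w \<in> boundaries F i j"
  have "cls F i j z \<subseteq> cls F i j w" if "z - w \<in> boundaries F i j" for z w
  proof
    fix c assume "c \<in> cls F i j z"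
    then obtain b where b: "b \<in> boundaries F i j" "c = b + z"
      unfolding cls_eq by blast
    then have "c = (b + (z - w)) + w"
      by simp
    then show "c \<in> cls F i j w"
      unfolding cls_eq by (rule image_eqI) (rule boundaries_add [OF assms b(1) that])
  qed
  moreover have "w - z \<in> boundaries F i j"
    using boundaries_diff [OF assms boundaries_0 [OF assms] zw] by simp
  ultimately show "cls F i j z = cls F i j w"
    using zw by blast
qed

lemma carrier_homology: "carrier (homology F i j) = cls F i j ` cycles F i j"
  by (auto simp: homology_def FactGroup_def RCOSETS_def r_coset_def)

lemma mult_homology:
  assumes "well_formed F"
  shows "cls F i j z \<otimes>\<^bsub>homology F i j\<^esub> cls F i j w = cls F i j (z + w)"
proof -
  have "cls F i j z \<otimes>\<^bsub>homology F i j\<^esub> cls F i j w = {a + b | a b. a \<in> cls F i j z \<and> b \<in> cls F i j w}"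
    by (auto simp: homology_def FactGroup_def set_mult_def chain_group_def)
  also have "\<dots> = cls F i j (z + w)"
  proof (intro equalityI subsetI)
    fix c assume "c \<in> {a + b | a b. a \<in> cls F i j z \<and> b \<in> cls F i j w}"
    then obtain b b' where b: "b \<in> boundaries F i j" "b' \<in> boundaries F i j" "c = (b + z) + (b' + w)"
      unfolding cls_eq by blast
    then have "c = (b + b') + (z + w)"
      by (simp add: algebra_simps)
    then show "c \<in> cls F i j (z + w)"
      unfolding cls_eq by (rule image_eqI) (rule boundaries_add [OF assms b(1,2)])
  next
    fix c assume "c \<in> cls F i j (z + w)"
    then obtain b where b: "b \<in> boundaries F i j" "c = b + (z + w)"
      unfolding cls_eq by blast
    have "c = (b + z) + (0 + w)"
      using b by (simp add: algebra_simps)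
    moreover have "b + z \<in> cls F i j z" "0 + w \<in> cls F i j w"
      unfolding cls_eq using b boundaries_0 [OF assms, of i j] by (intro imageI; simp)+
    ultimately show "c \<in> {a + b | a b. a \<in> cls F i j z \<and> b \<in> cls F i j w}"
      by blast
  qed
  finally show ?thesis .
qed

lemma one_homology: "\<one>\<^bsub>homology F i j\<^esub> = cls F i j 0"
  unfolding cls_eq by (simp add: homology_def FactGroup_def)

section \<open>Section, retraction and homotopy\<close>

context hopf
begin

text \<open>The sign with which changes at the new crossings enter the differential, as an operator
  on the chains of \<open>D\<close>. It is its own inverse, commutes with \<open>M\<close> and
  anticommutes with the differential.\<close>

definition N :: "('a estate \<Rightarrow>\<^sub>0 int) \<Rightarrow> ('a estate \<Rightarrow>\<^sub>0 int)" where
  "N = frag_extend (\<lambda>S. frag_cmul (nsg (fst S)) (frag_of S))"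

abbreviation M :: "('a estate \<Rightarrow>\<^sub>0 int) \<Rightarrow> ('a estate \<Rightarrow>\<^sub>0 int)" where
  "M \<equiv> xtot D arc"

definition Pr :: "bool \<Rightarrow> bool \<Rightarrow> bool \<Rightarrow> ('a hopf_label estate \<Rightarrow>\<^sub>0 int) \<Rightarrow> ('a estate \<Rightarrow>\<^sub>0 int)" where
  "Pr m1 m2 e = frag_extend (\<lambda>S'. if S' \<in> emb m1 m2 e ` enhanced_states D
     then frag_of (the_inv_into (enhanced_states D) (emb m1 m2 e) S') else 0)"

definition gamma :: "('a estate \<Rightarrow>\<^sub>0 int) \<Rightarrow> ('a hopf_label estate \<Rightarrow>\<^sub>0 int)" where
  "gamma x = Emb True True True x - Emb True True False (M x)"

definition retract :: "('a hopf_label estate \<Rightarrow>\<^sub>0 int) \<Rightarrow> ('a estate \<Rightarrow>\<^sub>0 int)" where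
  "retract x = Pr False False False x - M (Pr False False True x)"

text \<open>Inverts two components of the differential that are \<open>N\<close> up to the choice of
  copy: from ++ with negative small circle to +-, and from -+ to -- with positive small circle. Both
  have sign plus, in contrast to the components from +- to --.\<close>

definition homotopy :: "('a hopf_label estate \<Rightarrow>\<^sub>0 int) \<Rightarrow> ('a hopf_label estate \<Rightarrow>\<^sub>0 int)" where
  "homotopy x = Emb True True False (N (Pr True False False x)) + Emb False True False (N (Pr False False True x))"

lemma lin_N: "lin N" and lin_M: "lin M" and lin_Emb: "lin (Emb m1 m2 e)" and lin_Pr: "lin (Pr m1 m2 e)"
  unfolding N_def xtot_def Emb_def Pr_def by (rule lin_frag_extend)+

lemmas lin_rules = lin_N lin_M lin_Emb lin_Pr lin_dtot
  lin_compose [OF lin_N] lin_compose [OF lin_M] lin_compose [OF lin_Emb] lin_compose [OF lin_Pr] lin_compose [OF lin_dtot]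
  lin_sub lin_sum lin_uminus lin_id

lemma lin_gamma: "lin gamma" and lin_retract: "lin retract" and lin_homotopy: "lin homotopy"
  unfolding gamma_def retract_def homotopy_def by (intro lin_rules)+

lemma inj_emb: "inj_on (emb m1 m2 e) (enhanced_states D)"
  by (rule inj_onI) (use emb_inject in blast)

lemma emb_in_image:
  assumes S: "S \<in> enhanced_states D"
  shows "emb m1' m2' e' S \<in> emb m1 m2 e ` enhanced_states D \<longleftrightarrow> m1 = m1' \<and> m2 = m2' \<and> e = e'"
proof
  assume "emb m1' m2' e' S \<in> emb m1 m2 e ` enhanced_states D"
  then obtain S' where S': "emb m1' m2' e' S = emb m1 m2 e S'" "S' \<in> enhanced_states D"
    by (rule imageE)
  from emb_inject [OF S S'(2,1)] show "m1 = m1' \<and> m2 = m2' \<and> e = e'"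
    by simp
qed (use S in simp)

definition chains :: "('a estate \<Rightarrow>\<^sub>0 int) set" where
  "chains = {x. Poly_Mapping.keys x \<subseteq> enhanced_states D}"

lemma eq_on_chains:
  assumes "lin f" "lin g" "\<And>s T. (s, T) \<in> enhanced_states D \<Longrightarrow> f (frag_of (s, T)) = g (frag_of (s, T))" "x \<in> chains"
  shows "f x = g x"
  by (rule lin_eq_on [OF assms(1,2), of "enhanced_states D"]) (use assms(3,4) in \<open>auto simp: chains_def\<close>)

lemma Emb_frag_of: "Emb m1 m2 e (frag_of S) = frag_of (emb m1 m2 e S)"
  by (simp add: Emb_def)

lemma Pr_Emb:
  assumes "x \<in> chains"
  shows "Pr m1 m2 e (Emb m1' m2' e' x) = (if m1 = m1' \<and> m2 = m2' \<and> e = e' then x else 0)"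
proof (rule eq_on_chains [OF _ _ _ assms])
  show "lin (\<lambda>x. if m1 = m1' \<and> m2 = m2' \<and> e = e' then x else 0)"
    by (simp add: lin_def)
  fix s T assume S: "(s, T) \<in> enhanced_states D"
  have "emb m1' m2' e' (s, T) \<in> emb m1 m2 e ` enhanced_states D \<longleftrightarrow> m1 = m1' \<and> m2 = m2' \<and> e = e'"
    by (rule emb_in_image [OF S])
  then show "Pr m1 m2 e (Emb m1' m2' e' (frag_of (s, T))) = (if m1 = m1' \<and> m2 = m2' \<and> e = e' then frag_of (s, T) else 0)"
    using the_inv_into_f_f [OF inj_emb S] by (auto simp: Pr_def Emb_frag_of)
qed (intro lin_rules)

lemma N_frag_of: "N (frag_of S) = frag_cmul (nsg (fst S)) (frag_of S)"
  by (simp add: N_def)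

lemma Emb_cmul: "Emb m1 m2 e (frag_cmul c x) = frag_cmul c (Emb m1 m2 e x)"
  by (simp add: Emb_def frag_extend_cmul)

lemma M_cmul: "M (frag_cmul c x) = frag_cmul c (M x)"
  by (simp add: xtot_def frag_extend_cmul)

lemma N_N: "N (N x) = x"
proof (rule lin_eq_on [of "\<lambda>x. N (N x)" "\<lambda>x. x" UNIV])
  show "N (N (frag_of S)) = frag_of S" for S
    by (simp add: N_def frag_extend_cmul)
qed (intro lin_rules | simp)+

lemma M_frag_of: "M (frag_of S) = xgen D arc S"
  by (simp add: xtot_def)

lemma N_M: "N (M x) = M (N x)"
proof (rule lin_eq_on [of "\<lambda>x. N (M x)" "\<lambda>x. M (N x)" UNIV])
  show "N (M (frag_of S)) = M (N (frag_of S))" for S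
    by (simp add: M_frag_of N_frag_of M_cmul) (simp add: xgen_def N_def)
qed (intro lin_rules | simp)+

text \<open>Every term of the differential turns one more marker negative and so reverses
  \<open>nsg\<close>.\<close>

lemma dtot_N: "x \<in> chains \<Longrightarrow> dtot D (N x) = - N (dtot D x)"
proof (rule eq_on_chains [of "\<lambda>x. dtot D (N x)" "\<lambda>x. - N (dtot D x)"])
  fix s T assume S: "(s, T) \<in> enhanced_states D"
  then have s: "length s = length (crossings D)"
    by (simp add: enhanced_states_iff)
  have "N (dgen D (s, T)) = (\<Sum>v\<in>{v. v < n \<and> s ! v}. \<Sum>T'\<in>Pow (circles D (s[v := False])).
      frag_cmul (sg s v * vcoeff D s v T T' * nsg (s[v := False])) (frag_of (s[v := False], T')))"
    unfolding N_def dgen_eq [OF wf S] using fin by (simp add: frag_extend_sum comp_def frag_extend_cmul)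
  also have "\<dots> = (\<Sum>v\<in>{v. v < n \<and> s ! v}. \<Sum>T'\<in>Pow (circles D (s[v := False])).
      frag_cmul (- nsg s) (frag_cmul (sg s v * vcoeff D s v T T') (frag_of (s[v := False], T'))))"
    by (intro sum.cong refl) (simp add: nsg_update s algebra_simps)
  also have "\<dots> = frag_cmul (- nsg s) (dgen D (s, T))"
    unfolding dgen_eq [OF wf S] by (simp only: frag_cmul_sum)
  finally show "dtot D (N (frag_of (s, T))) = - N (dtot D (frag_of (s, T)))"
    by (simp add: N_frag_of dtot_def frag_extend_cmul)
qed (intro lin_rules | assumption)+

lemma dtot_M: "x \<in> chains \<Longrightarrow> dtot D (M x) = M (dtot D x)"
proof (rule eq_on_chains [of "\<lambda>x. dtot D (M x)" "\<lambda>x. M (dtot D x)"])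
  fix s T assume "(s, T) \<in> enhanced_states D"
  then show "dtot D (M (frag_of (s, T))) = M (dtot D (frag_of (s, T)))"
    using dtot_xgen [OF wf arc_in_arcs] by (simp add: M_frag_of dtot_def [of D])
qed (intro lin_rules | assumption)+

lemma N_chains: "x \<in> chains \<Longrightarrow> N x \<in> chains"
  unfolding chains_def N_def by (auto simp: keys_frag_of dest!: subsetD [OF keys_frag_extend])

text \<open>One circle turning positive raises \<open>tau\<close> by 2, hence
  \<open>sigma + 2 * tau\<close> by 4.\<close>

lemma xgen_graded: "S \<in> generators D i j \<Longrightarrow> Poly_Mapping.keys (xgen D arc S) \<subseteq> generators D i (j + 4)"
proof -
  assume S: "S \<in> generators D i j"
  obtain s T where sT: "S = (s, T)" by (cases S)
  have T: "T \<subseteq> circles D s" "length s = n"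
    using S by (simp_all add: sT generators_iff enhanced_states_iff)
  have fT: "finite T"
    using T(1) fin by (rule finite_subset)
  have iT: "insert (circ D s arc) T \<subseteq> circles D s"
    using T circ_in [OF arc_in_arcs] by simp
  have "(s, insert (circ D s arc) T) \<in> generators D i (j + 4)" if "circ D s arc \<notin> T"
  proof -
    have "tau D (s, insert (circ D s arc) T) = tau D (s, T) + 2"
      unfolding tau_bdeg [OF wf iT] tau_bdeg [OF wf T(1)] bdeg_def using that fT by simp
    then show ?thesis
      using S iT T(2) by (simp add: sT generators_iff enhanced_states_iff jdeg_def sigma_def)
  qed
  then show ?thesis
    by (simp add: sT xgen_def keys_frag_of)
qed

lemma M_graded: "Poly_Mapping.keys x \<subseteq> generators D i j \<Longrightarrow> Poly_Mapping.keys (M x) \<subseteq> generators D i (j + 4)"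
  unfolding xtot_def by (erule keys_frag_extend_subset) (rule xgen_graded)

lemma N_graded: "Poly_Mapping.keys x \<subseteq> generators D i j \<Longrightarrow> Poly_Mapping.keys (N x) \<subseteq> generators D i j"
  unfolding N_def by (rule keys_frag_extend_subset) (auto simp: keys_frag_of)

lemma M_chains: "x \<in> chains \<Longrightarrow> M x \<in> chains"
proof -
  have "Poly_Mapping.keys (xgen D arc S) \<subseteq> enhanced_states D" if "S \<in> enhanced_states D" for S
    using xgen_graded [of S "sigma S" "jdeg D S"] that by (auto simp: generators_iff)
  then show "x \<in> chains \<Longrightarrow> M x \<in> chains"
    unfolding chains_def xtot_def by (simp add: keys_frag_extend_subset)
qed

lemma dtot_chains: "x \<in> chains \<Longrightarrow> dtot D x \<in> chains"
proof -
  have "Poly_Mapping.keys (dgen D S) \<subseteq> enhanced_states D" if "S \<in> enhanced_states D" for S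
    using dtot_graded [of "frag_of S" D "sigma S" "jdeg D S"] that by (auto simp: generators_iff dtot_def keys_frag_of)
  then show "x \<in> chains \<Longrightarrow> dtot D x \<in> chains"
    unfolding chains_def dtot_def by (simp add: keys_frag_extend_subset)
qed

lemma Emb_graded:
  assumes "Poly_Mapping.keys x \<subseteq> generators D i j" "valid m1 m2 e"
    and "i' = i + (if m1 then 1 else - 1) + (if m2 then 1 else - 1)"
    and "j' = j + (if m1 then 1 else - 1) + (if m2 then 1 else - 1) + 2 * (if m1 = m2 then if e then 1 else - 1 else 0)"
  shows "Poly_Mapping.keys (Emb m1 m2 e x) \<subseteq> generators E i' j'"
  unfolding Emb_def using assms(1)
proof (rule keys_frag_extend_subset)
  fix S assume "S \<in> generators D i j"
  then show "Poly_Mapping.keys (frag_of (emb m1 m2 e S)) \<subseteq> generators E i' j'"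
    using emb_in [OF assms(2)] jdeg_emb [OF assms(2)] sigma_emb assms(3,4) by (simp add: keys_frag_of generators_iff)
qed

lemma Pr_graded:
  assumes "Poly_Mapping.keys x \<subseteq> generators E i' j'" "valid m1 m2 e"
    and "i' = i + (if m1 then 1 else - 1) + (if m2 then 1 else - 1)"
    and "j' = j + (if m1 then 1 else - 1) + (if m2 then 1 else - 1) + 2 * (if m1 = m2 then if e then 1 else - 1 else 0)"
  shows "Poly_Mapping.keys (Pr m1 m2 e x) \<subseteq> generators D i j"
  unfolding Pr_def using assms(1)
proof (rule keys_frag_extend_subset)
  fix S' assume S': "S' \<in> generators E i' j'"
  show "Poly_Mapping.keys (if S' \<in> emb m1 m2 e ` enhanced_states D
     then frag_of (the_inv_into (enhanced_states D) (emb m1 m2 e) S') else 0) \<subseteq> generators D i j"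
  proof (cases "S' \<in> emb m1 m2 e ` enhanced_states D")
    case True
    then obtain S where S: "S \<in> enhanced_states D" "S' = emb m1 m2 e S"
      by blast
    then have "S \<in> generators D i j"
      using S' jdeg_emb [OF assms(2) S(1)] sigma_emb [of m1 m2 e S] assms(3,4) by (simp add: generators_iff)
    with True show ?thesis
      using the_inv_into_f_f [OF inj_emb S(1)] by (simp add: S(2) keys_frag_of)
  qed simp
qed

text \<open>The first new crossing also counts the marker of the second one. This is the origin of
  the minus sign in \<open>dtot_Emb_pm\<close>.\<close>

lemma sg_new: "sg (m1 # m2 # s) 0 = (if m2 then 1 else - 1) * nsg s" "sg (m1 # m2 # s) (Suc 0) = nsg s"
  by (simp_all add: sg_Cons_0 nsg_Cons sg_Cons_Suc)

lemma dtot_Emb_pp: "x \<in> chains \<Longrightarrow> dtot E (Emb True True False x) =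
    Emb False True False (N x) + Emb True False False (N x) + Emb True True False (dtot D x)"
proof (rule eq_on_chains [where f = "\<lambda>x. dtot E (Emb True True False x)"])
  fix s T assume S: "(s, T) \<in> enhanced_states D"
  then have T: "T \<subseteq> circles D s"
    by (simp add: enhanced_states_iff)
  show "dtot E (Emb True True False (frag_of (s, T))) = Emb False True False (N (frag_of (s, T))) +
      Emb True False False (N (frag_of (s, T))) + Emb True True False (dtot D (frag_of (s, T)))"
    using dgen_emb [OF S, of True True False] term_at_new_merge [of 0 s False True T False]
      term_at_new_merge [of "Suc 0" s True False T False] T
    by (simp add: Emb_frag_of dtot_def N_frag_of Emb_cmul sg_new valid_def)
qed (intro lin_rules | assumption)+

lemma dtot_Emb_pp': "x \<in> chains \<Longrightarrow> dtot E (Emb True True True x) =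
    Emb False True False (N (M x)) + Emb True False False (N (M x)) + Emb True True True (dtot D x)"
proof (rule eq_on_chains [where f = "\<lambda>x. dtot E (Emb True True True x)"])
  fix s T assume S: "(s, T) \<in> enhanced_states D"
  then have T: "T \<subseteq> circles D s"
    by (simp add: enhanced_states_iff)
  show "dtot E (Emb True True True (frag_of (s, T))) = Emb False True False (N (M (frag_of (s, T)))) +
      Emb True False False (N (M (frag_of (s, T)))) + Emb True True True (dtot D (frag_of (s, T)))"
    unfolding N_M unfolding N_frag_of M_cmul M_frag_of Emb_cmul
    using dgen_emb [OF S, of True True True] term_at_new_merge [of 0 s False True T True]
      term_at_new_merge [of "Suc 0" s True False T True] T
    by (simp add: Emb_frag_of dtot_def sg_new valid_def)
qed (intro lin_rules | assumption)+

lemma dtot_Emb_pm: "x \<in> chains \<Longrightarrow> dtot E (Emb True False False x) =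
    - (Emb False False True (N x) + Emb False False False (N (M x))) + Emb True False False (dtot D x)"
proof (rule eq_on_chains [where f = "\<lambda>x. dtot E (Emb True False False x)"])
  fix s T assume S: "(s, T) \<in> enhanced_states D"
  then have T: "T \<subseteq> circles D s"
    by (simp add: enhanced_states_iff)
  show "dtot E (Emb True False False (frag_of (s, T))) = - (Emb False False True (N (frag_of (s, T))) +
      Emb False False False (N (M (frag_of (s, T))))) + Emb True False False (dtot D (frag_of (s, T)))"
    unfolding N_M unfolding N_frag_of M_cmul M_frag_of Emb_cmul
    using dgen_emb [OF S, of True False False] term_at_new_split [of 0 True False s T] T
    by (simp add: Emb_frag_of dtot_def sg_new valid_def frag_cmul_distrib2)
qed (intro lin_rules | assumption)+

lemma dtot_Emb_mp: "x \<in> chains \<Longrightarrow> dtot E (Emb False True False x) =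
    Emb False False True (N x) + Emb False False False (N (M x)) + Emb False True False (dtot D x)"
proof (rule eq_on_chains [where f = "\<lambda>x. dtot E (Emb False True False x)"])
  fix s T assume S: "(s, T) \<in> enhanced_states D"
  then have T: "T \<subseteq> circles D s"
    by (simp add: enhanced_states_iff)
  show "dtot E (Emb False True False (frag_of (s, T))) = Emb False False True (N (frag_of (s, T))) +
      Emb False False False (N (M (frag_of (s, T)))) + Emb False True False (dtot D (frag_of (s, T)))"
    unfolding N_M unfolding N_frag_of M_cmul M_frag_of Emb_cmul
    using dgen_emb [OF S, of False True False] term_at_new_split [of "Suc 0" False True s T] T
    by (simp add: Emb_frag_of dtot_def sg_new valid_def frag_cmul_distrib2)
qed (intro lin_rules | assumption)+

lemma dtot_Emb_mm: "x \<in> chains \<Longrightarrow> dtot E (Emb False False e x) = Emb False False e (dtot D x)"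
proof (rule eq_on_chains [where f = "\<lambda>x. dtot E (Emb False False e x)"])
  fix s T assume S: "(s, T) \<in> enhanced_states D"
  show "dtot E (Emb False False e (frag_of (s, T))) = Emb False False e (dtot D (frag_of (s, T)))"
    using dgen_emb [OF S, of False False e] by (simp add: Emb_frag_of dtot_def valid_def)
qed (intro lin_rules | assumption)+

text \<open>The six copies span the chains of \<open>E\<close>, so an identity of additive maps is
  checked copy by copy.\<close>

lemma eq_on_E:
  assumes f: "lin f" and g: "lin g"
    and eq: "\<And>m1 m2 e x. valid m1 m2 e \<Longrightarrow> x \<in> chains \<Longrightarrow> f (Emb m1 m2 e x) = g (Emb m1 m2 e x)"
    and x: "Poly_Mapping.keys x \<subseteq> enhanced_states E"
  shows "f x = g x"
proof (rule lin_eq_on [OF f g _ x])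
  fix S' assume "S' \<in> enhanced_states E"
  then obtain m1 m2 e S where S: "valid m1 m2 e" "S \<in> enhanced_states D" "S' = emb m1 m2 e S"
    by (rule emb_surj)
  then have "frag_of S \<in> chains"
    by (simp add: chains_def keys_frag_of)
  from eq [OF S(1) this] show "f (frag_of S') = g (frag_of S')"
    by (simp add: S(3) Emb_frag_of)
qed

lemmas chains_rules = N_chains M_chains dtot_chains
lemmas lin_simps = lin_add [OF lin_N] lin_diff [OF lin_N] lin_minus [OF lin_N] lin_0 [OF lin_N]
  lin_add [OF lin_M] lin_diff [OF lin_M] lin_minus [OF lin_M] lin_0 [OF lin_M]
  lin_add [OF lin_Emb] lin_diff [OF lin_Emb] lin_minus [OF lin_Emb] lin_0 [OF lin_Emb]
  lin_add [OF lin_Pr] lin_diff [OF lin_Pr] lin_minus [OF lin_Pr] lin_0 [OF lin_Pr]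
  lin_add [OF lin_dtot] lin_diff [OF lin_dtot] lin_minus [OF lin_dtot] lin_0 [OF lin_dtot]
lemmas dtot_Emb = dtot_Emb_pp dtot_Emb_pp' dtot_Emb_pm dtot_Emb_mp dtot_Emb_mm

text \<open>What arrives at -- from a mixed copy has the form (+) y + (-) (M y) up to sign and is
  killed by \<open>retract\<close>; on -- itself the claim is that \<open>M\<close> commutes with
  the differential.\<close>

lemma retract_chain_map:
  assumes "Poly_Mapping.keys x \<subseteq> enhanced_states E"
  shows "retract (dtot E x) = dtot D (retract x)"
proof (rule eq_on_E [OF _ _ _ assms])
  fix m1 m2 e and x :: "'a estate \<Rightarrow>\<^sub>0 int"
  assume v: "valid m1 m2 e" and x: "x \<in> chains"
  show "retract (dtot E (Emb m1 m2 e x)) = dtot D (retract (Emb m1 m2 e x))"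
    using v by (cases m1; cases m2; cases e)
      (simp_all add: retract_def dtot_Emb Pr_Emb lin_simps chains_rules x N_M dtot_M valid_def)
qed (unfold retract_def, (intro lin_rules)+)

text \<open>On the copy +- the stray term that arrives at -+ by way of ++ is cancelled by the minus
  sign in \<open>dtot_Emb_pm\<close>. Terms with the differential of \<open>D\<close> cancel because
  \<open>N\<close> anticommutes with it, and the terms with \<open>M\<close> on the other copies are
  the corrections in \<open>gamma\<close> and \<open>retract\<close>.\<close>

lemma homotopy_identity:
  assumes "Poly_Mapping.keys x \<subseteq> enhanced_states E"
  shows "x - Emb False False False (retract x) - gamma (Pr True True True x) =
    dtot E (homotopy x) + homotopy (dtot E x)"
proof (rule eq_on_E [OF _ _ _ assms])
  fix m1 m2 e and x :: "'a estate \<Rightarrow>\<^sub>0 int"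
  assume v: "valid m1 m2 e" and x: "x \<in> chains"
  show "Emb m1 m2 e x - Emb False False False (retract (Emb m1 m2 e x)) - gamma (Pr True True True (Emb m1 m2 e x)) =
    dtot E (homotopy (Emb m1 m2 e x)) + homotopy (dtot E (Emb m1 m2 e x))"
    using v by (cases m1; cases m2; cases e)
      (simp_all add: retract_def gamma_def homotopy_def dtot_Emb Pr_Emb lin_simps chains_rules x N_N dtot_N valid_def
        N_M [symmetric])
qed (unfold retract_def gamma_def homotopy_def, (intro lin_rules)+)

text \<open>At each mixed copy, merging (+) x and merging (-) (M x) both give
  \<open>N (M x)\<close>, so the difference contributes nothing there.\<close>

lemma gamma_chain_map: "x \<in> chains \<Longrightarrow> dtot E (gamma x) = gamma (dtot D x)"
  by (simp add: gamma_def dtot_Emb lin_simps chains_rules dtot_M)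

text \<open>The copy ++ with positive small circle is a quotient complex: markers never turn
  positive, and changes at old crossings keep the sign of the small circle, so no other copy maps
  into it.\<close>

lemma Pr_chain_map:
  assumes "Poly_Mapping.keys x \<subseteq> enhanced_states E"
  shows "Pr True True True (dtot E x) = dtot D (Pr True True True x)"
proof (rule eq_on_E [OF _ _ _ assms])
  fix m1 m2 e and x :: "'a estate \<Rightarrow>\<^sub>0 int"
  assume v: "valid m1 m2 e" and x: "x \<in> chains"
  show "Pr True True True (dtot E (Emb m1 m2 e x)) = dtot D (Pr True True True (Emb m1 m2 e x))"
    using v by (cases m1; cases m2; cases e)
      (simp_all add: dtot_Emb Pr_Emb lin_simps chains_rules x valid_def)
qed (intro lin_rules)+

section \<open>Comparison with the given maps on chains\<close>

lemma alpha_state_eq: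
  assumes "S \<in> enhanced_states D"
  shows "alpha_state D p ov S = emb False False False S"
proof -
  obtain s T where S: "S = (s, T)" by (cases S)
  have T: "T \<subseteq> circles D s"
    using assms by (simp add: S enhanced_states_iff)
  \<comment> \<open>The small circle has no old labels; as the empty set is not a circle of
    \<open>D\<close>, the small circle is not selected and is negative.\<close>
  have "{} \<notin> T"
    using T bl [of s] unfolding blocks_def by blast
  then have "{K \<in> circles E (False # False # s). Old -` K \<in> T} = lift False False ` T"
    using T unfolding circles_E by (auto simp: small_set_def vimage_lift vimage_small)
  then show ?thesis
    by (simp add: S alpha_state_def emb_def eset_def)
qed

lemma alpha_chain_eq:
  assumes "x \<in> chains"
  shows "alpha_chain D p ov x = Emb False False False x"
  unfolding alpha_chain_def Emb_def
  by (rule frag_extend_eq) (use assms alpha_state_eq in \<open>auto simp: chains_def\<close>)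

lemma beta_chain_eq:
  assumes "Poly_Mapping.keys x \<subseteq> enhanced_states E"
  shows "beta_chain D x = Pr True True True x"
  unfolding beta_chain_def Pr_def
proof (rule frag_extend_eq)
  fix S' assume "S' \<in> Poly_Mapping.keys x"
  then obtain m1 m2 e S where S: "valid m1 m2 e" "S \<in> enhanced_states D" "S' = emb m1 m2 e S"
    using assms by (blast elim: emb_surj)
  obtain s T where sT: "S = (s, T)" by (cases S)
  have T: "T \<subseteq> circles D s"
    using S(2) by (simp add: sT enhanced_states_iff)
  have iff: "S' \<in> emb True True True ` enhanced_states D \<longleftrightarrow> m1 \<and> m2 \<and> e"
    unfolding S(3) emb_in_image [OF S(2)] by auto
  have small: "{Between, Lower_half} \<in> snd S' \<longleftrightarrow> e" if "m1" "m2"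
    using small_in_eset [OF T, of True m2 e] that by (simp add: S(3) sT emb_def small_def)
  have cond: "fst S' ! 0 \<and> fst S' ! 1 \<and> {Between, Lower_half} \<in> snd S' \<longleftrightarrow> m1 \<and> m2 \<and> e"
    using small by (auto simp: S(3) emb_def)
  show "(if fst S' ! 0 \<and> fst S' ! 1 \<and> {Between, Lower_half} \<in> snd S' then frag_of (beta_state D S') else 0) =
    (if S' \<in> emb True True True ` enhanced_states D
     then frag_of (the_inv_into (enhanced_states D) (emb True True True) S') else 0)"
  proof (cases "m1 \<and> m2 \<and> e")
    case False
    then show ?thesis
      by (simp only: cond iff False if_False)
  next
    case True
    then have S': "S' = emb True True True S"
      using S(3) by simp
    \<comment> \<open>Here the small circle is positive, but its set of old labels is empty and so
      gives no circle of \<open>D\<close>.\<close>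
    have "{} \<notin> circles D s"
      using bl [of s] by (simp add: blocks_def)
    then have "{K \<in> circles D s. \<exists>K'\<in>eset True True True T. Old -` K' = K} = T"
      using T by (auto simp: eset_def vimage_lift vimage_small)
    then have "beta_state D S' = S"
      by (simp add: S' sT beta_state_def emb_def)
    moreover have "the_inv_into (enhanced_states D) (emb True True True) S' = S"
      unfolding S' by (rule the_inv_into_f_f [OF inj_emb S(2)])
    ultimately show ?thesis
      unfolding cond iff using True by simp
  qed
qed

section \<open>Bidegrees of the maps\<close>

lemma keys_generators: "Poly_Mapping.keys x \<subseteq> generators F i j \<Longrightarrow> Poly_Mapping.keys x \<subseteq> enhanced_states F"
  by (auto simp: generators_iff)

lemma generators_chains: "Poly_Mapping.keys x \<subseteq> generators D i j \<Longrightarrow> x \<in> chains"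
  by (simp add: chains_def keys_generators)

lemma alpha_graded:
  "Poly_Mapping.keys x \<subseteq> generators D k l \<Longrightarrow> Poly_Mapping.keys (alpha_chain D p ov x) \<subseteq> generators E (k - 2) (l - 4)"
  by (simp add: alpha_chain_eq generators_chains Emb_graded valid_def)

text \<open>The two summands have the same bidegree: making the small circle negative costs 4 in
  \<open>j\<close>, which is what \<open>M\<close> adds.\<close>

lemma gamma_graded:
  assumes "Poly_Mapping.keys x \<subseteq> generators D k l"
  shows "Poly_Mapping.keys (gamma x) \<subseteq> generators E (k + 2) (l + 4)"
  unfolding gamma_def
  by (rule keys_diff_subset; rule Emb_graded) (use assms M_graded [OF assms] in \<open>simp_all add: valid_def\<close>)

lemma beta_graded:
  assumes "Poly_Mapping.keys x \<subseteq> generators E k l"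
  shows "Poly_Mapping.keys (beta_chain D x) \<subseteq> generators D (k - 2) (l - 4)"
  unfolding beta_chain_eq [OF keys_generators [OF assms]]
  by (rule Pr_graded [OF assms]) (simp_all add: valid_def)

lemma retract_graded:
  assumes "Poly_Mapping.keys x \<subseteq> generators E k l"
  shows "Poly_Mapping.keys (retract x) \<subseteq> generators D (k + 2) (l + 4)"
proof -
  have "Poly_Mapping.keys (Pr False False False x) \<subseteq> generators D (k + 2) (l + 4)"
    by (rule Pr_graded [OF assms]) (simp_all add: valid_def)
  moreover have "Poly_Mapping.keys (Pr False False True x) \<subseteq> generators D (k + 2) l"
    by (rule Pr_graded [OF assms]) (simp_all add: valid_def)
  then have "Poly_Mapping.keys (M (Pr False False True x)) \<subseteq> generators D (k + 2) (l + 4)"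
    by (rule M_graded)
  ultimately show ?thesis
    unfolding retract_def by (rule keys_diff_subset)
qed

lemma homotopy_graded:
  assumes "Poly_Mapping.keys x \<subseteq> generators E k l"
  shows "Poly_Mapping.keys (homotopy x) \<subseteq> generators E (k + 2) l"
proof -
  have "Poly_Mapping.keys (Pr True False False x) \<subseteq> generators D k l"
    by (rule Pr_graded [OF assms]) (simp_all add: valid_def)
  then have "Poly_Mapping.keys (Emb True True False (N (Pr True False False x))) \<subseteq> generators E (k + 2) l"
    by (rule Emb_graded [OF N_graded]) (simp_all add: valid_def)
  moreover have "Poly_Mapping.keys (Pr False False True x) \<subseteq> generators D (k + 2) l"
    by (rule Pr_graded [OF assms]) (simp_all add: valid_def)
  then have "Poly_Mapping.keys (Emb False True False (N (Pr False False True x))) \<subseteq> generators E (k + 2) l"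
    by (rule Emb_graded [OF N_graded]) (simp_all add: valid_def)
  ultimately show ?thesis
    unfolding homotopy_def by (rule keys_add_subset)
qed

end

section \<open>Chain maps and the homomorphisms that they induce\<close>

definition chain_map :: "'b diagram \<Rightarrow> 'c diagram \<Rightarrow> int \<Rightarrow> int \<Rightarrow> (('b estate \<Rightarrow>\<^sub>0 int) \<Rightarrow> ('c estate \<Rightarrow>\<^sub>0 int)) \<Rightarrow> bool" where
  "chain_map F G a b f \<longleftrightarrow> lin f \<and>
     (\<forall>x k l. Poly_Mapping.keys x \<subseteq> generators F k l \<longrightarrow>
        Poly_Mapping.keys (f x) \<subseteq> generators G (k + a) (l + b) \<and> f (dtot F x) = dtot G (f x))"

lemma chain_map_cycles:
  assumes "well_formed F" "well_formed G" "chain_map F G a b f" "z \<in> cycles F k l"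
    and "k' = k + a" "l' = l + b"
  shows "f z \<in> cycles G k' l'"
  using assms lin_0 [of f] unfolding chain_map_def cycles_iff [OF assms(1)] cycles_iff [OF assms(2)] by metis

lemma chain_map_boundaries:
  assumes F: "well_formed F" and G: "well_formed G" and f: "chain_map F G a b f" and z: "z \<in> boundaries F k l"
    and k: "k' = k + a" "l' = l + b"
  shows "f z \<in> boundaries G k' l'"
proof -
  obtain x where x: "Poly_Mapping.keys x \<subseteq> generators F (k + 2) l" "z = dtot F x"
    using z unfolding boundaries_iff [OF F] by blast
  then have "Poly_Mapping.keys (f x) \<subseteq> generators G (k + 2 + a) (l + b)" "f z = dtot G (f x)"
    using f unfolding chain_map_def by blast+
  then show ?thesis
    unfolding boundaries_iff [OF G] k by (intro exI [of _ "f x"]) (simp add: algebra_simps)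
qed

lemma induced_cls:
  assumes F: "well_formed F" and G: "well_formed G" and f: "chain_map F G a b f" and k: "k' = k + a" "l' = l + b"
  shows "induced G k' l' f (cls F k l z) = cls G k' l' (f z)"
proof (rule induced_class)
  show "f (x + y) = f x + f y" for x y
    using f lin_add unfolding chain_map_def by blast
  show "f ` boundaries F k l \<subseteq> boundaries G k' l'"
    using chain_map_boundaries [OF F G f _ k] by blast
qed

lemma induced_hom:
  assumes F: "well_formed F" and G: "well_formed G" and f: "chain_map F G a b f" and k: "k' = k + a" "l' = l + b"
  shows "induced G k' l' f \<in> hom (homology F k l) (homology G k' l')"
proof (rule homI)
  fix x assume "x \<in> carrier (homology F k l)"
  then obtain z where "z \<in> cycles F k l" "x = cls F k l z"
    unfolding carrier_homology by blast
  then show "induced G k' l' f x \<in> carrier (homology G k' l')"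
    using chain_map_cycles [OF F G f _ k] by (simp add: induced_cls [OF F G f k] carrier_homology)
next
  fix x y assume "x \<in> carrier (homology F k l)" "y \<in> carrier (homology F k l)"
  then obtain z w where zw: "x = cls F k l z" "y = cls F k l w"
    unfolding carrier_homology by blast
  have "f (z + w) = f z + f w"
    using f lin_add unfolding chain_map_def by blast
  then show "induced G k' l' f (x \<otimes>\<^bsub>homology F k l\<^esub> y) =
      induced G k' l' f x \<otimes>\<^bsub>homology G k' l'\<^esub> induced G k' l' f y"
    unfolding zw mult_homology [OF F] induced_cls [OF F G f k] mult_homology [OF G] by simp
qed

section \<open>The splitting in homology\<close>

context hopf
begin

lemma chain_map_alpha: "chain_map D E (- 2) (- 4) (alpha_chain D p ov)"
proof -
  have "alpha_chain D p ov (dtot D x) = dtot E (alpha_chain D p ov x)" if "Poly_Mapping.keys x \<subseteq> generators D k l" for x k l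
    using generators_chains [OF that] by (simp add: alpha_chain_eq dtot_chains dtot_Emb_mm)
  then show ?thesis
    using alpha_graded unfolding chain_map_def by (simp add: alpha_chain_def lin_frag_extend)
qed

lemma chain_map_gamma: "chain_map D E 2 4 gamma"
  using gamma_graded gamma_chain_map [OF generators_chains] lin_gamma unfolding chain_map_def by simp

lemma chain_map_retract: "chain_map E D 2 4 retract"
  using retract_graded retract_chain_map [OF keys_generators] lin_retract unfolding chain_map_def by simp

lemma chain_map_beta: "chain_map E D (- 2) (- 4) (beta_chain D)"
proof -
  have "beta_chain D (dtot E x) = dtot D (beta_chain D x)" if "Poly_Mapping.keys x \<subseteq> generators E k l" for x k l
    using keys_generators [OF that] keys_generators [OF dtot_graded [OF that]]
    by (simp add: beta_chain_eq Pr_chain_map)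
  then show ?thesis
    using beta_graded unfolding chain_map_def by (simp add: beta_chain_def lin_frag_extend)
qed

lemma beta_gamma: "x \<in> chains \<Longrightarrow> Poly_Mapping.keys (gamma x) \<subseteq> enhanced_states E \<Longrightarrow> beta_chain D (gamma x) = x"
  by (simp add: beta_chain_eq) (simp add: gamma_def lin_simps Pr_Emb chains_rules)

lemma retract_alpha: "x \<in> chains \<Longrightarrow> retract (alpha_chain D p ov x) = x"
  by (simp add: alpha_chain_eq retract_def Pr_Emb lin_simps)

lemma retract_gamma: "x \<in> chains \<Longrightarrow> retract (gamma x) = 0"
  by (simp add: gamma_def retract_def Pr_Emb lin_simps chains_rules)

lemma beta_alpha:
  "x \<in> chains \<Longrightarrow> Poly_Mapping.keys (alpha_chain D p ov x) \<subseteq> enhanced_states E \<Longrightarrow> beta_chain D (alpha_chain D p ov x) = 0"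
  by (simp add: beta_chain_eq) (simp add: alpha_chain_eq Pr_Emb)

text \<open>On a cycle the second term of \<open>homotopy_identity\<close> vanishes, so the
  difference is the boundary of \<open>homotopy z\<close>.\<close>

lemma cycle_decomposition:
  assumes z: "z \<in> cycles E i j"
  shows "z - (alpha_chain D p ov (retract z) + gamma (beta_chain D z)) \<in> boundaries E i j"
proof -
  have kz: "Poly_Mapping.keys z \<subseteq> generators E i j" and dz: "dtot E z = 0"
    using z by (simp_all add: cycles_iff [OF well_formed_E])
  have "alpha_chain D p ov (retract z) = Emb False False False (retract z)"
    by (rule alpha_chain_eq [OF generators_chains [OF retract_graded [OF kz]]])
  then have "z - (alpha_chain D p ov (retract z) + gamma (beta_chain D z)) = dtot E (homotopy z)"
    using homotopy_identity [OF keys_generators [OF kz]] beta_chain_eq [OF keys_generators [OF kz]] dz lin_0 [OF lin_homotopy]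
    by (simp add: algebra_simps)
  then show ?thesis
    unfolding boundaries_iff [OF well_formed_E] using homotopy_graded [OF kz] by blast
qed

lemma splitting:
  fixes i j :: int
  defines "A \<equiv> alpha_h D p ov i j" and "B \<equiv> beta_h D i j" and "C \<equiv> induced E i j gamma"
    and "H1 \<equiv> homology D (i + 2) (j + 4)" and "H \<equiv> homology E i j" and "H2 \<equiv> homology D (i - 2) (j - 4)"
  shows "A \<in> mon H1 H \<and> B \<in> epi H H2 \<and> A ` carrier H1 = kernel H H2 B \<and> C \<in> hom H2 H \<and>
    (\<forall>x\<in>carrier H2. B (C x) = x) \<and> (\<lambda>(x, y). A x \<otimes>\<^bsub>H\<^esub> C y) \<in> iso (H1 \<times>\<times> H2) H"
proof -
  let ?a = "alpha_chain D p ov" and ?b = "beta_chain D"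
  let ?Z = "cycles E i j" and ?Z1 = "cycles D (i + 2) (j + 4)" and ?Z2 = "cycles D (i - 2) (j - 4)"
  let ?B = "boundaries E i j" and ?B1 = "boundaries D (i + 2) (j + 4)" and ?B2 = "boundaries D (i - 2) (j - 4)"
  note wfE = well_formed_E
  have carr: "carrier H1 = cls D (i + 2) (j + 4) ` ?Z1" "carrier H = cls E i j ` ?Z" "carrier H2 = cls D (i - 2) (j - 4) ` ?Z2"
    unfolding H1_def H_def H2_def by (rule carrier_homology)+
  have A: "A (cls D (i + 2) (j + 4) z) = cls E i j (?a z)" for z
    unfolding A_def alpha_h_def by (rule induced_cls [OF wf wfE chain_map_alpha]) simp_all
  have B: "B (cls E i j z) = cls D (i - 2) (j - 4) (?b z)" for z
    unfolding B_def beta_h_def by (rule induced_cls [OF wfE wf chain_map_beta]) simp_all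
  have C: "C (cls D (i - 2) (j - 4) z) = cls E i j (gamma z)" for z
    unfolding C_def by (rule induced_cls [OF wf wfE chain_map_gamma]) simp_all
  have mult: "cls E i j z \<otimes>\<^bsub>H\<^esub> cls E i j w = cls E i j (z + w)" for z w
    unfolding H_def by (rule mult_homology [OF wfE])
  have homA: "A \<in> hom H1 H"
    unfolding A_def alpha_h_def H1_def H_def by (rule induced_hom [OF wf wfE chain_map_alpha]) simp_all
  have homB: "B \<in> hom H H2"
    unfolding B_def beta_h_def H2_def H_def by (rule induced_hom [OF wfE wf chain_map_beta]) simp_all
  have homC: "C \<in> hom H2 H"
    unfolding C_def H2_def H_def by (rule induced_hom [OF wf wfE chain_map_gamma]) simp_all
  have Za: "?a z \<in> ?Z" if "z \<in> ?Z1" for z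
    by (rule chain_map_cycles [OF wf wfE chain_map_alpha that]) simp_all
  have Zr: "retract z \<in> ?Z1" if "z \<in> ?Z" for z
    by (rule chain_map_cycles [OF wfE wf chain_map_retract that]) simp_all
  have Zb: "?b z \<in> ?Z2" if "z \<in> ?Z" for z
    by (rule chain_map_cycles [OF wfE wf chain_map_beta that]) simp_all
  have Zc: "gamma z \<in> ?Z" if "z \<in> ?Z2" for z
    by (rule chain_map_cycles [OF wf wfE chain_map_gamma that]) simp_all
  have Br: "retract z \<in> ?B1" if "z \<in> ?B" for z
    by (rule chain_map_boundaries [OF wfE wf chain_map_retract that]) simp_all
  have Bb: "?b z \<in> ?B2" if "z \<in> ?B" for z
    by (rule chain_map_boundaries [OF wfE wf chain_map_beta that]) simp_all
  have Bc: "gamma z \<in> ?B" if "z \<in> ?B2" for z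
    by (rule chain_map_boundaries [OF wf wfE chain_map_gamma that]) simp_all
  have ch: "z \<in> chains" if "z \<in> cycles D k l" for z k l
    using that unfolding cycles_iff [OF wf] by (blast intro: generators_chains)
  have kE: "Poly_Mapping.keys z \<subseteq> enhanced_states E" if "z \<in> ?Z" for z
    by (rule keys_generators [of z E i j]) (use that in \<open>simp add: cycles_iff [OF wfE]\<close>)
  have bc: "?b (gamma z) = z" if "z \<in> ?Z2" for z
    by (rule beta_gamma [OF ch [OF that] kE [OF Zc [OF that]]])
  have ba: "?b (?a z) = 0" if "z \<in> ?Z1" for z
    by (rule beta_alpha [OF ch [OF that] kE [OF Za [OF that]]])
  have ra: "retract (?a z) = z" if "z \<in> ?Z1" for z
    by (rule retract_alpha [OF ch [OF that]])
  have rc: "retract (gamma z) = 0" if "z \<in> ?Z2" for z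
    by (rule retract_gamma [OF ch [OF that]])
  have lin_b: "lin ?b" and lin_a: "lin ?a"
    unfolding beta_chain_def alpha_chain_def by (rule lin_frag_extend)+
  have dec: "cls E i j z = cls E i j (?a (retract z) + gamma (?b z))" if "z \<in> ?Z" for z
    unfolding cls_eq_iff [OF wfE] by (rule cycle_decomposition [OF that])
  have BC: "B (C x) = x" if "x \<in> carrier H2" for x
    using that bc unfolding carr by (auto simp: B C)
  \<comment> \<open>\<open>retract\<close> and \<open>beta_chain\<close> recover the two summands,
    since \<open>retract\<close> kills \<open>gamma\<close> and \<open>beta_chain\<close> kills
    \<open>alpha_chain\<close>; being chain maps, they send the bounding difference to boundaries in
    \<open>D\<close>.\<close>
  have inj: "z - z' \<in> ?B1 \<and> w - w' \<in> ?B2"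
    if "z \<in> ?Z1" "z' \<in> ?Z1" "w \<in> ?Z2" "w' \<in> ?Z2" "cls E i j (?a z + gamma w) = cls E i j (?a z' + gamma w')" for z z' w w'
  proof -
    have *: "(?a z + gamma w) - (?a z' + gamma w') \<in> ?B"
      using that(5) by (simp add: cls_eq_iff [OF wfE])
    have "retract ((?a z + gamma w) - (?a z' + gamma w')) = z - z'"
      using that(1-4) by (simp add: lin_diff [OF lin_retract] lin_add [OF lin_retract] ra rc)
    moreover have "?b ((?a z + gamma w) - (?a z' + gamma w')) = w - w'"
      using that(1-4) by (simp add: lin_diff [OF lin_b] lin_add [OF lin_b] ba bc)
    ultimately show ?thesis
      using Br [OF *] Bb [OF *] by simp
  qed
  have Z2_0: "0 \<in> ?Z2"
    by (simp add: cycles_iff [OF wf] lin_0 [OF lin_dtot])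
  have monA: "A \<in> mon H1 H"
  proof -
    have "inj_on A (carrier H1)"
    proof (rule inj_onI)
      fix x y assume "x \<in> carrier H1" "y \<in> carrier H1" and eq: "A x = A y"
      then obtain z w where zw: "z \<in> ?Z1" "w \<in> ?Z1" "x = cls D (i + 2) (j + 4) z" "y = cls D (i + 2) (j + 4) w"
        unfolding carr by blast
      \<comment> \<open>The vanishing \<open>gamma 0\<close> is inserted so that injectivity of
        \<open>A\<close> becomes the case of second components 0 in \<open>inj\<close>.\<close>
      have "cls E i j (?a z + gamma 0) = cls E i j (?a w + gamma 0)"
        using eq unfolding zw A by (simp add: lin_0 [OF lin_gamma])
      then have "z - w \<in> ?B1"
        using inj [OF zw(1,2) Z2_0 Z2_0] by simp
      then show "x = y"
        unfolding zw cls_eq_iff [OF wf] .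
    qed
    with homA show ?thesis
      by (simp add: mon_def)
  qed
  have epiB: "B \<in> epi H H2"
  proof -
    have "carrier H2 \<subseteq> B ` carrier H"
    proof
      fix x assume x: "x \<in> carrier H2"
      then have "C x \<in> carrier H"
        using homC by (auto simp: hom_def)
      then show "x \<in> B ` carrier H"
        using BC [OF x] by (metis imageI)
    qed
    with homB show ?thesis
      by (auto simp: epi_def hom_def)
  qed
  have exact: "A ` carrier H1 = kernel H H2 B"
  proof (intro equalityI subsetI)
    fix y assume "y \<in> A ` carrier H1"
    then obtain z where z: "z \<in> ?Z1" "y = cls E i j (?a z)"
      unfolding carr by (auto simp: A)
    then have "B y = \<one>\<^bsub>H2\<^esub>"
      unfolding H2_def one_homology by (simp add: B ba)
    with z Za show "y \<in> kernel H H2 B"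
      by (simp add: kernel_def carr)
  next
    fix y assume "y \<in> kernel H H2 B"
    then obtain z where z: "z \<in> ?Z" "y = cls E i j z" and "B y = \<one>\<^bsub>H2\<^esub>"
      by (auto simp: kernel_def carr)
    then have "?b z \<in> ?B2"
      unfolding H2_def one_homology by (simp add: B cls_eq_iff [OF wf])
    \<comment> \<open>The \<open>gamma\<close> part of the decomposition of \<open>z\<close> is a
      boundary because \<open>gamma\<close> maps boundaries to boundaries; what remains of
      \<open>z\<close> in homology comes from \<open>A\<close>.\<close>
    then have "(?a (retract z) + gamma (?b z)) - ?a (retract z) \<in> ?B"
      using Bc by simp
    then have "y = A (cls D (i + 2) (j + 4) (retract z))"
      unfolding A z(2) dec [OF z(1)] cls_eq_iff [OF wfE] .
    then show "y \<in> A ` carrier H1"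
      using Zr [OF z(1)] by (simp add: carr)
  qed
  have iso: "(\<lambda>(x, y). A x \<otimes>\<^bsub>H\<^esub> C y) \<in> iso (H1 \<times>\<times> H2) H" (is "?f \<in> _")
  proof -
    have f: "?f (cls D (i + 2) (j + 4) z, cls D (i - 2) (j - 4) w) = cls E i j (?a z + gamma w)" for z w
      by (simp add: A C mult)
    have "inj_on ?f (carrier H1 \<times> carrier H2)"
    proof (rule inj_onI)
      fix x y assume "x \<in> carrier H1 \<times> carrier H2" "y \<in> carrier H1 \<times> carrier H2" and eq: "?f x = ?f y"
      then obtain z w z' w' where z: "z \<in> ?Z1" "w \<in> ?Z2" "z' \<in> ?Z1" "w' \<in> ?Z2"
        and xy: "x = (cls D (i + 2) (j + 4) z, cls D (i - 2) (j - 4) w)"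
          "y = (cls D (i + 2) (j + 4) z', cls D (i - 2) (j - 4) w')"
        unfolding carr by blast
      show "x = y"
        using inj [OF z(1,3,2,4) eq [unfolded xy f]] unfolding xy by (simp add: cls_eq_iff [OF wf])
    qed
    moreover have "?f ` (carrier H1 \<times> carrier H2) = carrier H"
    proof (intro equalityI subsetI)
      fix y assume "y \<in> ?f ` (carrier H1 \<times> carrier H2)"
      then obtain z w where "z \<in> ?Z1" "w \<in> ?Z2" "y = cls E i j (?a z + gamma w)"
        unfolding carr using f by blast
      moreover from this have "?a z + gamma w \<in> ?Z"
        using Za Zc by (simp add: cycles_iff [OF wfE] keys_add_subset lin_add [OF lin_dtot])
      ultimately show "y \<in> carrier H"
        unfolding carr by blast
    next
      fix y assume "y \<in> carrier H"
      then obtain z where z: "z \<in> ?Z" "y = cls E i j z"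
        unfolding carr by blast
      have "y = ?f (cls D (i + 2) (j + 4) (retract z), cls D (i - 2) (j - 4) (?b z))"
        unfolding f z(2) by (rule dec [OF z(1)])
      then show "y \<in> ?f ` (carrier H1 \<times> carrier H2)"
        unfolding carr using Zr [OF z(1)] Zb [OF z(1)] by blast
    qed
    moreover have "?f \<in> hom (H1 \<times>\<times> H2) H"
    proof (rule homI)
      fix x assume "x \<in> carrier (H1 \<times>\<times> H2)"
      then show "?f x \<in> carrier H"
        using calculation(2) by (auto simp del: case_prod_conv)
    next
      fix x y assume "x \<in> carrier (H1 \<times>\<times> H2)" "y \<in> carrier (H1 \<times>\<times> H2)"
      then obtain z w z' w' where
        xy: "x = (cls D (i + 2) (j + 4) z, cls D (i - 2) (j - 4) w)" "y = (cls D (i + 2) (j + 4) z', cls D (i - 2) (j - 4) w')"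
        unfolding carrier_DirProd carr by blast
      have "x \<otimes>\<^bsub>H1 \<times>\<times> H2\<^esub> y = (cls D (i + 2) (j + 4) (z + z'), cls D (i - 2) (j - 4) (w + w'))"
        unfolding xy mult_DirProd H1_def H2_def mult_homology [OF wf] ..
      then show "?f (x \<otimes>\<^bsub>H1 \<times>\<times> H2\<^esub> y) = ?f x \<otimes>\<^bsub>H\<^esub> ?f y"
        unfolding xy f mult by (simp only: f) (simp add: lin_add [OF lin_a] lin_add [OF lin_gamma] algebra_simps)
    qed
    ultimately show ?thesis
      by (simp add: iso_def bij_betw_def)
  qed
  show ?thesis
    using monA epiB exact homC BC iso by blast
qed

end

theorem theoremX6p2:
  fixes D :: "'a diagram" and p :: "'a place" and ov :: bool and i j :: int
  assumes "link_diagram D" and "is_place D p"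
  shows
    "alpha_h D p ov i j
       \<in> mon (homology D (i + 2) (j + 4)) (homology (hopf_addition D p ov) i j) \<and>
     beta_h D i j
       \<in> epi (homology (hopf_addition D p ov) i j) (homology D (i - 2) (j - 4)) \<and>
     alpha_h D p ov i j ` carrier (homology D (i + 2) (j + 4))
       = kernel (homology (hopf_addition D p ov) i j) (homology D (i - 2) (j - 4)) (beta_h D i j) \<and>
     (\<exists>\<gamma> \<in> hom (homology D (i - 2) (j - 4)) (homology (hopf_addition D p ov) i j).
        (\<forall>x \<in> carrier (homology D (i - 2) (j - 4)). beta_h D i j (\<gamma> x) = x) \<and>
        (\<lambda>(x, y). alpha_h D p ov i j x \<otimes>\<^bsub>homology (hopf_addition D p ov) i j\<^esub> \<gamma> y)
          \<in> iso (homology D (i + 2) (j + 4) \<times>\<times> homology D (i - 2) (j - 4))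
                (homology (hopf_addition D p ov) i j))"
proof -
  interpret hopf D p ov
    using assms by unfold_locales
  \<comment> \<open>The witness for \<gamma> is the map induced on homology by
    \<open>gamma\<close>.\<close>
  show ?thesis
    using splitting [of i j] by blast
qed

end
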